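(* Assume that the meshes and spaces satisfy the assumptions stated in the context, that accepted states satisfy $0<\rho_*\le\rho(\phi_h^\ell)\le\rho^*$ and $0<\eta_*\le\eta(\phi_h^\ell)\le\eta^*$, and that $q^{n+1}>0$. Then the saddle-point scheme of the context satisfies, for $k=1,2$, $$E_{h,k}^{n+1}-E_{h,k}^n+N_{h,k}^{n+1}+\frac{2\tau}{Re}\|(\eta_h^{n+1})^{1/2}D(\boldsymbol u_h^{n+1})\|_{n+1}^2+\frac{\tau q^{n+1}}{Pe\,We\,Cn}\langle m_E^{n+1}\nabla\mu_h^{n+1},\nabla\mu_h^{n+1}\rangle_\times=\tau(\boldsymbol f^{n+1},\boldsymbol u_h^{n+1})_{n+1},$$ where the modified energies are $$E_{h,1}^\ell=\tfrac12\|\boldsymbol g_{0,h}^\ell\|_\ell^2+q^\ell E_{\phi,r,1}^\ell+\tfrac1{2\alpha_q}(q^\ell)^2,$$ $$E_{h,2}^\ell=\tfrac14\bigl[\|\boldsymbol g_{0,h}^\ell\|_\ell^2+\|\boldsymbol g_{1,h}^\ell\|_\ell^2\bigr]+q^\ell E_{\phi,r,2}^\ell+\tfrac1{4\alpha_q}\bigl[(q^\ell)^2+(2q^\ell-q^{\ell-1})^2\bigr],$$ and the polarization remainders are $$N_{h,1}^\ell=\tfrac12\|\boldsymbol\zeta_h^\ell-\boldsymbol g_{0,H}^\ell\|_\ell^2+q^\ell\Bigl[\tfrac1{2We\,Cn}\|\phi_h^\ell-\phi_h^{\ell-1}\|_{Cn,s}^2+\tfrac1{We\,Cn}(r^\ell-r^{\ell-1})^2\Bigr]+\tfrac1{2\alpha_q}(q^\ell-q^{\ell-1})^2,$$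 $$N_{h,2}^\ell=\tfrac14\|\boldsymbol\zeta_h^\ell-\boldsymbol g_{1,H}^\ell\|_\ell^2+q^\ell\Bigl[\tfrac1{4We\,Cn}\|\phi_h^\ell-2\phi_h^{\ell-1}+\phi_h^{\ell-2}\|_{Cn,s}^2+\tfrac1{2We\,Cn}(r^\ell-2r^{\ell-1}+r^{\ell-2})^2\Bigr]+\tfrac1{4\alpha_q}(q^\ell-2q^{\ell-1}+q^{\ell-2})^2.$$
   Context: Domain and spaces. $\Omega\subset\mathbb R^d$ ($d=2,3$) is a fixed bounded polygonal or polyhedral domain, $\partial\Omega=\overline{\Gamma_D}\cup\overline{\Gamma_S}$ with disjoint relative interiors. For each accepted time level $\ell$, $\mathcal T_h^\ell$ is a conforming shape-regular triangulation of $\Omega$ preserving the boundary partition, with finite element spaces $S_h^\ell\subset H^1(\Omega)$, $V_h^\ell\subset\{\boldsymbol v\in[H^1(\Omega)]^d:\boldsymbol v=0\text{ on }\Gamma_D,\ \boldsymbol v\cdot\boldsymbol n=0\text{ on }\Gamma_S\}$, $P_h^\ell\subset L^2(\Omega)$ (finite-dimensional, with functions regular enough, as standard piecewise polynomials are, for all integrals below to be finite), $1\in S_h^\ell\cap P_h^\ell$, and zero-mean subspaces $S_{h,0}^\ell$, $P_{h,0}^\ell$; the velocity--pressure pairs satisfy a uniform discrete inf--sup condition. $(\cdot,\cdot)_\ell$, $\|\cdot\|_\ell$ and the cross-mesh pairing $\langle\cdot,\cdot\rangle_\times$ all denote the $L^2(\Omega)$ inner product/norm (Frobenius product for tensors);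 the notation only records on which mesh(es) the arguments live. $D(\boldsymbol v)=\frac12(\nabla\boldsymbol v+\nabla\boldsymbol v^T)$. Each update $n\to n+1$ is either a fixed-topology (ALE) update or a topology-changing (remeshing) update. For fixed-topology updates there are maps $\boldsymbol X_h^\ell:\widehat\Omega\to\Omega$ from a common reference triangulation onto $\mathcal T_h^\ell$, with uniformly admissible inverses, $\boldsymbol F_h^\ell=\widehat\nabla\boldsymbol X_h^\ell$, $J_h^\ell=\det\boldsymbol F_h^\ell>0$ (a function on $\widehat\Omega$), and a reference scalar space $\widehat S_h$ containing $\chi_h\circ\boldsymbol X_h^\ell$ for $\chi_h\in S_h^\ell$, with zero-mean subspace $\widehat S_{h,0}$. Data. $Cn,Pe,Re,We,\alpha_q>0$, $C_A>0$, time step $\tau>0$; $\rho(\phi)=\rho_0+\rho_\phi\phi$, $\eta(\phi)=\eta_0+\eta_\phi\phi$; mobility $m\ge0$; $F(\phi)=\frac s2\phi^2+G(\phi)$, $s>0$; $C_G>0$; $\boldsymbol f^{n+1}$ a given force. $k\in\{1,2\}$ ($n\ge1$ if $k=2$; the first step uses $k=1$), $\gamma_1=1$, $\gamma_2=3/2$. For any history $z$: $z_H^{n+1}=z^n$, $z_E^{n+1}=z^n$ if $k=1$; $z_H^{n+1}=(4z^n-z^{n-1})/3$, $z_E^{n+1}=2z^n-z^{n-1}$ if $k=2$; $D_\tau^{(k)}z^{n+1}=\frac{\gamma_k}\tau(z^{n+1}-z_H^{n+1})$. $\|v\|_{Cn,s}^2=Cn^2\|\nabla v\|^2+s\|v\|^2$.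 All previous accepted states are given; initially $r^0=((G(\phi_h^0),1)_0+C_G)^{1/2}$, $q^0=1$. Step 1 (histories). $m_E^{n+1}=m(\phi_E^{n+1})$, and $\phi_{H,h}^{n+1}\in S_h^{n+1}$ solves $Cn^2(\nabla\phi_{H,h}^{n+1},\nabla\chi_h)_{n+1}+s(\phi_{H,h}^{n+1},\chi_h)_{n+1}=Cn^2\langle\nabla\phi_H^{n+1},\nabla\chi_h\rangle_\times+s\langle\phi_H^{n+1},\chi_h\rangle_\times$ for all $\chi_h\in S_h^{n+1}$. With $\boldsymbol\zeta_h^\ell=(\rho_h^\ell)^{1/2}\boldsymbol u_h^\ell$, the kinetic histories $\boldsymbol g_{j,h}^n$ ($j=0$, and $j=1$ if $k=2$) are transferred by $\boldsymbol g_{j,H}^{n+1}=[(J_h^{n+1})^{-1/2}(J_h^n)^{1/2}(\boldsymbol g_{j,h}^n\circ\boldsymbol X_h^n)]\circ(\boldsymbol X_h^{n+1})^{-1}$ (fixed topology), or by $\boldsymbol g_{j,H}^{n+1}=\frac{\|\boldsymbol g_{j,h}^n\|_n}{\|\mathcal P\boldsymbol g_{j,h}^n\|_{n+1}}\mathcal P\boldsymbol g_{j,h}^n$ (topology change; $=0$ if $\boldsymbol g_{j,h}^n=0$), where $\mathcal P$ is the $L^2$-orthogonal projection onto a chosen piecewise-polynomial history space on $\mathcal T_h^{n+1}$ and it is assumed that $\mathcal P\boldsymbol g_{j,h}^n\ne0$ whenever $\boldsymbol g_{j,h}^n\ne0$. Then $\boldsymbol\zeta_{H,h}^{n+1}=\boldsymbol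 g_{0,H}^{n+1}$ ($k=1$), $\boldsymbol\zeta_{H,h}^{n+1}=\frac13(2\boldsymbol g_{0,H}^{n+1}+\boldsymbol g_{1,H}^{n+1})$ ($k=2$). After the step one sets $\boldsymbol g_{0,h}^{n+1}=\boldsymbol\zeta_h^{n+1}$ and (at each BDF2 level, and at level $1$ after the BE start-up) $\boldsymbol g_{1,h}^{n+1}=2\boldsymbol\zeta_h^{n+1}-\boldsymbol g_{0,H}^{n+1}$. Step 2 (carrier). Topology change: with $\boldsymbol u_{E,h}^{n+1}$ the extrapolation of the accepted velocities, find $\lambda_h^{n+1}\in S_{h,0}^{n+1}$ with $(\nabla\lambda_h^{n+1},\nabla\chi_h)_{n+1}=\langle\boldsymbol u_{E,h}^{n+1},\nabla\chi_h\rangle_\times$ for all $\chi_h\in S_{h,0}^{n+1}$ and set $\boldsymbol u_{c,h}^{n+1}=\boldsymbol u_{E,h}^{n+1}-\nabla\lambda_h^{n+1}$. Fixed topology: with $\widehat{\boldsymbol u}_h^m=J_h^m(\boldsymbol F_h^m)^{-1}(\boldsymbol u_h^m\circ\boldsymbol X_h^m)$ and $\widehat{\boldsymbol u}_E^{n+1}$ their extrapolation, find $\widehat\lambda_h^{n+1}\in\widehat S_{h,0}$ with $(\widehat\nabla\widehat\lambda_h^{n+1},\widehat\nabla\widehat\chi_h)_{\widehat\Omega}=(\widehat{\boldsymbol u}_E^{n+1},\widehat\nabla\widehat\chi_h)_{\widehat\Omega}$ for all $\widehat\chi_h\in\widehat S_{h,0}$ and set $\boldsymbol u_{c,h}^{n+1}\circ\boldsymbol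 X_h^{n+1}=\frac1{J_h^{n+1}}\boldsymbol F_h^{n+1}(\widehat{\boldsymbol u}_E^{n+1}-\widehat\nabla\widehat\lambda_h^{n+1})$. In either case $\langle\boldsymbol u_{c,h}^{n+1},\nabla\chi_h\rangle_\times=0$ for all $\chi_h\in S_h^{n+1}$. Step 3 (phase--SAV). With $U_E^{n+1}=(\langle G(\phi_E^{n+1}),1\rangle_\times+C_G)^{1/2}>0$, find $(\phi_h^{n+1},\mu_h^{n+1},r^{n+1})\in S_h^{n+1}\times S_h^{n+1}\times\mathbb R$ such that for all $\omega_h,\chi_h\in S_h^{n+1}$ $$\bigl(\tfrac{\gamma_k}\tau(\phi_h^{n+1}-\phi_{H,h}^{n+1}),\omega_h\bigr)_{n+1}-\langle\phi_E^{n+1}\boldsymbol u_{c,h}^{n+1},\nabla\omega_h\rangle_\times+\tfrac1{Pe}\langle m_E^{n+1}\nabla\mu_h^{n+1},\nabla\omega_h\rangle_\times=0,$$ $$(\mu_h^{n+1},\chi_h)_{n+1}=Cn^2(\nabla\phi_h^{n+1},\nabla\chi_h)_{n+1}+s(\phi_h^{n+1},\chi_h)_{n+1}+\tfrac{r^{n+1}}{U_E^{n+1}}\langle G'(\phi_E^{n+1}),\chi_h\rangle_\times,$$ $$D_\tau^{(k)}r^{n+1}=\tfrac1{2U_E^{n+1}}\bigl\langle G'(\phi_E^{n+1}),\tfrac{\gamma_k}\tau(\phi_h^{n+1}-\phi_{H,h}^{n+1})\bigr\rangle_\times.$$ Set $\rho_h^{n+1}=\rho(\phi_h^{n+1})$,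 $\eta_h^{n+1}=\eta(\phi_h^{n+1})$, $\rho_E^{n+1}=\rho(\phi_E^{n+1})$, $\boldsymbol J_{\rho,h}^{n+1}=\rho_E^{n+1}\boldsymbol u_{c,h}^{n+1}-\frac{\rho_\phi}{Pe}m_E^{n+1}\nabla\mu_h^{n+1}$; let $\boldsymbol w_h^{n+1,(k)}=[D_\tau^{(k)}\boldsymbol X_h^{n+1}]\circ(\boldsymbol X_h^{n+1})^{-1}$ for a fixed-topology update and $0$ for a topology-changing step; and $$C_{\rho,h}^{n+1}(\boldsymbol v,\boldsymbol z)=\tfrac12\bigl[\langle(\boldsymbol J_{\rho,h}^{n+1}-\rho_h^{n+1}\boldsymbol w_h^{n+1,(k)})\cdot\nabla\boldsymbol v,\boldsymbol z\rangle_\times-\langle(\boldsymbol J_{\rho,h}^{n+1}-\rho_h^{n+1}\boldsymbol w_h^{n+1,(k)})\cdot\nabla\boldsymbol z,\boldsymbol v\rangle_\times\bigr].$$ Also $E_{\phi,r,1}^\ell=\frac1{2We\,Cn}\|\phi_h^\ell\|_{Cn,s}^2+\frac1{We\,Cn}(r^\ell)^2+C_A$ and $E_{\phi,r,2}^\ell=\frac1{4We\,Cn}[\|\phi_h^\ell\|_{Cn,s}^2+\|2\phi_h^\ell-\phi_h^{\ell-1}\|_{Cn,s}^2]+\frac1{2We\,Cn}[(r^\ell)^2+(2r^\ell-r^{\ell-1})^2]+C_A$. Saddle-point scheme (after Steps 1--3). Find $(\boldsymbol u_h^{n+1},p_h^{n+1},q^{n+1})\in V_h^{n+1}\times P_{h,0}^{n+1}\times\mathbb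 R_{>0}$ such that for all $\boldsymbol v_h\in V_h^{n+1}$, $\alpha_h\in P_{h,0}^{n+1}$ $$\tfrac{\gamma_k}\tau((\rho_h^{n+1})^{1/2}\boldsymbol u_h^{n+1}-\boldsymbol\zeta_{H,h}^{n+1},(\rho_h^{n+1})^{1/2}\boldsymbol v_h)_{n+1}+C_{\rho,h}^{n+1}(\boldsymbol u_h^{n+1},\boldsymbol v_h)+\tfrac2{Re}(\eta_h^{n+1}D(\boldsymbol u_h^{n+1}),D(\boldsymbol v_h))_{n+1}-(p_h^{n+1},\nabla\cdot\boldsymbol v_h)_{n+1}$$ $$=(\boldsymbol f^{n+1},\boldsymbol v_h)_{n+1}-\tfrac{q^{n+1}}{We\,Cn}(\phi_h^{n+1}\nabla\mu_h^{n+1},\boldsymbol v_h)_{n+1},\qquad(\nabla\cdot\boldsymbol u_h^{n+1},\alpha_h)_{n+1}=0,$$ $$\tfrac{\gamma_kq^{n+1}}{\alpha_q\tau}(q^{n+1}-q_H^{n+1})+\tfrac{q^{n+1}-q^n}\tau E_{\phi,r,k}^n+\tfrac{q^{n+1}}{We\,Cn}\langle\phi_E^{n+1}\boldsymbol u_{c,h}^{n+1},\nabla\mu_h^{n+1}\rangle_\times-\tfrac{q^{n+1}}{We\,Cn}(\phi_h^{n+1}\nabla\mu_h^{n+1},\boldsymbol u_h^{n+1})_{n+1}=0.$$ *)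

theory Defs
  imports "HOL-Analysis.Analysis"
begin

section \<open>Lebesgue and Sobolev spaces on an open set\<close>

text \<open>Functions live on all of \<open>real ^ 'd\<close>; only their restriction to the domain, up to null sets,
  matters. The same pairing serves scalars, vectors and matrices: the inner product of
  \<open>real ^ 'd ^ 'd\<close> is the Frobenius product.\<close>

definition L2 :: "(real ^ 'd) set \<Rightarrow> (real ^ 'd \<Rightarrow> 'b::euclidean_space) set" where
  "L2 \<Omega> = {f. f \<in> borel_measurable (lebesgue_on \<Omega>) \<and>
                integrable (lebesgue_on \<Omega>) (\<lambda>x. (norm (f x))\<^sup>2)}"

definition ip :: "(real ^ 'd) set \<Rightarrow> (real ^ 'd \<Rightarrow> 'b::euclidean_space) \<Rightarrow> (real ^ 'd \<Rightarrow> 'b) \<Rightarrow> real" where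
  "ip \<Omega> f g = (LINT x|lebesgue_on \<Omega>. f x \<bullet> g x)"

definition L2norm :: "(real ^ 'd) set \<Rightarrow> (real ^ 'd \<Rightarrow> 'b::euclidean_space) \<Rightarrow> real" where
  "L2norm \<Omega> f = sqrt (ip \<Omega> f f)"

text \<open>\<open>\<psi>\<close> is a compactly supported \<open>C\<^sup>1\<close> function on the open set \<open>U\<close>, with gradient \<open>d\<psi>\<close>.\<close>

definition test_function ::
    "(real ^ 'd) set \<Rightarrow> (real ^ 'd \<Rightarrow> real) \<Rightarrow> (real ^ 'd \<Rightarrow> real ^ 'd) \<Rightarrow> bool" where
  "test_function U \<psi> d\<psi> \<longleftrightarrow>
     (\<forall>x. (\<psi> has_derivative (\<lambda>h. d\<psi> x \<bullet> h)) (at x)) \<and> continuous_on UNIV d\<psi> \<and>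
     (\<exists>K. compact K \<and> K \<subseteq> U \<and> (\<forall>x. x \<notin> K \<longrightarrow> \<psi> x = 0))"

definition weak_gradient ::
    "(real ^ 'd) set \<Rightarrow> (real ^ 'd \<Rightarrow> real) \<Rightarrow> (real ^ 'd \<Rightarrow> real ^ 'd) \<Rightarrow> bool" where
  "weak_gradient \<Omega> v g \<longleftrightarrow>
     (\<forall>\<psi> d\<psi>. test_function \<Omega> \<psi> d\<psi> \<longrightarrow>
        (LINT x|lebesgue_on \<Omega>. v x *\<^sub>R d\<psi> x) = - (LINT x|lebesgue_on \<Omega>. \<psi> x *\<^sub>R g x))"

definition H1 :: "(real ^ 'd) set \<Rightarrow> (real ^ 'd \<Rightarrow> real) set" where
  "H1 \<Omega> = {v \<in> L2 \<Omega>. \<exists>g \<in> L2 \<Omega>. weak_gradient \<Omega> v g}"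

text \<open>The weak gradient of an \<open>H\<^sup>1\<close> function is unique up to null sets; \<open>grad\<close> selects a
  representative.\<close>

definition grad :: "(real ^ 'd) set \<Rightarrow> (real ^ 'd \<Rightarrow> real) \<Rightarrow> real ^ 'd \<Rightarrow> real ^ 'd" where
  "grad \<Omega> v = (SOME g. g \<in> L2 \<Omega> \<and> weak_gradient \<Omega> v g)"

definition H1vec :: "(real ^ 'd) set \<Rightarrow> (real ^ 'd \<Rightarrow> real ^ 'd) set" where
  "H1vec \<Omega> = {v. \<forall>i. (\<lambda>x. v x $ i) \<in> H1 \<Omega>}"

text \<open>Row \<open>i\<close> of \<open>jac \<Omega> v x\<close> is the gradient of the component \<open>v\<^sub>i\<close>, so that
  \<open>(a \<cdot> \<nabla>) v\<close> is \<open>jac \<Omega> v x *v a x\<close>.\<close>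

definition jac :: "(real ^ 'd) set \<Rightarrow> (real ^ 'd \<Rightarrow> real ^ 'd) \<Rightarrow> real ^ 'd \<Rightarrow> real ^ 'd ^ 'd" where
  "jac \<Omega> v x = (\<chi> i. grad \<Omega> (\<lambda>y. v y $ i) x)"

definition divg :: "(real ^ 'd) set \<Rightarrow> (real ^ 'd \<Rightarrow> real ^ 'd) \<Rightarrow> real ^ 'd \<Rightarrow> real" where
  "divg \<Omega> v x = trace (jac \<Omega> v x)"

definition symgrad :: "(real ^ 'd) set \<Rightarrow> (real ^ 'd \<Rightarrow> real ^ 'd) \<Rightarrow> real ^ 'd \<Rightarrow> real ^ 'd ^ 'd" where
  "symgrad \<Omega> v x = (1/2) *\<^sub>R (jac \<Omega> v x + transpose (jac \<Omega> v x))"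

definition H1norm :: "(real ^ 'd) set \<Rightarrow> (real ^ 'd \<Rightarrow> real ^ 'd) \<Rightarrow> real" where
  "H1norm \<Omega> v = sqrt ((L2norm \<Omega> v)\<^sup>2 + (L2norm \<Omega> (jac \<Omega> v))\<^sup>2)"

text \<open>Boundary values of \<open>H\<^sup>1\<close> fields, in the sense of traces. By Green's formula the integrals
  below are the boundary integrals of \<open>\<psi> v\<^sub>i n\<close> and of \<open>\<psi> v \<cdot> n\<close>; the test functions are those
  whose support stays away from the part of the boundary outside \<open>\<Gamma>\<close>.\<close>

definition zero_trace_on ::
    "(real ^ 'd) set \<Rightarrow> (real ^ 'd) set \<Rightarrow> (real ^ 'd \<Rightarrow> real ^ 'd) \<Rightarrow> bool" where
  "zero_trace_on \<Omega> \<Gamma> v \<longleftrightarrow>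
     (\<forall>\<psi> d\<psi> i. test_function (- closure (frontier \<Omega> - \<Gamma>)) \<psi> d\<psi> \<longrightarrow>
        (LINT x|lebesgue_on \<Omega>. (v x $ i) *\<^sub>R d\<psi> x + \<psi> x *\<^sub>R (jac \<Omega> v x $ i)) = 0)"

definition zero_normal_trace_on ::
    "(real ^ 'd) set \<Rightarrow> (real ^ 'd) set \<Rightarrow> (real ^ 'd \<Rightarrow> real ^ 'd) \<Rightarrow> bool" where
  "zero_normal_trace_on \<Omega> \<Gamma> v \<longleftrightarrow>
     (\<forall>\<psi> d\<psi>. test_function (- closure (frontier \<Omega> - \<Gamma>)) \<psi> d\<psi> \<longrightarrow>
        (LINT x|lebesgue_on \<Omega>. v x \<bullet> d\<psi> x + \<psi> x * divg \<Omega> v x) = 0)"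

section \<open>Domain, meshes and discrete spaces\<close>

definition polyhedral_domain :: "(real ^ 'd) set \<Rightarrow> bool" where
  "polyhedral_domain \<Omega> \<longleftrightarrow>
     open \<Omega> \<and> connected \<Omega> \<and> bounded \<Omega> \<and> \<Omega> \<noteq> {} \<and> \<Omega> = interior (closure \<Omega>) \<and>
     (\<exists>F. finite F \<and> (\<forall>K\<in>F. polytope K) \<and> closure \<Omega> = \<Union>F)"

definition boundary_partition ::
    "(real ^ 'd) set \<Rightarrow> (real ^ 'd) set \<Rightarrow> (real ^ 'd) set \<Rightarrow> bool" where
  "boundary_partition \<Omega> \<Gamma>D \<Gamma>S \<longleftrightarrow>
     \<Gamma>D \<subseteq> frontier \<Omega> \<and> \<Gamma>S \<subseteq> frontier \<Omega> \<and> frontier \<Omega> = closure \<Gamma>D \<union> closure \<Gamma>S \<and>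
     (top_of_set (frontier \<Omega>) interior_of \<Gamma>D) \<inter> (top_of_set (frontier \<Omega>) interior_of \<Gamma>S) = {}"

text \<open>Conformity (two elements meet in a common face or not at all) is part of
  \<^const>\<open>triangulation\<close>.\<close>

definition conforming_mesh :: "(real ^ 'd) set \<Rightarrow> (real ^ 'd) set set \<Rightarrow> bool" where
  "conforming_mesh \<Omega> T \<longleftrightarrow>
     triangulation T \<and> (\<forall>K\<in>T. int CARD('d) simplex K) \<and> \<Union>T = closure \<Omega>"

text \<open>\<open>\<kappa>\<close> bounds the ratio of the diameter of an element to its inradius.\<close>

definition shape_regular :: "real \<Rightarrow> (real ^ 'd) set set \<Rightarrow> bool" where
  "shape_regular \<kappa> T \<longleftrightarrow> (\<forall>K\<in>T. \<exists>z. cball z (diameter K / \<kappa>) \<subseteq> K)"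

definition preserves_partition ::
    "(real ^ 'd) set \<Rightarrow> (real ^ 'd) set \<Rightarrow> (real ^ 'd) set \<Rightarrow> (real ^ 'd) set set \<Rightarrow> bool" where
  "preserves_partition \<Omega> \<Gamma>D \<Gamma>S T \<longleftrightarrow>
     (\<forall>K\<in>T. \<forall>e. e facet_of K \<and> e \<subseteq> frontier \<Omega> \<longrightarrow> e \<subseteq> closure \<Gamma>D \<or> e \<subseteq> closure \<Gamma>S)"

text \<open>A finite-dimensional space of functions on \<open>\<Omega>\<close> modulo null sets, represented by the set of
  all representatives of its elements.\<close>

definition fin_dim_space :: "(real ^ 'd) set \<Rightarrow> (real ^ 'd \<Rightarrow> 'b::euclidean_space) set \<Rightarrow> bool" where
  "fin_dim_space \<Omega> W \<longleftrightarrow>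
     (\<exists>B. finite B \<and> W = {v. \<exists>c. AE x in lebesgue_on \<Omega>. v x = (\<Sum>b\<in>B. c b *\<^sub>R b x)})"

definition zero_mean :: "(real ^ 'd) set \<Rightarrow> (real ^ 'd \<Rightarrow> real) set \<Rightarrow> (real ^ 'd \<Rightarrow> real) set" where
  "zero_mean \<Omega> W = {v \<in> W. (LINT x|lebesgue_on \<Omega>. v x) = 0}"

definition piecewise_polynomial :: "(real ^ 'd) set set \<Rightarrow> (real ^ 'd \<Rightarrow> real ^ 'd) \<Rightarrow> bool" where
  "piecewise_polynomial T v \<longleftrightarrow>
     (\<forall>K\<in>T. \<exists>p. polynomial_function p \<and> (AE x in lebesgue_on K. v x = p x))"

definition L2proj ::
    "(real ^ 'd) set \<Rightarrow> (real ^ 'd \<Rightarrow> 'b::euclidean_space) set \<Rightarrow> (real ^ 'd \<Rightarrow> 'b) \<Rightarrow> real ^ 'd \<Rightarrow> 'b" where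
  "L2proj \<Omega> W g = (SOME p. p \<in> W \<and> (\<forall>w\<in>W. ip \<Omega> (\<lambda>x. g x - p x) w = 0))"

text \<open>Index \<open>l\<close> is the time level, and update \<open>n\<close> leads from level \<open>n\<close> to level \<open>n + 1\<close>. The
  reference data \<open>OmegaHat\<close>, \<open>ThHat\<close>, \<open>ShHat\<close> and the map \<open>Xh\<close> are attached to levels because a
  remeshing starts a new reference configuration; they are constrained only at levels that take
  part in a fixed-topology update. \<open>Hh\<close> holds the history spaces for the kinetic projections.\<close>

record ('d::finite) discretization =
  Omega :: "(real ^ 'd) set"
  GammaD :: "(real ^ 'd) set"
  GammaS :: "(real ^ 'd) set"
  Th :: "nat \<Rightarrow> (real ^ 'd) set set"
  Sh :: "nat \<Rightarrow> (real ^ 'd \<Rightarrow> real) set"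
  Vh :: "nat \<Rightarrow> (real ^ 'd \<Rightarrow> real ^ 'd) set"
  Ph :: "nat \<Rightarrow> (real ^ 'd \<Rightarrow> real) set"
  Hh :: "nat \<Rightarrow> (real ^ 'd \<Rightarrow> real ^ 'd) set"
  remesh :: "nat \<Rightarrow> bool"
  OmegaHat :: "nat \<Rightarrow> (real ^ 'd) set"
  ThHat :: "nat \<Rightarrow> (real ^ 'd) set set"
  ShHat :: "nat \<Rightarrow> (real ^ 'd \<Rightarrow> real) set"
  Xh :: "nat \<Rightarrow> real ^ 'd \<Rightarrow> real ^ 'd"

abbreviation Sh0 :: "'d::finite discretization \<Rightarrow> nat \<Rightarrow> (real ^ 'd \<Rightarrow> real) set" where
  "Sh0 D l \<equiv> zero_mean (Omega D) (Sh D l)"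

abbreviation Ph0 :: "'d::finite discretization \<Rightarrow> nat \<Rightarrow> (real ^ 'd \<Rightarrow> real) set" where
  "Ph0 D l \<equiv> zero_mean (Omega D) (Ph D l)"

abbreviation ShHat0 :: "'d::finite discretization \<Rightarrow> nat \<Rightarrow> (real ^ 'd \<Rightarrow> real) set" where
  "ShHat0 D l \<equiv> zero_mean (OmegaHat D l) (ShHat D l)"

definition admissible_mesh :: "'d::finite discretization \<Rightarrow> real \<Rightarrow> nat \<Rightarrow> bool" where
  "admissible_mesh D \<kappa> l \<longleftrightarrow>
     conforming_mesh (Omega D) (Th D l) \<and> shape_regular \<kappa> (Th D l) \<and>
     preserves_partition (Omega D) (GammaD D) (GammaS D) (Th D l)"

definition admissible_spaces :: "'d::finite discretization \<Rightarrow> nat \<Rightarrow> bool" where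
  "admissible_spaces D l \<longleftrightarrow>
     fin_dim_space (Omega D) (Sh D l) \<and> fin_dim_space (Omega D) (Vh D l) \<and>
     fin_dim_space (Omega D) (Ph D l) \<and>
     Sh D l \<subseteq> H1 (Omega D) \<and>
     Vh D l \<subseteq> {v \<in> H1vec (Omega D). zero_trace_on (Omega D) (GammaD D) v \<and>
                                   zero_normal_trace_on (Omega D) (GammaS D) v} \<and>
     Ph D l \<subseteq> L2 (Omega D) \<and>
     (\<lambda>_. 1) \<in> Sh D l \<inter> Ph D l"

text \<open>Extended reals make the infimum and supremum meaningful on every set.\<close>

definition inf_sup_condition :: "'d::finite discretization \<Rightarrow> real \<Rightarrow> nat \<Rightarrow> bool" where
  "inf_sup_condition D \<beta> l \<longleftrightarrow>
     ereal \<beta> \<le> (INF a \<in> {a \<in> Ph0 D l. L2norm (Omega D) a \<noteq> 0}.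
                  SUP v \<in> {v \<in> Vh D l. H1norm (Omega D) v \<noteq> 0}.
                    ereal (ip (Omega D) (divg (Omega D) v) a /
                           (H1norm (Omega D) v * L2norm (Omega D) a)))"

definition Fh :: "'d::finite discretization \<Rightarrow> nat \<Rightarrow> real ^ 'd \<Rightarrow> real ^ 'd ^ 'd" where
  "Fh D l y = matrix (frechet_derivative (Xh D l) (at y))"

definition Jh :: "'d::finite discretization \<Rightarrow> nat \<Rightarrow> real ^ 'd \<Rightarrow> real" where
  "Jh D l y = det (Fh D l y)"

definition Xinv :: "'d::finite discretization \<Rightarrow> nat \<Rightarrow> real ^ 'd \<Rightarrow> real ^ 'd" where
  "Xinv D l = inv_into (OmegaHat D l) (Xh D l)"

text \<open>The map of level \<open>l\<close> is a bi-Lipschitz homeomorphism with constant \<open>L\<close>, continuously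
  differentiable with positive Jacobian inside every reference element, and takes the reference
  triangulation onto the mesh of level \<open>l\<close>.\<close>

definition admissible_map :: "'d::finite discretization \<Rightarrow> real \<Rightarrow> nat \<Rightarrow> bool" where
  "admissible_map D L l \<longleftrightarrow>
     polyhedral_domain (OmegaHat D l) \<and> conforming_mesh (OmegaHat D l) (ThHat D l) \<and>
     bij_betw (Xh D l) (OmegaHat D l) (Omega D) \<and>
     bij_betw (Xh D l) (closure (OmegaHat D l)) (closure (Omega D)) \<and>
     L-lipschitz_on (closure (OmegaHat D l)) (Xh D l) \<and>
     L-lipschitz_on (closure (Omega D)) (inv_into (closure (OmegaHat D l)) (Xh D l)) \<and>
     (`) (Xh D l) ` ThHat D l = Th D l \<and>
     (\<forall>K\<in>ThHat D l. continuous_on (interior K) (Fh D l) \<and>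
        (\<forall>y\<in>interior K. Xh D l differentiable (at y) \<and> Jh D l y > 0)) \<and>
     fin_dim_space (OmegaHat D l) (ShHat D l) \<and> ShHat D l \<subseteq> H1 (OmegaHat D l) \<and>
     (\<forall>\<xi>\<in>Sh D l. \<xi> \<circ> Xh D l \<in> ShHat D l)"

text \<open>Levels entering update \<open>n\<close> of a run of order \<open>k\<close>; update \<open>0\<close> is always backward Euler.\<close>

definition update_levels :: "nat \<Rightarrow> nat \<Rightarrow> nat set" where
  "update_levels k n = (if k = 2 \<and> n \<ge> 1 then {n - 1, n, n + 1} else {n, n + 1})"

definition fixed_topology_update :: "'d::finite discretization \<Rightarrow> real \<Rightarrow> nat \<Rightarrow> nat \<Rightarrow> bool" where
  "fixed_topology_update D L k n \<longleftrightarrow>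
     (\<forall>m\<in>update_levels k n. admissible_map D L m \<and> OmegaHat D m = OmegaHat D (n + 1) \<and>
        ThHat D m = ThHat D (n + 1) \<and> ShHat D m = ShHat D (n + 1))"

section \<open>Physical data and discrete states\<close>

text \<open>\<open>rho0 + rho1 * x\<close> and \<open>eta0 + eta1 * x\<close> are the density and viscosity laws, \<open>mob\<close> the
  mobility, \<open>Fpot\<close> the potential and \<open>stab\<close> the coefficient \<open>s\<close> of its quadratic part.\<close>

record params =
  Cn :: real
  Pe :: real
  Rey :: real
  We :: real
  alpha_q :: real
  C_A :: real
  C_G :: real
  tau :: real
  stab :: real
  rho0 :: real
  rho1 :: real
  eta0 :: real
  eta1 :: real
  mob :: "real \<Rightarrow> real"
  Fpot :: "real \<Rightarrow> real"

definition rho :: "params \<Rightarrow> real \<Rightarrow> real" where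
  "rho P x = rho0 P + rho1 P * x"

definition eta :: "params \<Rightarrow> real \<Rightarrow> real" where
  "eta P x = eta0 P + eta1 P * x"

definition Gpot :: "params \<Rightarrow> real \<Rightarrow> real" where
  "Gpot P x = Fpot P x - stab P / 2 * x\<^sup>2"

definition admissible_params :: "params \<Rightarrow> bool" where
  "admissible_params P \<longleftrightarrow>
     Cn P > 0 \<and> Pe P > 0 \<and> Rey P > 0 \<and> We P > 0 \<and> alpha_q P > 0 \<and> C_A P > 0 \<and> C_G P > 0 \<and>
     tau P > 0 \<and> stab P > 0 \<and> (\<forall>x. mob P x \<ge> 0) \<and>
     (\<forall>x. Gpot P differentiable (at x))"

record ('d::finite) states =
  phi :: "nat \<Rightarrow> real ^ 'd \<Rightarrow> real"
  mu :: "nat \<Rightarrow> real ^ 'd \<Rightarrow> real"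
  vel :: "nat \<Rightarrow> real ^ 'd \<Rightarrow> real ^ 'd"
  prs :: "nat \<Rightarrow> real ^ 'd \<Rightarrow> real"
  sav :: "nat \<Rightarrow> real"
  qs :: "nat \<Rightarrow> real"

definition gam :: "nat \<Rightarrow> real" where
  "gam k = (if k = 1 then 1 else 3/2)"

definition hist :: "nat \<Rightarrow> (nat \<Rightarrow> 'a::real_vector) \<Rightarrow> nat \<Rightarrow> 'a" where
  "hist k z n = (if k = 1 then z n else (1/3) *\<^sub>R (4 *\<^sub>R z n - z (n - 1)))"

definition extrap :: "nat \<Rightarrow> (nat \<Rightarrow> 'a::real_vector) \<Rightarrow> nat \<Rightarrow> 'a" where
  "extrap k z n = (if k = 1 then z n else 2 *\<^sub>R z n - z (n - 1))"

text \<open>The value at level \<open>n + 1\<close> of the discrete time derivative.\<close>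

definition Dtau :: "params \<Rightarrow> nat \<Rightarrow> (nat \<Rightarrow> 'a::real_vector) \<Rightarrow> nat \<Rightarrow> 'a" where
  "Dtau P k z n = (gam k / tau P) *\<^sub>R (z (n + 1) - hist k z n)"

definition cns_norm2 :: "params \<Rightarrow> (real ^ 'd) set \<Rightarrow> (real ^ 'd \<Rightarrow> real) \<Rightarrow> real" where
  "cns_norm2 P \<Omega> v = (Cn P)\<^sup>2 * (L2norm \<Omega> (grad \<Omega> v))\<^sup>2 + stab P * (L2norm \<Omega> v)\<^sup>2"

definition phiH :: "'d::finite states \<Rightarrow> nat \<Rightarrow> nat \<Rightarrow> real ^ 'd \<Rightarrow> real" where
  "phiH Y k n x = hist k (\<lambda>m. phi Y m x) n"

definition phiE :: "'d::finite states \<Rightarrow> nat \<Rightarrow> nat \<Rightarrow> real ^ 'd \<Rightarrow> real" where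
  "phiE Y k n x = extrap k (\<lambda>m. phi Y m x) n"

definition initial_values :: "params \<Rightarrow> 'd::finite discretization \<Rightarrow> 'd states \<Rightarrow> bool" where
  "initial_values P D Y \<longleftrightarrow>
     integrable (lebesgue_on (Omega D)) (\<lambda>x. Gpot P (phi Y 0 x)) \<and>
     0 \<le> ip (Omega D) (\<lambda>x. Gpot P (phi Y 0 x)) (\<lambda>_. 1) + C_G P \<and>
     sav Y 0 = sqrt (ip (Omega D) (\<lambda>x. Gpot P (phi Y 0 x)) (\<lambda>_. 1) + C_G P) \<and>
     qs Y 0 = 1"

section \<open>Histories\<close>

definition projected_history ::
    "params \<Rightarrow> 'd::finite discretization \<Rightarrow> 'd states \<Rightarrow> nat \<Rightarrow> nat \<Rightarrow> (real ^ 'd \<Rightarrow> real) \<Rightarrow> bool" where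
  "projected_history P D Y k n \<phi>Hh \<longleftrightarrow>
     \<phi>Hh \<in> Sh D (n + 1) \<and>
     (\<forall>\<xi>\<in>Sh D (n + 1).
        (Cn P)\<^sup>2 * ip (Omega D) (grad (Omega D) \<phi>Hh) (grad (Omega D) \<xi>)
          + stab P * ip (Omega D) \<phi>Hh \<xi>
        = (Cn P)\<^sup>2 * ip (Omega D) (grad (Omega D) (phiH Y k n)) (grad (Omega D) \<xi>)
          + stab P * ip (Omega D) (phiH Y k n) \<xi>)"

definition zeta :: "params \<Rightarrow> 'd::finite states \<Rightarrow> nat \<Rightarrow> real ^ 'd \<Rightarrow> real ^ 'd" where
  "zeta P Y l x = sqrt (rho P (phi Y l x)) *\<^sub>R vel Y l x"

text \<open>Transfer of a kinetic history from level \<open>n\<close> to level \<open>n + 1\<close>.\<close>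

definition transfer ::
    "'d::finite discretization \<Rightarrow> nat \<Rightarrow> (real ^ 'd \<Rightarrow> real ^ 'd) \<Rightarrow> real ^ 'd \<Rightarrow> real ^ 'd" where
  "transfer D n g =
     (if remesh D n then
        (if L2norm (Omega D) g = 0 then (\<lambda>_. 0)
         else (\<lambda>x. (L2norm (Omega D) g / L2norm (Omega D) (L2proj (Omega D) (Hh D (n + 1)) g))
                     *\<^sub>R L2proj (Omega D) (Hh D (n + 1)) g x))
      else (\<lambda>x. let y = Xinv D (n + 1) x in
              (1 / sqrt (Jh D (n + 1) y) * sqrt (Jh D n y)) *\<^sub>R g (Xh D n y)))"

text \<open>\<open>g0H\<close> and \<open>g1H\<close> at level \<open>l \<ge> 1\<close> are the histories of level \<open>l - 1\<close> transferred to level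
  \<open>l\<close>; \<open>g1\<close> is meaningful from level \<open>1\<close> on.\<close>

definition g0 :: "params \<Rightarrow> 'd::finite states \<Rightarrow> nat \<Rightarrow> real ^ 'd \<Rightarrow> real ^ 'd" where
  "g0 P Y l = zeta P Y l"

definition g0H :: "params \<Rightarrow> 'd::finite discretization \<Rightarrow> 'd states \<Rightarrow> nat \<Rightarrow> real ^ 'd \<Rightarrow> real ^ 'd" where
  "g0H P D Y l = transfer D (l - 1) (g0 P Y (l - 1))"

definition g1 :: "params \<Rightarrow> 'd::finite discretization \<Rightarrow> 'd states \<Rightarrow> nat \<Rightarrow> real ^ 'd \<Rightarrow> real ^ 'd" where
  "g1 P D Y l x = 2 *\<^sub>R zeta P Y l x - g0H P D Y l x"

definition g1H :: "params \<Rightarrow> 'd::finite discretization \<Rightarrow> 'd states \<Rightarrow> nat \<Rightarrow> real ^ 'd \<Rightarrow> real ^ 'd" where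
  "g1H P D Y l = transfer D (l - 1) (g1 P D Y (l - 1))"

definition zetaH ::
    "params \<Rightarrow> 'd::finite discretization \<Rightarrow> 'd states \<Rightarrow> nat \<Rightarrow> nat \<Rightarrow> real ^ 'd \<Rightarrow> real ^ 'd" where
  "zetaH P D Y k l x =
     (if k = 1 then g0H P D Y l x else (1/3) *\<^sub>R (2 *\<^sub>R g0H P D Y l x + g1H P D Y l x))"

text \<open>Standing assumption on the history spaces of a topology-changing update \<open>n\<close> of a run of
  order \<open>k\<close>.\<close>

definition remeshing_update ::
    "params \<Rightarrow> 'd::finite discretization \<Rightarrow> 'd states \<Rightarrow> nat \<Rightarrow> nat \<Rightarrow> bool" where
  "remeshing_update P D Y k n \<longleftrightarrow>
     fin_dim_space (Omega D) (Hh D (n + 1)) \<and>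
     (\<forall>w\<in>Hh D (n + 1). piecewise_polynomial (Th D (n + 1)) w) \<and>
     (L2norm (Omega D) (g0 P Y n) \<noteq> 0 \<longrightarrow>
        L2norm (Omega D) (L2proj (Omega D) (Hh D (n + 1)) (g0 P Y n)) \<noteq> 0) \<and>
     (k = 2 \<and> n \<ge> 1 \<and> L2norm (Omega D) (g1 P D Y n) \<noteq> 0 \<longrightarrow>
        L2norm (Omega D) (L2proj (Omega D) (Hh D (n + 1)) (g1 P D Y n)) \<noteq> 0)"

section \<open>Divergence-corrected carrier\<close>

definition velE :: "'d::finite states \<Rightarrow> nat \<Rightarrow> nat \<Rightarrow> real ^ 'd \<Rightarrow> real ^ 'd" where
  "velE Y k n x = extrap k (\<lambda>m. vel Y m x) n"

text \<open>Contravariant Piola pull-back of the velocity to the reference domain.\<close>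

definition vel_hat :: "'d::finite discretization \<Rightarrow> 'd states \<Rightarrow> nat \<Rightarrow> real ^ 'd \<Rightarrow> real ^ 'd" where
  "vel_hat D Y m y = Jh D m y *\<^sub>R (matrix_inv (Fh D m y) *v vel Y m (Xh D m y))"

definition vel_hatE :: "'d::finite discretization \<Rightarrow> 'd states \<Rightarrow> nat \<Rightarrow> nat \<Rightarrow> real ^ 'd \<Rightarrow> real ^ 'd" where
  "vel_hatE D Y k n y = extrap k (\<lambda>m. vel_hat D Y m y) n"

text \<open>\<open>lam\<close> is a function on the physical domain for a topology-changing update and on the
  reference domain otherwise.\<close>

definition carrier_potential ::
    "'d::finite discretization \<Rightarrow> 'd states \<Rightarrow> nat \<Rightarrow> nat \<Rightarrow> (real ^ 'd \<Rightarrow> real) \<Rightarrow> bool" where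
  "carrier_potential D Y k n lam \<longleftrightarrow>
     (if remesh D n then
        lam \<in> Sh0 D (n + 1) \<and>
        (\<forall>\<xi>\<in>Sh0 D (n + 1).
           ip (Omega D) (grad (Omega D) lam) (grad (Omega D) \<xi>)
           = ip (Omega D) (velE Y k n) (grad (Omega D) \<xi>))
      else
        lam \<in> ShHat0 D (n + 1) \<and>
        (\<forall>\<xi>\<in>ShHat0 D (n + 1).
           ip (OmegaHat D (n + 1)) (grad (OmegaHat D (n + 1)) lam) (grad (OmegaHat D (n + 1)) \<xi>)
           = ip (OmegaHat D (n + 1)) (vel_hatE D Y k n) (grad (OmegaHat D (n + 1)) \<xi>)))"

definition vel_c ::
    "'d::finite discretization \<Rightarrow> 'd states \<Rightarrow> nat \<Rightarrow> nat \<Rightarrow> (real ^ 'd \<Rightarrow> real) \<Rightarrow> real ^ 'd \<Rightarrow> real ^ 'd" where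
  "vel_c D Y k n lam x =
     (if remesh D n then velE Y k n x - grad (Omega D) lam x
      else let y = Xinv D (n + 1) x in
        (1 / Jh D (n + 1) y) *\<^sub>R
          (Fh D (n + 1) y *v (vel_hatE D Y k n y - grad (OmegaHat D (n + 1)) lam y)))"

section \<open>Phase-field and saddle-point updates\<close>

definition UE :: "params \<Rightarrow> 'd::finite discretization \<Rightarrow> 'd states \<Rightarrow> nat \<Rightarrow> nat \<Rightarrow> real" where
  "UE P D Y k n = sqrt (ip (Omega D) (\<lambda>x. Gpot P (phiE Y k n x)) (\<lambda>_. 1) + C_G P)"

definition dG_E :: "params \<Rightarrow> 'd::finite states \<Rightarrow> nat \<Rightarrow> nat \<Rightarrow> real ^ 'd \<Rightarrow> real" where
  "dG_E P Y k n x = deriv (Gpot P) (phiE Y k n x)"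

definition mobE :: "params \<Rightarrow> 'd::finite states \<Rightarrow> nat \<Rightarrow> nat \<Rightarrow> real ^ 'd \<Rightarrow> real" where
  "mobE P Y k n x = mob P (phiE Y k n x)"

definition phase_sav_update ::
    "params \<Rightarrow> 'd::finite discretization \<Rightarrow> 'd states \<Rightarrow> nat \<Rightarrow> nat
      \<Rightarrow> (real ^ 'd \<Rightarrow> real) \<Rightarrow> (real ^ 'd \<Rightarrow> real) \<Rightarrow> bool" where
  "phase_sav_update P D Y k n \<phi>Hh lam \<longleftrightarrow>
     (let \<Omega> = Omega D; uc = vel_c D Y k n lam; U = UE P D Y k n;
          \<phi> = phi Y (n + 1); \<mu> = mu Y (n + 1); r = sav Y (n + 1);
          d\<phi> = (\<lambda>x. gam k / tau P * (\<phi> x - \<phi>Hh x))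
      in U > 0 \<and> \<phi> \<in> Sh D (n + 1) \<and> \<mu> \<in> Sh D (n + 1) \<and>
         (\<forall>\<omega>\<in>Sh D (n + 1).
            ip \<Omega> d\<phi> \<omega> - ip \<Omega> (\<lambda>x. phiE Y k n x *\<^sub>R uc x) (grad \<Omega> \<omega>)
            + 1 / Pe P * ip \<Omega> (\<lambda>x. mobE P Y k n x *\<^sub>R grad \<Omega> \<mu> x) (grad \<Omega> \<omega>) = 0) \<and>
         (\<forall>\<xi>\<in>Sh D (n + 1).
            ip \<Omega> \<mu> \<xi> = (Cn P)\<^sup>2 * ip \<Omega> (grad \<Omega> \<phi>) (grad \<Omega> \<xi>) + stab P * ip \<Omega> \<phi> \<xi>
                      + r / U * ip \<Omega> (dG_E P Y k n) \<xi>) \<and>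
         Dtau P k (sav Y) n = 1 / (2 * U) * ip \<Omega> (dG_E P Y k n) d\<phi>)"

definition mass_flux ::
    "params \<Rightarrow> 'd::finite discretization \<Rightarrow> 'd states \<Rightarrow> nat \<Rightarrow> nat \<Rightarrow> (real ^ 'd \<Rightarrow> real)
      \<Rightarrow> real ^ 'd \<Rightarrow> real ^ 'd" where
  "mass_flux P D Y k n lam x =
     rho P (phiE Y k n x) *\<^sub>R vel_c D Y k n lam x
     - (rho1 P / Pe P * mobE P Y k n x) *\<^sub>R grad (Omega D) (mu Y (n + 1)) x"

definition mesh_velocity :: "params \<Rightarrow> 'd::finite discretization \<Rightarrow> nat \<Rightarrow> nat \<Rightarrow> real ^ 'd \<Rightarrow> real ^ 'd" where
  "mesh_velocity P D k n x =
     (if remesh D n then 0 else Dtau P k (\<lambda>m. Xh D m (Xinv D (n + 1) x)) n)"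

definition relative_flux ::
    "params \<Rightarrow> 'd::finite discretization \<Rightarrow> 'd states \<Rightarrow> nat \<Rightarrow> nat \<Rightarrow> (real ^ 'd \<Rightarrow> real)
      \<Rightarrow> real ^ 'd \<Rightarrow> real ^ 'd" where
  "relative_flux P D Y k n lam x =
     mass_flux P D Y k n lam x - rho P (phi Y (n + 1) x) *\<^sub>R mesh_velocity P D k n x"

definition conv_form ::
    "params \<Rightarrow> 'd::finite discretization \<Rightarrow> 'd states \<Rightarrow> nat \<Rightarrow> nat \<Rightarrow> (real ^ 'd \<Rightarrow> real)
      \<Rightarrow> (real ^ 'd \<Rightarrow> real ^ 'd) \<Rightarrow> (real ^ 'd \<Rightarrow> real ^ 'd) \<Rightarrow> real" where
  "conv_form P D Y k n lam v z =
     1/2 * (ip (Omega D) (\<lambda>x. jac (Omega D) v x *v relative_flux P D Y k n lam x) z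
          - ip (Omega D) (\<lambda>x. jac (Omega D) z x *v relative_flux P D Y k n lam x) v)"

definition Ephi1 :: "params \<Rightarrow> 'd::finite discretization \<Rightarrow> 'd states \<Rightarrow> nat \<Rightarrow> real" where
  "Ephi1 P D Y l = 1 / (2 * We P * Cn P) * cns_norm2 P (Omega D) (phi Y l)
     + 1 / (We P * Cn P) * (sav Y l)\<^sup>2 + C_A P"

definition Ephi2 :: "params \<Rightarrow> 'd::finite discretization \<Rightarrow> 'd states \<Rightarrow> nat \<Rightarrow> real" where
  "Ephi2 P D Y l =
     1 / (4 * We P * Cn P) * (cns_norm2 P (Omega D) (phi Y l)
        + cns_norm2 P (Omega D) (\<lambda>x. 2 * phi Y l x - phi Y (l - 1) x))
     + 1 / (2 * We P * Cn P) * ((sav Y l)\<^sup>2 + (2 * sav Y l - sav Y (l - 1))\<^sup>2) + C_A P"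

definition Ephi :: "params \<Rightarrow> 'd::finite discretization \<Rightarrow> 'd states \<Rightarrow> nat \<Rightarrow> nat \<Rightarrow> real" where
  "Ephi P D Y k l = (if k = 1 then Ephi1 P D Y l else Ephi2 P D Y l)"

definition saddle_point_update ::
    "params \<Rightarrow> 'd::finite discretization \<Rightarrow> 'd states \<Rightarrow> nat \<Rightarrow> nat \<Rightarrow> (real ^ 'd \<Rightarrow> real)
      \<Rightarrow> (real ^ 'd \<Rightarrow> real ^ 'd) \<Rightarrow> bool" where
  "saddle_point_update P D Y k n lam f \<longleftrightarrow>
     (let \<Omega> = Omega D; \<phi> = phi Y (n + 1); \<mu> = mu Y (n + 1);
          u = vel Y (n + 1); p = prs Y (n + 1); q = qs Y (n + 1);
          sr = (\<lambda>x. sqrt (rho P (\<phi> x)));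
          cap = (\<lambda>x. \<phi> x *\<^sub>R grad \<Omega> \<mu> x)
      in u \<in> Vh D (n + 1) \<and> p \<in> Ph0 D (n + 1) \<and> q > 0 \<and>
         (\<forall>v\<in>Vh D (n + 1).
            gam k / tau P * ip \<Omega> (\<lambda>x. sr x *\<^sub>R u x - zetaH P D Y k (n + 1) x) (\<lambda>x. sr x *\<^sub>R v x)
            + conv_form P D Y k n lam u v
            + 2 / Rey P * ip \<Omega> (\<lambda>x. eta P (\<phi> x) *\<^sub>R symgrad \<Omega> u x) (symgrad \<Omega> v)
            - ip \<Omega> p (divg \<Omega> v)
            = ip \<Omega> f v - q / (We P * Cn P) * ip \<Omega> cap v) \<and>
         (\<forall>a\<in>Ph0 D (n + 1). ip \<Omega> (divg \<Omega> u) a = 0) \<and>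
         gam k * q / (alpha_q P * tau P) * (q - hist k (qs Y) n)
         + (q - qs Y n) / tau P * Ephi P D Y k n
         + q / (We P * Cn P) * ip \<Omega> (\<lambda>x. phiE Y k n x *\<^sub>R vel_c D Y k n lam x) (grad \<Omega> \<mu>)
         - q / (We P * Cn P) * ip \<Omega> cap u = 0)"

text \<open>The integrals of the scheme that are not products of two square-integrable functions under
  the remaining assumptions are required to be finite.\<close>

definition finite_integrals ::
    "params \<Rightarrow> 'd::finite discretization \<Rightarrow> 'd states \<Rightarrow> nat \<Rightarrow> nat \<Rightarrow> (real ^ 'd \<Rightarrow> real)
      \<Rightarrow> (real ^ 'd \<Rightarrow> real ^ 'd) \<Rightarrow> bool" where
  "finite_integrals P D Y k n lam f \<longleftrightarrow>
     (let \<Omega> = Omega D; M = lebesgue_on \<Omega>; \<phi> = phi Y (n + 1); \<mu> = mu Y (n + 1)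
      in integrable M (\<lambda>x. Gpot P (phiE Y k n x)) \<and>
         (\<forall>\<omega>\<in>Sh D (n + 1).
            integrable M (\<lambda>x. dG_E P Y k n x * \<omega> x) \<and>
            integrable M (\<lambda>x. (phiE Y k n x *\<^sub>R vel_c D Y k n lam x) \<bullet> grad \<Omega> \<omega> x) \<and>
            integrable M (\<lambda>x. (mobE P Y k n x *\<^sub>R grad \<Omega> \<mu> x) \<bullet> grad \<Omega> \<omega> x)) \<and>
         (\<forall>v\<in>Vh D (n + 1).
            integrable M (\<lambda>x. f x \<bullet> v x) \<and>
            integrable M (\<lambda>x. (\<phi> x *\<^sub>R grad \<Omega> \<mu> x) \<bullet> v x) \<and>
            (\<forall>z\<in>Vh D (n + 1).
               integrable M (\<lambda>x. (jac \<Omega> v x *v relative_flux P D Y k n lam x) \<bullet> z x))))"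

section \<open>Modified energies and polarization remainders\<close>

definition Eh1 :: "params \<Rightarrow> 'd::finite discretization \<Rightarrow> 'd states \<Rightarrow> nat \<Rightarrow> real" where
  "Eh1 P D Y l = 1/2 * (L2norm (Omega D) (g0 P Y l))\<^sup>2 + qs Y l * Ephi1 P D Y l
     + 1 / (2 * alpha_q P) * (qs Y l)\<^sup>2"

definition Eh2 :: "params \<Rightarrow> 'd::finite discretization \<Rightarrow> 'd states \<Rightarrow> nat \<Rightarrow> real" where
  "Eh2 P D Y l =
     1/4 * ((L2norm (Omega D) (g0 P Y l))\<^sup>2 + (L2norm (Omega D) (g1 P D Y l))\<^sup>2)
     + qs Y l * Ephi2 P D Y l
     + 1 / (4 * alpha_q P) * ((qs Y l)\<^sup>2 + (2 * qs Y l - qs Y (l - 1))\<^sup>2)"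

definition Eh :: "params \<Rightarrow> 'd::finite discretization \<Rightarrow> 'd states \<Rightarrow> nat \<Rightarrow> nat \<Rightarrow> real" where
  "Eh P D Y k l = (if k = 1 then Eh1 P D Y l else Eh2 P D Y l)"

definition Nh1 :: "params \<Rightarrow> 'd::finite discretization \<Rightarrow> 'd states \<Rightarrow> nat \<Rightarrow> real" where
  "Nh1 P D Y l =
     1/2 * (L2norm (Omega D) (\<lambda>x. zeta P Y l x - g0H P D Y l x))\<^sup>2
     + qs Y l * (1 / (2 * We P * Cn P) * cns_norm2 P (Omega D) (\<lambda>x. phi Y l x - phi Y (l - 1) x)
                 + 1 / (We P * Cn P) * (sav Y l - sav Y (l - 1))\<^sup>2)
     + 1 / (2 * alpha_q P) * (qs Y l - qs Y (l - 1))\<^sup>2"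

definition Nh2 :: "params \<Rightarrow> 'd::finite discretization \<Rightarrow> 'd states \<Rightarrow> nat \<Rightarrow> real" where
  "Nh2 P D Y l =
     1/4 * (L2norm (Omega D) (\<lambda>x. zeta P Y l x - g1H P D Y l x))\<^sup>2
     + qs Y l * (1 / (4 * We P * Cn P) *
                   cns_norm2 P (Omega D) (\<lambda>x. phi Y l x - 2 * phi Y (l - 1) x + phi Y (l - 2) x)
                 + 1 / (2 * We P * Cn P) * (sav Y l - 2 * sav Y (l - 1) + sav Y (l - 2))\<^sup>2)
     + 1 / (4 * alpha_q P) * (qs Y l - 2 * qs Y (l - 1) + qs Y (l - 2))\<^sup>2"

definition Nh :: "params \<Rightarrow> 'd::finite discretization \<Rightarrow> 'd states \<Rightarrow> nat \<Rightarrow> nat \<Rightarrow> real" where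
  "Nh P D Y k l = (if k = 1 then Nh1 P D Y l else Nh2 P D Y l)"

end

theory Submission
  imports Defs
begin

text \<open>The identity is obtained by testing the phase equation with \<open>\<mu>\<close>, the chemical potential
  equation with the discrete phase increment and the momentum equation with the velocity, and by
  multiplying the scalar equation with \<open>\<tau>\<close>: the convective form is skew, the pressure
  drops out, the capillary work cancels against the scalar equation, and what remains is a discrete
  polarization identity for each energy. For the phase energy the polarization closes because the
  elliptic projection of the history only enters through its pairing with \<open>\<phi>\<close>; for the kinetic
  energy it closes because the transfer of the histories preserves the \<open>L\<^sup>2\<close> norm.

  Two analytic facts carry this: weak gradients are unique almost everywhere, hence linear, although
  \<open>grad\<close> is only a choice of representatives, and the Jacobian weights of the transfer are those of
  the change of variables on the element interiors, which exhaust the domain up to a null set.\<close>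

section \<open>Square-integrable functions\<close>

text \<open>The phase energy carries the factor \<open>q\<close>, so its increment splits by the
  discrete product rule \<open>q' E' - q E = q' (E' - E) + (q' - q) E\<close>: the second summand is
  the energy term of the scalar equation, the first is what the phase equations times
  \<open>q'\<close> control. For BDF2 the kinetic polarization is written in
  \<open>z\<^sup>n\<close> and \<open>2 z\<^sup>n - z\<^sup>n\<^sup>-\<^sup>1\<close> rather than in
  two consecutive states. It then contains the norms of the two transferred histories and their
  products with the new state, but never the product of the two histories. This is decisive, because
  the rescaled projection of a remeshing update is not linear and keeps norms only. With these forms
  every energy produces the same factor \<open>gam k\<close>. Two obstacles shape the analytic part.
  \<open>grad\<close> and \<open>L2proj\<close> are choices, so existence (and for
  \<open>grad\<close> uniqueness) has to be proved before anything can be computed with them. And a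
  Lebesgue measurable function composed with a mesh map is not measurable for free; measurability is
  read off the integrability equivalence of the change of variables theorem.\<close>

lemma L2_measurable [measurable_dest]: "f \<in> L2 \<Omega> \<Longrightarrow> f \<in> borel_measurable (lebesgue_on \<Omega>)"
  by (simp add: L2_def)

lemma L2_norm_sq: "f \<in> L2 \<Omega> \<Longrightarrow> integrable (lebesgue_on \<Omega>) (\<lambda>x. (norm (f x))\<^sup>2)"
  by (simp add: L2_def)

lemma L2_inner_integrable:
  assumes f: "f \<in> L2 \<Omega>" and g: "g \<in> L2 \<Omega>"
  shows "integrable (lebesgue_on \<Omega>) (\<lambda>x. f x \<bullet> g x)"
proof (rule Bochner_Integration.integrable_bound)
  show "integrable (lebesgue_on \<Omega>) (\<lambda>x. (norm (f x))\<^sup>2 + (norm (g x))\<^sup>2)"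
    using f g by (simp add: L2_norm_sq)
  show "(\<lambda>x. f x \<bullet> g x) \<in> borel_measurable (lebesgue_on \<Omega>)"
    using L2_measurable[OF f] L2_measurable[OF g] by measurable
  have "\<bar>f x \<bullet> g x\<bar> \<le> (norm (f x))\<^sup>2 + (norm (g x))\<^sup>2" for x
    using Cauchy_Schwarz_ineq2[of "f x" "g x"] sum_squares_bound[of "norm (f x)" "norm (g x)"]
      mult_nonneg_nonneg[OF norm_ge_zero[of "f x"] norm_ge_zero[of "g x"]]
    unfolding mult.assoc by linarith
  then show "AE x in lebesgue_on \<Omega>. norm (f x \<bullet> g x) \<le> norm ((norm (f x))\<^sup>2 + (norm (g x))\<^sup>2)"
    by simp
qed

lemma L2_add:
  assumes f: "f \<in> L2 \<Omega>" and g: "g \<in> L2 \<Omega>"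
  shows "(\<lambda>x. f x + g x) \<in> L2 \<Omega>"
proof -
  have m: "(\<lambda>x. f x + g x) \<in> borel_measurable (lebesgue_on \<Omega>)"
    using L2_measurable[OF f] L2_measurable[OF g] by measurable
  have "(norm (f x + g x))\<^sup>2 = (norm (f x))\<^sup>2 + 2 * (f x \<bullet> g x) + (norm (g x))\<^sup>2" for x
    by (simp add: power2_norm_eq_inner inner_add inner_commute)
  then show ?thesis
    using m L2_norm_sq[OF f] L2_norm_sq[OF g] L2_inner_integrable[OF f g] by (simp add: L2_def)
qed

lemma L2_scaleR: "f \<in> L2 \<Omega> \<Longrightarrow> (\<lambda>x. c *\<^sub>R f x) \<in> L2 \<Omega>"
  by (auto simp: L2_def power_mult_distrib intro: borel_measurable_scaleR)

lemma L2_lincomb: "f \<in> L2 \<Omega> \<Longrightarrow> g \<in> L2 \<Omega> \<Longrightarrow> (\<lambda>x. a *\<^sub>R f x + b *\<^sub>R g x) \<in> L2 \<Omega>"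
  by (intro L2_add L2_scaleR)

lemma L2_diff: "f \<in> L2 \<Omega> \<Longrightarrow> g \<in> L2 \<Omega> \<Longrightarrow> (\<lambda>x. f x - g x) \<in> L2 \<Omega>"
  using L2_lincomb[of f \<Omega> g 1 "-1"] by simp

lemma L2_sum: "(\<And>b. b \<in> B \<Longrightarrow> h b \<in> L2 \<Omega>) \<Longrightarrow> (\<lambda>x. \<Sum>b\<in>B. h b x) \<in> L2 \<Omega>"
  by (induction B rule: infinite_finite_induct) (simp_all add: L2_add, simp_all add: L2_def)

lemma L2_bounded_scaleR:
  assumes c: "c \<in> borel_measurable (lebesgue_on \<Omega>)" "AE x in lebesgue_on \<Omega>. \<bar>c x\<bar> \<le> C"
    and f: "f \<in> L2 \<Omega>"
  shows "(\<lambda>x. c x *\<^sub>R f x) \<in> L2 \<Omega>"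
proof -
  have m: "(\<lambda>x. c x *\<^sub>R f x) \<in> borel_measurable (lebesgue_on \<Omega>)"
    using c(1) L2_measurable[OF f] by measurable
  have "integrable (lebesgue_on \<Omega>) (\<lambda>x. (norm (c x *\<^sub>R f x))\<^sup>2)"
  proof (rule Bochner_Integration.integrable_bound)
    show "integrable (lebesgue_on \<Omega>) (\<lambda>x. C\<^sup>2 * (norm (f x))\<^sup>2)"
      using f by (simp add: L2_norm_sq)
    show "(\<lambda>x. (norm (c x *\<^sub>R f x))\<^sup>2) \<in> borel_measurable (lebesgue_on \<Omega>)"
      using m by measurable
    show "AE x in lebesgue_on \<Omega>. norm ((norm (c x *\<^sub>R f x))\<^sup>2) \<le> norm (C\<^sup>2 * (norm (f x))\<^sup>2)"
      using c(2)
    proof eventually_elim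
      case (elim x)
      then have "(c x)\<^sup>2 \<le> C\<^sup>2"
        by (metis abs_ge_zero power2_abs power_mono)
      then show ?case
        by (simp add: power_mult_distrib mult_right_mono)
    qed
  qed
  then show ?thesis using m by (simp add: L2_def)
qed

lemma L2_integrable:
  assumes \<Omega>: "\<Omega> \<in> lmeasurable" and f: "f \<in> L2 \<Omega>"
  shows "integrable (lebesgue_on \<Omega>) f"
proof (rule Bochner_Integration.integrable_bound)
  interpret finite_measure "lebesgue_on \<Omega>" by (rule finite_measure_lebesgue_on[OF \<Omega>])
  show "integrable (lebesgue_on \<Omega>) (\<lambda>x. 1 + (norm (f x))\<^sup>2)"
    using f by (simp add: L2_norm_sq)
  show "f \<in> borel_measurable (lebesgue_on \<Omega>)" by (rule L2_measurable[OF f])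
  have "norm (f x) \<le> 1 + (norm (f x))\<^sup>2" for x
    using sum_squares_bound[of 1 "norm (f x)"] norm_ge_zero[of "f x"] unfolding one_power2 by linarith
  then show "AE x in lebesgue_on \<Omega>. norm (f x) \<le> norm (1 + (norm (f x))\<^sup>2)"
    by simp
qed

lemma ip_commute: "ip \<Omega> f g = ip \<Omega> g f"
  by (simp add: ip_def inner_commute)

lemma ip_lincomb_left:
  assumes "f \<in> L2 \<Omega>" "g \<in> L2 \<Omega>" "h \<in> L2 \<Omega>"
  shows "ip \<Omega> (\<lambda>x. a *\<^sub>R f x + b *\<^sub>R g x) h = a * ip \<Omega> f h + b * ip \<Omega> g h"
  using assms by (simp add: ip_def inner_add_left L2_inner_integrable)

lemma ip_lincomb_right:
  assumes "f \<in> L2 \<Omega>" "g \<in> L2 \<Omega>" "h \<in> L2 \<Omega>"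
  shows "ip \<Omega> h (\<lambda>x. a *\<^sub>R f x + b *\<^sub>R g x) = a * ip \<Omega> h f + b * ip \<Omega> h g"
  using ip_lincomb_left[OF assms] by (simp add: ip_commute)

lemma ip_self_nonneg: "ip \<Omega> f f \<ge> 0"
  by (simp add: ip_def)

lemma L2norm_sq: "(L2norm \<Omega> f)\<^sup>2 = ip \<Omega> f f"
  by (simp add: L2norm_def ip_self_nonneg)

lemma L2norm_scaleR: "L2norm \<Omega> (\<lambda>x. c *\<^sub>R f x) = \<bar>c\<bar> * L2norm \<Omega> f"
  by (simp add: L2norm_def ip_def real_sqrt_mult flip: power2_eq_square mult.assoc)

lemma ip_cong_AE:
  assumes "f \<in> borel_measurable (lebesgue_on \<Omega>)" "f' \<in> borel_measurable (lebesgue_on \<Omega>)"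
    "g \<in> borel_measurable (lebesgue_on \<Omega>)" "g' \<in> borel_measurable (lebesgue_on \<Omega>)"
    and "AE x in lebesgue_on \<Omega>. f x = f' x" "AE x in lebesgue_on \<Omega>. g x = g' x"
  shows "ip \<Omega> f g = ip \<Omega> f' g'"
  unfolding ip_def
proof (rule integral_cong_AE)
  show "AE x in lebesgue_on \<Omega>. f x \<bullet> g x = f' x \<bullet> g' x"
    using assms(5,6) by eventually_elim simp
qed (use assms(1-4) in measurable)

lemma ip_self_eq_0_AE:
  assumes f: "f \<in> L2 \<Omega>" and "ip \<Omega> f f = 0"
  shows "AE x in lebesgue_on \<Omega>. f x = 0"
  using assms integral_nonneg_eq_0_iff_AE[OF L2_inner_integrable[OF f f]]
  by (simp add: ip_def)

text \<open>Lebesgue measure is complete: after extension by zero to the whole space, a change on a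
  null set keeps measurability. This serves piecewise polynomials, which equal a polynomial only
  almost everywhere on each element.\<close>

lemma borel_measurable_lebesgue_on_AE:
  fixes f g :: "'a::euclidean_space \<Rightarrow> 'b::euclidean_space"
  assumes S: "S \<in> sets lebesgue" and f: "f \<in> borel_measurable (lebesgue_on S)"
    and ae: "AE x in lebesgue_on S. g x = f x"
  shows "g \<in> borel_measurable (lebesgue_on S)"
proof -
  have "(\<lambda>x. if x \<in> S then f x else 0) \<in> borel_measurable lebesgue"
    using f borel_measurable_if[OF S] by blast
  moreover have "AE x in lebesgue. (if x \<in> S then f x else 0) = (if x \<in> S then g x else 0)"
    using ae AE_restrict_space_iff[of S lebesgue "\<lambda>x. g x = f x"] S by (auto elim: eventually_mono)
  ultimately have "(\<lambda>x. if x \<in> S then g x else 0) \<in> borel_measurable lebesgue"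
    by (rule borel_measurable_AE)
  then show ?thesis
    using borel_measurable_if[OF S] by blast
qed

section \<open>Finite-dimensional spaces and orthogonal projection\<close>

lemma fin_dim_space_lincomb:
  assumes W: "fin_dim_space \<Omega> W" and "v \<in> W" "w \<in> W"
  shows "(\<lambda>x. a *\<^sub>R v x + b *\<^sub>R w x) \<in> W"
proof -
  obtain B where B: "W = {v. \<exists>c. AE x in lebesgue_on \<Omega>. v x = (\<Sum>b\<in>B. c b *\<^sub>R b x)}"
    using W by (auto simp: fin_dim_space_def)
  obtain c d where cd: "AE x in lebesgue_on \<Omega>. v x = (\<Sum>b\<in>B. c b *\<^sub>R b x)"
      "AE x in lebesgue_on \<Omega>. w x = (\<Sum>b\<in>B. d b *\<^sub>R b x)"
    using assms(2,3) by (auto simp: B)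
  have "AE x in lebesgue_on \<Omega>. a *\<^sub>R v x + b *\<^sub>R w x = (\<Sum>e\<in>B. (a * c e + b * d e) *\<^sub>R e x)"
    using cd by eventually_elim (simp add: scaleR_add_left sum.distrib scaleR_sum_right)
  then show ?thesis by (auto simp: B intro!: exI[of _ "\<lambda>e. a * c e + b * d e"])
qed

text \<open>Gram-Schmidt by induction on the spanning set. \<open>B\<close> may be linearly
  dependent modulo null sets, since \<open>fin_dim_space\<close> only provides a finite spanning
  set; the new direction can therefore have norm zero.\<close>

lemma orthogonal_projection_exists:
  assumes "finite B" "B \<subseteq> L2 \<Omega>" "g \<in> L2 \<Omega>"
  shows "\<exists>c. \<forall>b\<in>B. ip \<Omega> (\<lambda>x. g x - (\<Sum>e\<in>B. c e *\<^sub>R e x)) b = 0"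
  using assms
proof (induction B arbitrary: g rule: finite_induct)
  case (insert b B)
  have BL: "e \<in> L2 \<Omega>" if "e \<in> B" for e using insert.prems(1) that by auto
  have bL: "b \<in> L2 \<Omega>" using insert.prems(1) by auto
  obtain c where c: "\<forall>e\<in>B. ip \<Omega> (\<lambda>x. g x - (\<Sum>e\<in>B. c e *\<^sub>R e x)) e = 0"
    using insert.IH[OF _ insert.prems(2)] insert.prems(1) by auto
  obtain d where d: "\<forall>e\<in>B. ip \<Omega> (\<lambda>x. b x - (\<Sum>e\<in>B. d e *\<^sub>R e x)) e = 0"
    using insert.IH[OF _ bL] insert.prems(1) by auto
  define p where "p = (\<lambda>x. \<Sum>e\<in>B. c e *\<^sub>R e x)"
  define q where "q = (\<lambda>x. \<Sum>e\<in>B. d e *\<^sub>R e x)"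
  define r where "r = (\<lambda>x. b x - q x)"
  define s where "s = (\<lambda>x. g x - p x)"
  have pqL: "p \<in> L2 \<Omega>" "q \<in> L2 \<Omega>"
    unfolding p_def q_def by (intro L2_sum L2_scaleR BL; assumption)+
  have rs: "r \<in> L2 \<Omega>" "s \<in> L2 \<Omega>"
    unfolding r_def s_def using pqL bL insert.prems(2) by (auto intro: L2_diff)
  \<comment> \<open>If \<open>r\<close> has norm zero, the quotient is 0 by convention and
    \<open>ip \<Omega> s r\<close> is 0 too, so \<open>sr\<close> below holds in both cases.\<close>
  define t where "t = ip \<Omega> s r / ip \<Omega> r r"
  have orth: "ip \<Omega> r e = 0" "ip \<Omega> s e = 0" if "e \<in> B" for e
    using c d that by (auto simp: r_def s_def p_def q_def)
  have orthq: "ip \<Omega> s q = 0 \<and> ip \<Omega> r q = 0"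
  proof -
    have "ip \<Omega> z q = (\<Sum>e\<in>B. d e * ip \<Omega> z e)" if "z \<in> L2 \<Omega>" for z
      using that BL by (simp add: ip_def q_def inner_sum_right L2_inner_integrable Bochner_Integration.integral_sum)
    then show ?thesis using orth rs by simp
  qed
  have sr: "ip \<Omega> s r = t * ip \<Omega> r r"
  proof (cases "ip \<Omega> r r = 0")
    case True
    then have "AE x in lebesgue_on \<Omega>. r x = 0" by (rule ip_self_eq_0_AE[OF rs(1)])
    then have "ip \<Omega> s r = ip \<Omega> s (\<lambda>_. 0)"
      by (intro ip_cong_AE) (use rs in \<open>auto intro: L2_measurable\<close>)
    then show ?thesis using True by (simp add: ip_def)
  qed (simp add: t_def)
  \<comment> \<open>Coefficients of \<open>p + t r\<close> with \<open>r = b - q\<close>, which turn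
    the residual of \<open>g\<close> into \<open>s - t r\<close>.\<close>
  let ?c = "\<lambda>e. if e = b then t else c e - t * d e"
  have eq: "(\<lambda>x. g x - (\<Sum>e\<in>insert b B. ?c e *\<^sub>R e x)) = (\<lambda>x. 1 *\<^sub>R s x + (- t) *\<^sub>R r x)"
  proof
    fix x
    have "(\<Sum>e\<in>B. ?c e *\<^sub>R e x) = (\<Sum>e\<in>B. (c e - t * d e) *\<^sub>R e x)"
      using insert.hyps by (intro sum.cong) auto
    also have "\<dots> = p x - t *\<^sub>R q x"
      by (simp add: p_def q_def algebra_simps sum_subtractf scaleR_sum_right)
    finally show "g x - (\<Sum>e\<in>insert b B. ?c e *\<^sub>R e x) = 1 *\<^sub>R s x + (- t) *\<^sub>R r x"
      using insert.hyps by (simp add: s_def r_def algebra_simps)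
  qed
  have "ip \<Omega> (\<lambda>x. 1 *\<^sub>R s x + (- t) *\<^sub>R r x) e = 0" if "e \<in> insert b B" for e
  proof (cases "e = b")
    case False
    then have "e \<in> B" using that by simp
    then show ?thesis
      using rs BL orth by (subst ip_lincomb_left) auto
  next
    case True
    have "b = (\<lambda>x. 1 *\<^sub>R r x + 1 *\<^sub>R q x)" by (simp add: r_def)
    moreover have "ip \<Omega> z (\<lambda>x. 1 *\<^sub>R r x + 1 *\<^sub>R q x) = ip \<Omega> z r + ip \<Omega> z q" if "z \<in> L2 \<Omega>" for z
      using rs pqL that by (subst ip_lincomb_right) auto
    ultimately have "ip \<Omega> s b = ip \<Omega> s r" "ip \<Omega> r b = ip \<Omega> r r"
      using orthq rs by auto
    then show ?thesis
      using True rs bL sr by (subst ip_lincomb_left) auto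
  qed
  then show ?case by (intro exI[of _ ?c]) (simp only: eq, blast)
qed simp

text \<open>\<open>L2proj\<close> is a Hilbert choice and says nothing until a projection is known
  to exist. The spanning functions are themselves members of \<open>W\<close> (Kronecker
  coefficients), hence square-integrable, and orthogonality to them passes to every
  almost-everywhere representative in \<open>W\<close>.\<close>

lemma L2proj_in_space:
  assumes W: "fin_dim_space \<Omega> W" and WL: "W \<subseteq> L2 \<Omega>" and g: "g \<in> L2 \<Omega>"
  shows "L2proj \<Omega> W g \<in> W"
proof -
  obtain B where B: "finite B" "W = {v. \<exists>c. AE x in lebesgue_on \<Omega>. v x = (\<Sum>b\<in>B. c b *\<^sub>R b x)}"
    using W by (auto simp: fin_dim_space_def)
  have "b \<in> W" if "b \<in> B" for b
  proof -
    have "b x = (\<Sum>e\<in>B. (if e = b then 1 else 0) *\<^sub>R e x)" for x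
      using that B(1) by (simp add: if_distrib[of "\<lambda>c. c *\<^sub>R _"] cong: if_cong)
    then show ?thesis by (auto simp: B(2) intro!: exI[of _ "\<lambda>e. if e = b then 1 else 0"])
  qed
  then have BL: "B \<subseteq> L2 \<Omega>" using WL by auto
  obtain c where c: "\<forall>b\<in>B. ip \<Omega> (\<lambda>x. g x - (\<Sum>e\<in>B. c e *\<^sub>R e x)) b = 0"
    using orthogonal_projection_exists[OF B(1) BL g] by blast
  define p where "p = (\<lambda>x. \<Sum>e\<in>B. c e *\<^sub>R e x)"
  have pW: "p \<in> W" by (auto simp: B(2) p_def)
  then have r: "(\<lambda>x. g x - p x) \<in> L2 \<Omega>"
    using WL g by (auto intro: L2_diff)
  have "ip \<Omega> (\<lambda>x. g x - p x) w = 0" if w: "w \<in> W" for w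
  proof -
    obtain d where d: "AE x in lebesgue_on \<Omega>. w x = (\<Sum>b\<in>B. d b *\<^sub>R b x)"
      using w by (auto simp: B(2))
    have "(\<lambda>x. \<Sum>b\<in>B. d b *\<^sub>R b x) \<in> L2 \<Omega>"
      using BL by (intro L2_sum L2_scaleR) auto
    then have "ip \<Omega> (\<lambda>x. g x - p x) w = ip \<Omega> (\<lambda>x. g x - p x) (\<lambda>x. \<Sum>b\<in>B. d b *\<^sub>R b x)"
      using r w WL d by (intro ip_cong_AE) (auto intro: L2_measurable)
    also have "\<dots> = (\<Sum>b\<in>B. d b * ip \<Omega> (\<lambda>x. g x - p x) b)"
      using BL L2_inner_integrable[OF r]
      by (simp add: ip_def inner_sum_right subset_iff Bochner_Integration.integral_sum)
    finally show ?thesis using c by (simp add: p_def)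
  qed
  then show ?thesis
    unfolding L2proj_def using someI[of "\<lambda>p. p \<in> W \<and> (\<forall>w\<in>W. ip \<Omega> (\<lambda>x. g x - p x) w = 0)" p] pW by blast
qed

section \<open>Weak gradients\<close>

text \<open>Squaring removes the kink of the positive part at 0, the only point that needs an
  argument. This is the profile of the bumps below.\<close>

lemma has_derivative_pos_part_sq:
  "((\<lambda>t::real. (max 0 t)\<^sup>2) has_real_derivative 2 * max 0 t) (at t)"
proof (cases t "0::real" rule: linorder_cases)
  case less
  have "((\<lambda>t::real. 0) has_real_derivative 0) (at t)" by simp
  then have "((\<lambda>t::real. (max 0 t)\<^sup>2) has_real_derivative 0) (at t)"
    by (rule has_field_derivative_transform_within_open[where S = "{..<0}"]) (use less in auto)
  then show ?thesis using less by simp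
next
  case greater
  have "((\<lambda>t::real. t\<^sup>2) has_real_derivative 2 * t) (at t)" by (auto intro!: derivative_eq_intros)
  then have "((\<lambda>t::real. (max 0 t)\<^sup>2) has_real_derivative 2 * t) (at t)"
    by (rule has_field_derivative_transform_within_open[where S = "{0<..}"]) (use greater in auto)
  then show ?thesis using greater by simp
next
  case equal
  \<comment> \<open>At 0 the difference quotient equals \<open>max 0 h\<close> for every nonzero
    \<open>h\<close>.\<close>
  have "((\<lambda>h::real. max 0 h) \<longlongrightarrow> max 0 0) (at 0)" by (intro tendsto_intros)
  then have "((\<lambda>h::real. max 0 h) \<longlongrightarrow> 0) (at 0)" by simp
  then have "((\<lambda>h::real. ((max 0 (0 + h))\<^sup>2 - (max 0 0)\<^sup>2) / h) \<longlongrightarrow> 0) (at 0)"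
    by (rule Lim_transform_eventually)
       (auto simp: eventually_at_filter power2_eq_square max_def)
  then show ?thesis using equal by (simp add: DERIV_def)
qed

text \<open>Test functions only have to be C^1, so the square of a truncated quadratic replaces the
  usual exponential mollifier.\<close>

definition bump :: "real ^ 'd \<Rightarrow> real \<Rightarrow> real ^ 'd::finite \<Rightarrow> real" where
  "bump c r x = (max 0 (r\<^sup>2 - (x - c) \<bullet> (x - c)))\<^sup>2"

definition bump_grad :: "real ^ 'd \<Rightarrow> real \<Rightarrow> real ^ 'd::finite \<Rightarrow> real ^ 'd" where
  "bump_grad c r x = (- 4 * max 0 (r\<^sup>2 - (x - c) \<bullet> (x - c))) *\<^sub>R (x - c)"

lemma bump_pos_iff: "r > 0 \<Longrightarrow> bump c r x > 0 \<longleftrightarrow> x \<in> ball c r"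
proof -
  assume r: "r > 0"
  have "bump c r x > 0 \<longleftrightarrow> (norm (x - c))\<^sup>2 < r\<^sup>2"
    by (auto simp: bump_def max_def power2_norm_eq_inner)
  also have "\<dots> \<longleftrightarrow> norm (x - c) < r"
    using r power2_less_imp_less[of "norm (x - c)" r] power_strict_mono[of "norm (x - c)" r 2] by auto
  finally show ?thesis by (simp add: dist_norm norm_minus_commute)
qed

lemma bump_nonneg: "bump c r x \<ge> 0"
  by (simp add: bump_def)

lemma test_function_bump:
  assumes "r > 0" "cball c r \<subseteq> U"
  shows "test_function U (bump c r) (bump_grad c r)"
  unfolding test_function_def
proof (intro conjI allI exI)
  fix x
  have "((\<lambda>x. r\<^sup>2 - (x - c) \<bullet> (x - c)) has_derivative (\<lambda>h. - 2 * ((x - c) \<bullet> h))) (at x)"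
    by (auto intro!: derivative_eq_intros simp: inner_commute)
  from has_derivative_compose[OF this has_derivative_pos_part_sq[unfolded has_field_derivative_def]]
  show "(bump c r has_derivative (\<lambda>h. bump_grad c r x \<bullet> h)) (at x)"
    unfolding bump_def bump_grad_def by (simp add: mult.assoc mult.left_commute)
  show "continuous_on UNIV (bump_grad c r)"
    unfolding bump_grad_def by (intro continuous_intros)
  show "compact (cball c r)" "cball c r \<subseteq> U" using assms by simp_all
  show "x \<notin> cball c r \<longrightarrow> bump c r x = 0"
    using bump_pos_iff[OF assms(1), of c x] bump_nonneg[of c r x] by force
qed

lemma test_function_sum:
  assumes "finite I" "\<And>i. i \<in> I \<Longrightarrow> test_function U (\<psi> i) (d\<psi> i)"
  shows "test_function U (\<lambda>x. \<Sum>i\<in>I. \<psi> i x) (\<lambda>x. \<Sum>i\<in>I. d\<psi> i x)"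
  unfolding test_function_def
proof (intro conjI allI)
  fix x
  show "((\<lambda>x. \<Sum>i\<in>I. \<psi> i x) has_derivative (\<lambda>h. (\<Sum>i\<in>I. d\<psi> i x) \<bullet> h)) (at x)"
    unfolding inner_sum_left using assms(2) by (intro has_derivative_sum) (auto simp: test_function_def)
  show "continuous_on UNIV (\<lambda>x. \<Sum>i\<in>I. d\<psi> i x)"
    using assms(2) by (intro continuous_on_sum) (auto simp: test_function_def)
  obtain K where K: "\<And>i. i \<in> I \<Longrightarrow> compact (K i) \<and> K i \<subseteq> U \<and> (\<forall>x. x \<notin> K i \<longrightarrow> \<psi> i x = 0)"
    using assms(2) unfolding test_function_def by metis
  then show "\<exists>K. compact K \<and> K \<subseteq> U \<and> (\<forall>x. x \<notin> K \<longrightarrow> (\<Sum>i\<in>I. \<psi> i x) = 0)"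
    using assms(1) by (intro exI[of _ "\<Union>i\<in>I. K i"]) (auto intro: compact_UN)
qed

text \<open>The function equals \<open>m F / (1 + m F)\<close>: it vanishes wherever
  \<open>F\<close> does, so the support stays compact in \<open>U\<close>, and it stays between 0
  and 1 however large \<open>m\<close> is.\<close>

lemma test_function_saturate:
  assumes F: "test_function U F dF" and pos: "\<And>x. F x \<ge> 0" and m: "m \<ge> 0"
  shows "test_function U (\<lambda>x. 1 - 1 / (1 + m * F x)) (\<lambda>x. (m / (1 + m * F x)\<^sup>2) *\<^sub>R dF x)"
  unfolding test_function_def
proof (intro conjI allI)
  have nz: "1 + m * F x > 0" for x
    using pos[of x] m by (simp add: add_pos_nonneg)
  then have nz': "1 + m * F x \<noteq> 0" for x
    by (metis less_irrefl)
  fix x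
  have "(F has_derivative (\<lambda>h. dF x \<bullet> h)) (at x)"
    using F by (simp add: test_function_def)
  then show "((\<lambda>x. 1 - 1 / (1 + m * F x)) has_derivative (\<lambda>h. (m / (1 + m * F x)\<^sup>2) *\<^sub>R dF x \<bullet> h)) (at x)"
    using nz' by (auto intro!: derivative_eq_intros simp: power2_eq_square divide_simps algebra_simps)
  have "continuous_on UNIV F"
    using F unfolding test_function_def
    by (intro continuous_at_imp_continuous_on ballI) (meson has_derivative_continuous)
  then show "continuous_on UNIV (\<lambda>x. (m / (1 + m * F x)\<^sup>2) *\<^sub>R dF x)"
    using F nz' by (intro continuous_intros) (auto simp: test_function_def)
  show "\<exists>K. compact K \<and> K \<subseteq> U \<and> (\<forall>x. x \<notin> K \<longrightarrow> 1 - 1 / (1 + m * F x) = 0)"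
    using F by (force simp: test_function_def)
qed

text \<open>An open set is a countable union of balls whose closures lie inside it; with \<open>F\<^sub>m\<close> the sum of the
  first \<open>m\<close> corresponding bumps, \<open>m F\<^sub>m / (1 + m F\<^sub>m)\<close> tends to the indicator function.\<close>

lemma test_functions_tendsto_indicator:
  fixes U :: "(real ^ 'd::finite) set"
  assumes "open U"
  obtains \<psi> :: "nat \<Rightarrow> real ^ 'd \<Rightarrow> real" and d\<psi> where "\<And>m. test_function U (\<psi> m) (d\<psi> m)" "\<And>m x. \<bar>\<psi> m x\<bar> \<le> 1"
    "\<And>x. (\<lambda>m. \<psi> m x) \<longlonglongrightarrow> indicator U x"
proof (cases "U = {}")
  case True
  have "test_function U (\<lambda>_. 0) (\<lambda>_. 0)"
    by (auto simp: test_function_def intro!: exI[of _ "{}"])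
  then show ?thesis using True that[of "\<lambda>_ _. 0" "\<lambda>_ _. 0"] by simp
next
  case False
  define \<F> where "\<F> = {ball c r |c r. r > 0 \<and> cball c r \<subseteq> U}"
  obtain \<F>' where \<F>': "\<F>' \<subseteq> \<F>" "countable \<F>'" "\<Union>\<F>' = \<Union>\<F>"
    using Lindelof[of \<F>] by (auto simp: \<F>_def)
  have "\<Union>\<F> = U"
  proof
    show "U \<subseteq> \<Union>\<F>"
    proof
      fix x assume "x \<in> U"
      then obtain e where "e > 0" "cball x e \<subseteq> U"
        using assms open_contains_cball by blast
      then show "x \<in> \<Union>\<F>" by (auto simp: \<F>_def intro!: exI[of _ "ball x e"])
    qed
    show "\<Union>\<F> \<subseteq> U" using ball_subset_cball by (fastforce simp: \<F>_def)
  qed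
  with \<F>' False have U: "\<Union>\<F>' = U" "\<F>' \<noteq> {}" by auto
  \<comment> \<open>\<open>from_nat_into\<close> enumerates a nonempty countable set, possibly with
    repetitions; this is why the empty open set was split off.\<close>
  have "\<forall>i. \<exists>c r. r > 0 \<and> cball c r \<subseteq> U \<and> from_nat_into \<F>' i = ball c r"
    using from_nat_into[OF U(2)] \<F>'(1) unfolding \<F>_def by blast
  then obtain c r where cr: "\<And>i. r i > 0" "\<And>i. cball (c i) (r i) \<subseteq> U" "\<And>i. from_nat_into \<F>' i = ball (c i) (r i)"
    by metis
  define F where "F = (\<lambda>m x. \<Sum>i<m. bump (c i) (r i) x)"
  define dF where "dF = (\<lambda>m x. \<Sum>i<m. bump_grad (c i) (r i) x)"
  have F: "test_function U (F m) (dF m)" for m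
    unfolding F_def dF_def using cr by (intro test_function_sum test_function_bump) auto
  have F0: "F m x \<ge> 0" for m x
    unfolding F_def by (intro sum_nonneg bump_nonneg)
  let ?\<psi> = "\<lambda>m x. 1 - 1 / (1 + real m * F m x)"
  show ?thesis
  proof (rule that)
    show "test_function U (?\<psi> m) (\<lambda>x. (real m / (1 + real m * F m x)\<^sup>2) *\<^sub>R dF m x)" for m
      by (rule test_function_saturate[OF F F0]) simp
    show "\<bar>?\<psi> m x\<bar> \<le> 1" for m x
      using F0[of m x] by (simp add: add_nonneg_nonneg add_pos_nonneg)
    show "(\<lambda>m. ?\<psi> m x) \<longlonglongrightarrow> indicator U x" for x
    proof (cases "x \<in> U")
      case False
      have "bump (c i) (r i) x = 0" for i
        using False cr(2)[of i] bump_pos_iff[OF cr(1)[of i], of "c i" x] bump_nonneg[of "c i" "r i" x] ball_subset_cball[of "c i" "r i"]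
        by force
      then show ?thesis using False by (simp add: F_def)
    next
      case True
      then obtain i where i: "x \<in> ball (c i) (r i)"
        using U \<F>'(2) cr(3) from_nat_into_surj by (metis UnionE)
      define b where "b = bump (c i) (r i) x"
      have b: "b > 0" using i cr(1) by (simp add: b_def bump_pos_iff)
      have Fb: "F m x \<ge> b" if "m > i" for m
        unfolding F_def b_def using that
        by (intro member_le_sum) (auto simp: bump_nonneg)
      \<comment> \<open>Beyond the index of a ball containing \<open>x\<close>, \<open>F m x\<close>
        stays above the fixed positive number \<open>b\<close>, and the factor \<open>m\<close>
        drives the quotient to 0.\<close>
      have "(\<lambda>m. 1 / (1 + real m * F m x)) \<longlonglongrightarrow> 0"
      proof (rule tendsto_sandwich)
        show "\<forall>\<^sub>F m in sequentially. 0 \<le> 1 / (1 + real m * F m x)"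
          using F0 by (simp add: add_nonneg_nonneg)
        show "\<forall>\<^sub>F m in sequentially. 1 / (1 + real m * F m x) \<le> inverse (1 + real m * b)"
          using eventually_gt_at_top[of i]
        proof eventually_elim
          case (elim m)
          have "1 + real m * b > 0" using b by (simp add: add_pos_nonneg)
          then show ?case using Fb[OF elim] F0[of m x]
            by (simp add: inverse_eq_divide frac_le mult_left_mono)
        qed
        have "filterlim (\<lambda>m. 1 + b * real m) at_top sequentially"
          using b by (intro filterlim_tendsto_add_at_top[OF tendsto_const]
              filterlim_tendsto_pos_mult_at_top[OF tendsto_const] filterlim_real_sequentially)
        then show "(\<lambda>m. inverse (1 + real m * b)) \<longlonglongrightarrow> 0"
          by (simp add: mult.commute tendsto_inverse_0_at_top)
      qed simp
      then have "(\<lambda>m. ?\<psi> m x) \<longlonglongrightarrow> 1 - 0" by (intro tendsto_diff tendsto_const)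
      then show ?thesis using True by simp
    qed
  qed
qed

text \<open>The fundamental lemma of the calculus of variations. The vanishing integral passes from
  test functions to indicators of open sets, then through G-delta sets to indicators of all
  measurable sets, and a function with vanishing integral over every measurable set is zero almost
  everywhere.\<close>

lemma AE_zero_if_test_integrals_zero:
  fixes h :: "real ^ 'd::finite \<Rightarrow> real"
  assumes \<Omega>: "open \<Omega>" and h: "integrable (lebesgue_on \<Omega>) h"
    and test: "\<And>\<psi> d\<psi>. test_function \<Omega> \<psi> d\<psi> \<Longrightarrow> (LINT x|lebesgue_on \<Omega>. \<psi> x * h x) = 0"
  shows "AE x in lebesgue_on \<Omega>. h x = 0"
proof -
  let ?M = "lebesgue_on \<Omega>"
  have \<Omega>L: "\<Omega> \<in> sets lebesgue" using \<Omega> by simp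
  have hm[measurable]: "h \<in> borel_measurable ?M" using h by simp
  \<comment> \<open>Dominated convergence with majorant \<open>\<bar>h x\<bar>\<close>, used for
    both passages: test functions to open sets, and open sets to measurable sets.\<close>
  have dom: "(LINT x|?M. w x * h x) = 0"
    if "\<And>m. s m \<in> borel_measurable ?M" "w \<in> borel_measurable ?M" "\<And>m x. \<bar>s m x\<bar> \<le> (1::real)"
       "AE x in ?M. (\<lambda>m. s m x) \<longlonglongrightarrow> w x" "\<And>m::nat. (LINT x|?M. s m x * h x) = 0" for s w
  proof -
    have "(\<lambda>m. LINT x|?M. s m x * h x) \<longlonglongrightarrow> (LINT x|?M. w x * h x)"
    proof (rule integral_dominated_convergence)
      show "integrable ?M (\<lambda>x. \<bar>h x\<bar>)" using h by simp
      show "AE x in ?M. (\<lambda>m. s m x * h x) \<longlonglongrightarrow> w x * h x"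
        using that(4) by eventually_elim (intro tendsto_intros)
      show "AE x in ?M. norm (s m x * h x) \<le> \<bar>h x\<bar>" for m
        using that(3) by (intro AE_I2) (simp add: abs_mult mult_left_le_one_le)
    qed (use that(1,2) in measurable)
    then show ?thesis using that(5) by (simp add: LIMSEQ_const_iff)
  qed
  have op: "(LINT x|?M. indicator U x * h x) = 0" if U: "open U" "U \<subseteq> \<Omega>" for U
  proof -
    obtain \<psi> d\<psi> where \<psi>: "\<And>m. test_function U (\<psi> m) (d\<psi> m)" "\<And>m x. \<bar>\<psi> m x\<bar> \<le> 1"
        "\<And>x. (\<lambda>m. \<psi> m x) \<longlonglongrightarrow> indicator U x"
      by (rule test_functions_tendsto_indicator[OF U(1)]) blast
    show ?thesis
    proof (rule dom[of \<psi>])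
      show "\<psi> m \<in> borel_measurable ?M" for m
      proof (rule continuous_imp_measurable_on_sets_lebesgue[OF _ \<Omega>L])
        show "continuous_on \<Omega> (\<psi> m)"
          using \<psi>(1)[of m] unfolding test_function_def
          by (intro continuous_at_imp_continuous_on ballI) (meson has_derivative_continuous)
      qed
      have "test_function \<Omega> (\<psi> m) (d\<psi> m)" for m
        using \<psi>(1)[of m] U(2) unfolding test_function_def by (meson subset_trans)
      then show "(LINT x|?M. \<psi> m x * h x) = 0" for m by (rule test)
      have "U \<in> sets ?M" using U \<Omega>L by (auto simp: sets_restrict_space_iff)
      then show "indicator U \<in> borel_measurable ?M" by simp
    qed (use \<psi>(2,3) in \<open>auto intro: always_eventually\<close>)
  qed
  have "(LINT x:A|?M. h x) = (LINT x:A|?M. 0)" if A: "A \<in> sets ?M" for A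
  proof -
    have AL: "A \<in> sets lebesgue" "A \<subseteq> \<Omega>" using A \<Omega>L by (auto simp: sets_restrict_space_iff)
    obtain C T where CT: "gdelta C" "T \<in> null_sets lebesgue" "A \<union> T = C"
      using lebesgue_set_almost_gdelta[OF AL(1)] .
    obtain G :: "nat \<Rightarrow> _" where G: "\<And>n. open (G n)" "C = (\<Inter>n. G n)"
      using CT(1) by (auto simp: gdelta.simps)
    \<comment> \<open>Open subsets of \<open>\<Omega>\<close> decreasing to
      \<open>\<Omega> \<inter> C\<close>, which agrees with \<open>A\<close> outside the null set
      \<open>T\<close>.\<close>
    define H where "H = (\<lambda>m. \<Omega> \<inter> (\<Inter>k\<le>m. G k))"
    have H: "open (H m)" "H m \<subseteq> \<Omega>" for m
      unfolding H_def using \<Omega> G(1) by (auto intro!: open_Int open_INT)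
    have "(LINT x|?M. indicator A x * h x) = 0"
    proof (rule dom[of "\<lambda>m. indicator (H m)"])
      show "(indicator (H m) :: _ \<Rightarrow> real) \<in> borel_measurable ?M" for m
        using H[of m] \<Omega>L by (intro borel_measurable_indicator) (auto simp: sets_restrict_space_iff)
      show "(indicator A :: _ \<Rightarrow> real) \<in> borel_measurable ?M" using A by simp
      show "\<bar>indicator (H m) x\<bar> \<le> (1::real)" for m x by (simp add: indicator_def)
      show "(LINT x|?M. indicator (H m) x * h x) = 0" for m by (rule op[OF H])
      have "AE x in ?M. x \<notin> T"
        using CT(2) \<Omega>L AE_not_in[OF CT(2)] by (auto simp: AE_restrict_space_iff elim: eventually_mono)
      then show "AE x in ?M. (\<lambda>m. indicator (H m) x) \<longlonglongrightarrow> (indicator A x :: real)"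
        using AE_space
      proof eventually_elim
        case (elim x)
        show ?case
        proof (cases "x \<in> A")
          case True
          then have "x \<in> H m" for m using AL CT(3) G(2) by (auto simp: H_def)
          then show ?thesis using True by simp
        next
          case False
          then have "x \<notin> C" using CT(3) elim by auto
          then obtain k where "x \<notin> G k" using G(2) by auto
          then have "x \<notin> H m" if "m \<ge> k" for m using that by (auto simp: H_def)
          then have "\<forall>\<^sub>F m in sequentially. indicator (H m) x = (0::real)"
            unfolding eventually_sequentially by (intro exI[of _ k]) simp
          then show ?thesis using False by (simp add: tendsto_eventually)
        qed
      qed
    qed
    then show ?thesis by (simp add: set_lebesgue_integral_def)
  qed
  note * = this
  show ?thesis
    by (rule density_unique_real[OF h _ *]) simp_all
qed

section \<open>Uniqueness and almost-everywhere linearity of weak gradients\<close>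

lemma test_function_bounded:
  assumes \<psi>: "test_function U \<psi> d\<psi>" and \<Omega>: "bounded \<Omega>" "\<Omega> \<in> sets lebesgue"
  obtains C where "\<psi> \<in> borel_measurable (lebesgue_on \<Omega>)" "d\<psi> \<in> borel_measurable (lebesgue_on \<Omega>)"
    "\<And>x. x \<in> \<Omega> \<Longrightarrow> \<bar>\<psi> x\<bar> \<le> C" "\<And>x. x \<in> \<Omega> \<Longrightarrow> norm (d\<psi> x) \<le> C"
proof -
  have c: "continuous_on UNIV \<psi>" "continuous_on UNIV d\<psi>"
    using \<psi> unfolding test_function_def
    by (auto intro!: continuous_at_imp_continuous_on) (meson has_derivative_continuous)
  have cl: "compact (closure \<Omega>)" using \<Omega> by simp
  have "bounded (\<psi> ` closure \<Omega>)" "bounded (d\<psi> ` closure \<Omega>)"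
    using c by (auto intro!: compact_imp_bounded compact_continuous_image cl intro: continuous_on_subset)
  then obtain C1 C2 where C: "\<And>x. x \<in> closure \<Omega> \<Longrightarrow> \<bar>\<psi> x\<bar> \<le> C1" "\<And>x. x \<in> closure \<Omega> \<Longrightarrow> norm (d\<psi> x) \<le> C2"
    unfolding bounded_iff by auto
  have *: "x \<in> closure \<Omega>" if "x \<in> \<Omega>" for x using that closure_subset by auto
  show ?thesis
  proof (rule that[of "max C1 C2"])
    show "\<psi> \<in> borel_measurable (lebesgue_on \<Omega>)" "d\<psi> \<in> borel_measurable (lebesgue_on \<Omega>)"
      using c \<Omega>(2) by (auto intro!: continuous_imp_measurable_on_sets_lebesgue intro: continuous_on_subset)
  qed (use C * in \<open>auto simp: le_max_iff_disj\<close>)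
qed

lemma test_function_integrable:
  fixes g :: "real ^ 'd::finite \<Rightarrow> real ^ 'd"
  assumes \<psi>: "test_function U \<psi> d\<psi>" and \<Omega>: "bounded \<Omega>" "\<Omega> \<in> sets lebesgue"
  shows "integrable (lebesgue_on \<Omega>) v \<Longrightarrow> integrable (lebesgue_on \<Omega>) (\<lambda>x. v x *\<^sub>R d\<psi> x)"
    and "integrable (lebesgue_on \<Omega>) g \<Longrightarrow> integrable (lebesgue_on \<Omega>) (\<lambda>x. \<psi> x *\<^sub>R g x)"
proof -
  obtain C where C: "\<psi> \<in> borel_measurable (lebesgue_on \<Omega>)" "d\<psi> \<in> borel_measurable (lebesgue_on \<Omega>)"
    "\<And>x. x \<in> \<Omega> \<Longrightarrow> \<bar>\<psi> x\<bar> \<le> C" "\<And>x. x \<in> \<Omega> \<Longrightarrow> norm (d\<psi> x) \<le> C"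
    by (rule test_function_bounded[OF assms]) blast
  show "integrable (lebesgue_on \<Omega>) (\<lambda>x. v x *\<^sub>R d\<psi> x)" if v: "integrable (lebesgue_on \<Omega>) v"
  proof (rule Bochner_Integration.integrable_bound)
    show "integrable (lebesgue_on \<Omega>) (\<lambda>x. C * \<bar>v x\<bar>)" using v by simp
    show "(\<lambda>x. v x *\<^sub>R d\<psi> x) \<in> borel_measurable (lebesgue_on \<Omega>)"
      using v C(2) by measurable
    show "AE x in lebesgue_on \<Omega>. norm (v x *\<^sub>R d\<psi> x) \<le> norm (C * \<bar>v x\<bar>)"
    proof (rule AE_I2)
      fix x assume "x \<in> space (lebesgue_on \<Omega>)"
      then have "norm (d\<psi> x) \<le> \<bar>C\<bar>" using C(4)[of x] by simp
      from mult_left_mono[OF this abs_ge_zero[of "v x"]]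
      show "norm (v x *\<^sub>R d\<psi> x) \<le> norm (C * \<bar>v x\<bar>)"
        by (simp add: abs_mult mult.commute)
    qed
  qed
  show "integrable (lebesgue_on \<Omega>) (\<lambda>x. \<psi> x *\<^sub>R g x)" if g: "integrable (lebesgue_on \<Omega>) g"
  proof (rule Bochner_Integration.integrable_bound)
    show "integrable (lebesgue_on \<Omega>) (\<lambda>x. C *\<^sub>R g x)" using g by simp
    show "(\<lambda>x. \<psi> x *\<^sub>R g x) \<in> borel_measurable (lebesgue_on \<Omega>)"
      using g C(1) by measurable
    show "AE x in lebesgue_on \<Omega>. norm (\<psi> x *\<^sub>R g x) \<le> norm (C *\<^sub>R g x)"
      using C(3) by (intro AE_I2) (auto intro!: mult_right_mono order_trans[OF C(3) abs_ge_self])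
  qed
qed

text \<open>Each component of the difference satisfies the fundamental lemma. Boundedness of the
  domain makes square-integrable fields integrable, so that the two defining integrals may be
  subtracted.\<close>

lemma weak_gradient_unique:
  assumes \<Omega>: "open \<Omega>" "bounded \<Omega>"
    and g: "g \<in> L2 \<Omega>" "weak_gradient \<Omega> v g" and g': "g' \<in> L2 \<Omega>" "weak_gradient \<Omega> v g'"
  shows "AE x in lebesgue_on \<Omega>. g x = g' x"
proof -
  have \<Omega>': "\<Omega> \<in> lmeasurable" "\<Omega> \<in> sets lebesgue"
    using \<Omega> by (auto intro: lmeasurable_open)
  have int: "integrable (lebesgue_on \<Omega>) g" "integrable (lebesgue_on \<Omega>) g'"
    using L2_integrable[OF \<Omega>'(1)] g g' by auto
  have comp: "AE x in lebesgue_on \<Omega>. (g x - g' x) \<bullet> axis i 1 = 0" for i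
  proof (rule AE_zero_if_test_integrals_zero[OF \<Omega>(1)])
    show "integrable (lebesgue_on \<Omega>) (\<lambda>x. (g x - g' x) \<bullet> axis i 1)"
      using int by simp
    fix \<psi> d\<psi> assume \<psi>: "test_function \<Omega> \<psi> d\<psi>"
    note i = test_function_integrable(2)[OF \<psi> \<Omega>(2) \<Omega>'(2)]
    have "(LINT x|lebesgue_on \<Omega>. \<psi> x *\<^sub>R g x) = (LINT x|lebesgue_on \<Omega>. \<psi> x *\<^sub>R g' x)"
      using g(2)[unfolded weak_gradient_def, rule_format, OF \<psi>]
        g'(2)[unfolded weak_gradient_def, rule_format, OF \<psi>] by simp
    then have "(LINT x|lebesgue_on \<Omega>. \<psi> x *\<^sub>R g x - \<psi> x *\<^sub>R g' x) = 0"
      using i[OF int(1)] i[OF int(2)] by simp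
    moreover have "(LINT x|lebesgue_on \<Omega>. (\<psi> x *\<^sub>R g x - \<psi> x *\<^sub>R g' x) \<bullet> axis i 1) =
          (LINT x|lebesgue_on \<Omega>. \<psi> x *\<^sub>R g x - \<psi> x *\<^sub>R g' x) \<bullet> axis i 1"
      using i[OF int(1)] i[OF int(2)] by (intro integral_inner_left) auto
    ultimately show "(LINT x|lebesgue_on \<Omega>. \<psi> x * ((g x - g' x) \<bullet> axis i 1)) = 0"
      by (simp add: inner_diff_left right_diff_distrib)
  qed
  then have "AE x in lebesgue_on \<Omega>. \<forall>i. (g x - g' x) \<bullet> axis i 1 = 0"
    by (simp add: AE_all_countable)
  then show ?thesis
    by eventually_elim (simp add: inner_axis vec_eq_iff)
qed

lemma H1_grad:
  assumes "v \<in> H1 \<Omega>"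
  shows "grad \<Omega> v \<in> L2 \<Omega>" "weak_gradient \<Omega> v (grad \<Omega> v)"
  using someI_ex[of "\<lambda>g. g \<in> L2 \<Omega> \<and> weak_gradient \<Omega> v g"] assms
  by (auto simp: H1_def grad_def)

lemma H1_L2: "v \<in> H1 \<Omega> \<Longrightarrow> v \<in> L2 \<Omega>"
  by (simp add: H1_def)

text \<open>The combination of the chosen gradients is a weak gradient of the combination, and
  uniqueness identifies it with the chosen one. Since \<open>grad\<close> selects a representative
  per function, equality can be had only almost everywhere.\<close>

lemma grad_lincomb:
  assumes \<Omega>: "open \<Omega>" "bounded \<Omega>" and v: "v \<in> H1 \<Omega>" and w: "w \<in> H1 \<Omega>"
  shows "(\<lambda>x. a * v x + b * w x) \<in> H1 \<Omega>"
    and "AE x in lebesgue_on \<Omega>. grad \<Omega> (\<lambda>x. a * v x + b * w x) x = a *\<^sub>R grad \<Omega> v x + b *\<^sub>R grad \<Omega> w x"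
proof -
  let ?g = "\<lambda>x. a *\<^sub>R grad \<Omega> v x + b *\<^sub>R grad \<Omega> w x"
  have \<Omega>': "\<Omega> \<in> lmeasurable" "\<Omega> \<in> sets lebesgue"
    using \<Omega> by (auto intro: lmeasurable_open)
  have gL: "?g \<in> L2 \<Omega>" by (intro L2_lincomb H1_grad v w)
  have vL: "(\<lambda>x. a * v x + b * w x) \<in> L2 \<Omega>"
    using L2_lincomb[OF H1_L2[OF v] H1_L2[OF w], of a b] by simp
  have wg: "weak_gradient \<Omega> (\<lambda>x. a * v x + b * w x) ?g"
    unfolding weak_gradient_def
  proof (intro allI impI)
    fix \<psi> d\<psi> assume \<psi>: "test_function \<Omega> \<psi> d\<psi>"
    note i = test_function_integrable[OF \<psi> \<Omega>(2) \<Omega>'(2)]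
    have i1: "integrable (lebesgue_on \<Omega>) (\<lambda>x. v x *\<^sub>R d\<psi> x)" "integrable (lebesgue_on \<Omega>) (\<lambda>x. w x *\<^sub>R d\<psi> x)"
      using i(1) L2_integrable[OF \<Omega>'(1)] H1_L2 v w by auto
    have i2: "integrable (lebesgue_on \<Omega>) (\<lambda>x. \<psi> x *\<^sub>R grad \<Omega> v x)" "integrable (lebesgue_on \<Omega>) (\<lambda>x. \<psi> x *\<^sub>R grad \<Omega> w x)"
      using i(2) L2_integrable[OF \<Omega>'(1)] H1_grad v w by auto
    have "(LINT x|lebesgue_on \<Omega>. (a * v x + b * w x) *\<^sub>R d\<psi> x)
        = (LINT x|lebesgue_on \<Omega>. a *\<^sub>R (v x *\<^sub>R d\<psi> x) + b *\<^sub>R (w x *\<^sub>R d\<psi> x))"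
      by (simp add: scaleR_add_left)
    also have "\<dots> = a *\<^sub>R (LINT x|lebesgue_on \<Omega>. v x *\<^sub>R d\<psi> x) + b *\<^sub>R (LINT x|lebesgue_on \<Omega>. w x *\<^sub>R d\<psi> x)"
      using i1 by (simp del: scaleR_scaleR)
    also have "\<dots> = - (a *\<^sub>R (LINT x|lebesgue_on \<Omega>. \<psi> x *\<^sub>R grad \<Omega> v x) + b *\<^sub>R (LINT x|lebesgue_on \<Omega>. \<psi> x *\<^sub>R grad \<Omega> w x))"
      using H1_grad(2)[OF v] H1_grad(2)[OF w] \<psi> unfolding weak_gradient_def by simp
    also have "\<dots> = - (LINT x|lebesgue_on \<Omega>. a *\<^sub>R (\<psi> x *\<^sub>R grad \<Omega> v x) + b *\<^sub>R (\<psi> x *\<^sub>R grad \<Omega> w x))"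
      using i2 by (simp del: scaleR_scaleR)
    also have "\<dots> = - (LINT x|lebesgue_on \<Omega>. \<psi> x *\<^sub>R ?g x)"
      by (simp add: scaleR_add_right mult.commute)
    finally show "(LINT x|lebesgue_on \<Omega>. (a * v x + b * w x) *\<^sub>R d\<psi> x) = - (LINT x|lebesgue_on \<Omega>. \<psi> x *\<^sub>R ?g x)" .
  qed
  show H: "(\<lambda>x. a * v x + b * w x) \<in> H1 \<Omega>"
    unfolding H1_def using vL gL wg by blast
  show "AE x in lebesgue_on \<Omega>. grad \<Omega> (\<lambda>x. a * v x + b * w x) x = ?g x"
    by (rule weak_gradient_unique[OF \<Omega> H1_grad[OF H] gL wg])
qed

section \<open>Change of variables\<close>

text \<open>The change of variables theorem of the library is restricted to vectors indexed by a well-ordered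
  finite type. A bijection of index types is a measure-preserving isometry that leaves determinants
  unchanged, so the theorem carries over to any index type with two or three elements.\<close>

definition reindex_vec :: "('b \<Rightarrow> 'a) \<Rightarrow> real ^ 'a \<Rightarrow> real ^ 'b" where
  "reindex_vec \<sigma> x = (\<chi> j. x $ \<sigma> j)"

lemma reindex_vec_nth [simp]: "reindex_vec \<sigma> x $ j = x $ \<sigma> j"
  by (simp add: reindex_vec_def)

lemma linear_reindex_vec: "linear (reindex_vec \<sigma> :: real ^ 'a \<Rightarrow> real ^ 'b)"
  for \<sigma> :: "'b::finite \<Rightarrow> 'a::finite"
  by (rule linearI) (simp_all add: vec_eq_iff)

lemma reindex_vec_inverse:
  assumes "bij \<sigma>"
  shows "reindex_vec (inv \<sigma>) (reindex_vec \<sigma> x) = x" "reindex_vec \<sigma> (reindex_vec (inv \<sigma>) y) = y"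
  using assms by (simp_all add: vec_eq_iff bij_is_surj surj_f_inv_f bij_is_inj)

lemma prod_Basis_cart:
  fixes f :: "real ^ 'n::finite \<Rightarrow> 'b::comm_monoid_mult"
  shows "(\<Prod>b\<in>Basis. f b) = (\<Prod>i\<in>UNIV. f (axis i 1))"
proof -
  have "bij_betw (\<lambda>i. axis i 1) UNIV (Basis :: (real ^ 'n) set)"
    by (auto simp: bij_betw_def inj_on_def axis_eq_axis Basis_vec_def)
  then show ?thesis
    by (rule prod.reindex_bij_betw[symmetric])
qed

text \<open>Boxes pull back to boxes with permuted edge lengths, and the product of the lengths does
  not see the order. Lebesgue measure is determined by its values on boxes.\<close>

lemma distr_lborel_reindex_vec:
  fixes \<sigma> :: "'b::finite \<Rightarrow> 'a::finite"
  assumes "bij \<sigma>"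
  shows "distr lborel borel (reindex_vec \<sigma>) = (lborel :: (real ^ 'b) measure)"
proof (rule lborel_eqI[symmetric])
  fix l u :: "real ^ 'b"
  assume le: "\<And>b. b \<in> Basis \<Longrightarrow> l \<bullet> b \<le> u \<bullet> b"
  have le': "l $ i \<le> u $ i" for i
    using le[of "axis i 1"] by (simp add: inner_axis)
  have [measurable]: "(reindex_vec \<sigma> :: real ^ 'a \<Rightarrow> _) \<in> borel_measurable borel"
    by (intro borel_measurable_continuous_onI linear_continuous_on linear_conv_bounded_linear[THEN iffD1] linear_reindex_vec)
  have "reindex_vec \<sigma> -` box l u = box (reindex_vec (inv \<sigma>) l) (reindex_vec (inv \<sigma>) u)"
  proof (rule set_eqI)
    fix x
    have all: "(\<forall>j. Q j) \<longleftrightarrow> (\<forall>i. Q (\<sigma> i))" for Q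
      using bij_is_surj[OF assms] by (metis surjD)
    show "x \<in> reindex_vec \<sigma> -` box l u \<longleftrightarrow> x \<in> box (reindex_vec (inv \<sigma>) l) (reindex_vec (inv \<sigma>) u)"
      using all[of "\<lambda>j. l $ inv \<sigma> j < x $ j \<and> x $ j < u $ inv \<sigma> j"] bij_is_inj[OF assms]
      by (simp add: mem_box_cart)
  qed
  then have "emeasure (distr lborel borel (reindex_vec \<sigma>)) (box l u)
      = emeasure lborel (box (reindex_vec (inv \<sigma>) l) (reindex_vec (inv \<sigma>) u))"
    by (simp add: emeasure_distr)
  also have "\<dots> = (\<Prod>j\<in>UNIV. u $ inv \<sigma> j - l $ inv \<sigma> j)"
    using le' by (subst emeasure_lborel_box, force simp: Basis_vec_def inner_axis, simp add: prod_Basis_cart inner_axis)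
  also have "(\<Prod>j\<in>UNIV. u $ inv \<sigma> j - l $ inv \<sigma> j) = (\<Prod>i\<in>UNIV. u $ i - l $ i)"
    using prod.reindex_bij_betw[OF bij_imp_bij_inv[OF assms], of "\<lambda>i. u $ i - l $ i"] by simp
  finally show "emeasure (distr lborel borel (reindex_vec \<sigma>)) (box l u)
      = ennreal (\<Prod>b\<in>Basis. (u - l) \<bullet> b)"
    by (simp add: prod_Basis_cart inner_axis)
qed simp

text \<open>Passage to the completion: the push-forward of Lebesgue measure is \<open>lborel\<close>
  itself, so null sets pull back to null sets.\<close>

lemma distr_lebesgue_reindex_vec:
  fixes \<sigma> :: "'b::finite \<Rightarrow> 'a::finite"
  assumes "bij \<sigma>"
  shows "reindex_vec \<sigma> \<in> lebesgue \<rightarrow>\<^sub>M (lebesgue :: (real ^ 'b) measure)"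
    and "distr lebesgue lebesgue (reindex_vec \<sigma>) = (lebesgue :: (real ^ 'b) measure)"
proof -
  have m: "(reindex_vec \<sigma> :: real ^ 'a \<Rightarrow> _) \<in> borel_measurable borel"
    by (intro borel_measurable_continuous_onI linear_continuous_on linear_conv_bounded_linear[THEN iffD1] linear_reindex_vec)
  then have m': "(reindex_vec \<sigma> :: real ^ 'a \<Rightarrow> _) \<in> lebesgue \<rightarrow>\<^sub>M lborel"
    by (simp add: measurable_completion)
  have eq: "distr lebesgue lborel (reindex_vec \<sigma>) = (lborel :: (real ^ 'b) measure)"
    using m distr_lborel_reindex_vec[OF assms]
    by (subst distr_completion) (simp_all cong: distr_cong)
  show "reindex_vec \<sigma> \<in> lebesgue \<rightarrow>\<^sub>M (lebesgue :: (real ^ 'b) measure)"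
    by (rule completion.measurable_completion2[OF m']) (simp add: eq)
  show "distr lebesgue lebesgue (reindex_vec \<sigma>) = (lebesgue :: (real ^ 'b) measure)"
    using completion.completion_distr_eq[OF m'] by (simp add: eq)
qed

lemma absolutely_integrable_reindex_vec_imp:
  fixes \<sigma> :: "'b::finite \<Rightarrow> 'a::finite" and f :: "real ^ 'b \<Rightarrow> 'c::euclidean_space"
  assumes \<sigma>: "bij \<sigma>" and f: "f absolutely_integrable_on (reindex_vec \<sigma> ` S)"
  shows "(\<lambda>x. f (reindex_vec \<sigma> x)) absolutely_integrable_on S"
    and "integral S (\<lambda>x. f (reindex_vec \<sigma> x)) = integral (reindex_vec \<sigma> ` S) f"
proof -
  let ?T = "reindex_vec \<sigma> :: real ^ 'a \<Rightarrow> real ^ 'b"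
  have ind: "indicator (?T ` S) (?T x) = (indicator S x :: real)" for x
    using inj_image_mem_iff[OF inj_on_inverseI[where f = ?T], of "reindex_vec (inv \<sigma>)"] reindex_vec_inverse[OF \<sigma>]
    by (simp add: indicator_def)
  have i: "integrable lebesgue (\<lambda>y. indicator (?T ` S) y *\<^sub>R f y)"
    using f by (simp add: set_integrable_def)
  then have "integrable (distr lebesgue lebesgue ?T) (\<lambda>y. indicator (?T ` S) y *\<^sub>R f y)"
    by (simp add: distr_lebesgue_reindex_vec[OF \<sigma>])
  from integrable_distr[OF distr_lebesgue_reindex_vec(1)[OF \<sigma>] this]
  show ai: "(\<lambda>x. f (?T x)) absolutely_integrable_on S"
    by (simp add: set_integrable_def ind)
  have "(LINT y|lebesgue. indicator (?T ` S) y *\<^sub>R f y)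
      = (LINT y|distr lebesgue lebesgue ?T. indicator (?T ` S) y *\<^sub>R f y)"
    by (simp add: distr_lebesgue_reindex_vec[OF \<sigma>])
  also have "\<dots> = (LINT x|lebesgue. indicator S x *\<^sub>R f (?T x))"
    using i by (subst integral_distr[OF distr_lebesgue_reindex_vec(1)[OF \<sigma>]]) (auto simp: ind)
  finally show "integral S (\<lambda>x. f (?T x)) = integral (?T ` S) f"
    using set_lebesgue_integral_eq_integral(2)[OF ai] set_lebesgue_integral_eq_integral(2)[OF f]
    by (simp add: set_lebesgue_integral_def)
qed

text \<open>The converse is the forward direction for \<open>inv \<sigma>\<close>. Integrability and
  value stay in one equivalence because the change of variables theorem has that shape.\<close>

lemma absolutely_integrable_reindex_vec:
  fixes \<sigma> :: "'b::finite \<Rightarrow> 'a::finite" and f :: "real ^ 'b \<Rightarrow> 'c::euclidean_space"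
  assumes \<sigma>: "bij \<sigma>"
  shows "(\<lambda>x. f (reindex_vec \<sigma> x)) absolutely_integrable_on S \<and>
           integral S (\<lambda>x. f (reindex_vec \<sigma> x)) = c \<longleftrightarrow>
         f absolutely_integrable_on (reindex_vec \<sigma> ` S) \<and> integral (reindex_vec \<sigma> ` S) f = c"
proof -
  have "f absolutely_integrable_on (reindex_vec \<sigma> ` S)"
    if "(\<lambda>x. f (reindex_vec \<sigma> x)) absolutely_integrable_on S"
    using absolutely_integrable_reindex_vec_imp(1)[OF bij_imp_bij_inv[OF \<sigma>],
        where f = "\<lambda>x. f (reindex_vec \<sigma> x)" and S = "reindex_vec \<sigma> ` S"] that
    by (simp add: image_image reindex_vec_inverse[OF \<sigma>])
  then show ?thesis
    using absolutely_integrable_reindex_vec_imp[OF \<sigma>, where f = f and S = S] by auto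
qed

text \<open>In the Leibniz formula, \<open>map_permutation UNIV \<sigma>\<close> conjugates by
  \<open>\<sigma>\<close>: a sign-preserving bijection between the permutations of the two index
  types.\<close>

lemma det_reindex:
  fixes \<sigma> :: "'b::finite \<Rightarrow> 'a::finite" and A :: "real ^ 'a ^ 'a"
  assumes \<sigma>: "bij \<sigma>"
  shows "det (\<chi> i j. A $ \<sigma> i $ \<sigma> j) = det A"
proof -
  have \<sigma>': "bij_betw \<sigma> UNIV UNIV" "inj \<sigma>" "bij (inv \<sigma>)"
    using \<sigma> by (auto simp: bij_is_inj bij_imp_bij_inv)
  have bij: "bij_betw (map_permutation UNIV \<sigma>) {p. p permutes UNIV} {p. p permutes UNIV}"
  proof (rule bij_betwI[where g = "map_permutation UNIV (inv \<sigma>)"])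
    show "map_permutation UNIV \<sigma> \<in> {p. p permutes UNIV} \<rightarrow> {p. p permutes UNIV}"
      using map_permutation_permutes[OF \<sigma>'(1)] by auto
    show "map_permutation UNIV (inv \<sigma>) \<in> {p. p permutes UNIV} \<rightarrow> {p. p permutes UNIV}"
      using map_permutation_permutes[OF \<sigma>'(3)] by auto
    show "map_permutation UNIV (inv \<sigma>) (map_permutation UNIV \<sigma> p) = p" if "p \<in> {p. p permutes UNIV}" for p
      using that \<sigma>'(2) by (intro map_permutation_compose_inv[OF \<sigma>'(1)]) auto
    show "map_permutation UNIV \<sigma> (map_permutation UNIV (inv \<sigma>) p) = p" if "p \<in> {p. p permutes UNIV}" for p
      using that \<sigma> by (intro map_permutation_compose_inv[OF \<sigma>'(3)]) (auto simp: bij_is_surj surj_f_inv_f)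
  qed
  have "det A = (\<Sum>p | p permutes UNIV. of_int (sign (map_permutation UNIV \<sigma> p)) *
                   (\<Prod>i\<in>UNIV. A $ i $ map_permutation UNIV \<sigma> p i))"
    unfolding det_def using sum.reindex_bij_betw[OF bij, symmetric] .
  also have "\<dots> = (\<Sum>p | p permutes UNIV. of_int (sign p) * (\<Prod>i\<in>UNIV. A $ \<sigma> i $ \<sigma> (p i)))"
  proof (rule sum.cong[OF refl])
    fix p :: "'b \<Rightarrow> 'b" assume "p \<in> {p. p permutes UNIV}"
    then have "sign (map_permutation UNIV \<sigma> p) = sign p"
      using \<sigma>'(2) by (intro sign_map_permutation) auto
    moreover have "(\<Prod>i\<in>UNIV. A $ i $ map_permutation UNIV \<sigma> p i) = (\<Prod>i\<in>UNIV. A $ \<sigma> i $ \<sigma> (p i))"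
      using prod.reindex_bij_betw[OF \<sigma>, symmetric, of "\<lambda>i. A $ i $ map_permutation UNIV \<sigma> p i"]
      by (simp add: map_permutation_apply[OF \<sigma>'(2)])
    ultimately show "of_int (sign (map_permutation UNIV \<sigma> p)) * (\<Prod>i\<in>UNIV. A $ i $ map_permutation UNIV \<sigma> p i)
        = of_int (sign p) * (\<Prod>i\<in>UNIV. A $ \<sigma> i $ \<sigma> (p i))"
      by simp
  qed
  finally show ?thesis
    by (simp add: det_def)
qed

text \<open>The theorem is applied to the conjugate \<open>T \<circ> g \<circ> R\<close> and the
  integrand \<open>f \<circ> R\<close>; reindexing moves the integrals on both sides back, and the
  matrix of the conjugated derivative is a relabelling, so its determinant is the old one.\<close>

lemma change_of_variables_reindex:
  fixes \<sigma> :: "'d::finite \<Rightarrow> 'e::{finite, wellorder}"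
    and f :: "real ^ 'd \<Rightarrow> real ^ 'n::finite" and g :: "real ^ 'd \<Rightarrow> real ^ 'd"
  assumes \<sigma>: "bij \<sigma>" and S: "S \<in> sets lebesgue"
    and g': "\<And>x. x \<in> S \<Longrightarrow> (g has_derivative g' x) (at x within S)"
    and inj: "inj_on g S"
  shows "(\<lambda>x. \<bar>det (matrix (g' x))\<bar> *\<^sub>R f (g x)) absolutely_integrable_on S \<and>
           integral S (\<lambda>x. \<bar>det (matrix (g' x))\<bar> *\<^sub>R f (g x)) = b
     \<longleftrightarrow> f absolutely_integrable_on (g ` S) \<and> integral (g ` S) f = b"
proof -
  define T :: "real ^ 'd \<Rightarrow> real ^ 'e::_" where "T = reindex_vec (inv \<sigma>)"
  define R :: "real ^ 'e::_ \<Rightarrow> real ^ 'd" where "R = reindex_vec \<sigma>"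
  have RT [simp]: "R (T x) = x" "T (R y) = y" for x y
    using reindex_vec_inverse[OF \<sigma>] by (simp_all add: R_def T_def)
  have lin: "linear T" "linear R"
    by (simp_all add: T_def R_def linear_reindex_vec)
  have bl: "bounded_linear T" "bounded_linear R"
    using lin by (simp_all add: linear_conv_bounded_linear)
  have RS: "R ` T ` X = X" "T ` R ` Z = Z" for X Z
    by (simp_all add: image_image)
  have TS: "T ` S \<in> sets lebesgue"
  proof -
    have "T ` S = R -` S \<inter> space lebesgue"
      using RT(2) by (force simp: image_iff)
    then show ?thesis
      using measurable_sets[OF distr_lebesgue_reindex_vec(1)[OF \<sigma>] S] by (simp add: R_def)
  qed
  have der: "((T \<circ> g \<circ> R) has_derivative (T \<circ> g' (R y) \<circ> R)) (at y within T ` S)" if "y \<in> T ` S" for y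
  proof -
    have "R y \<in> S" using that by auto
    have "((\<lambda>x. T (g (R x))) has_derivative (\<lambda>h. T (g' (R y) (R h)))) (at y within T ` S)"
    proof (rule bounded_linear.has_derivative[OF bl(1)])
      have "(g has_derivative g' (R y)) (at (R y) within R ` T ` S)"
        using g'[OF \<open>R y \<in> S\<close>] by (simp add: RS)
      from has_derivative_in_compose[OF bounded_linear_imp_has_derivative[OF bl(2)] this]
      show "((\<lambda>x. g (R x)) has_derivative (\<lambda>h. g' (R y) (R h))) (at y within T ` S)" .
    qed
    then show ?thesis by (simp add: o_def)
  qed
  have inj': "inj_on (T \<circ> g \<circ> R) (T ` S)"
  proof (rule inj_onI)
    fix y z assume "y \<in> T ` S" "z \<in> T ` S" and eq: "(T \<circ> g \<circ> R) y = (T \<circ> g \<circ> R) z"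
    then obtain a b where ab: "a \<in> S" "b \<in> S" "y = T a" "z = T b" by blast
    have "R (T (g a)) = R (T (g b))"
      using eq ab by simp
    then have "g a = g b" by simp
    then show "y = z"
      using inj ab by (simp add: inj_on_eq_iff)
  qed
  have det: "det (matrix (T \<circ> g' x \<circ> R)) = det (matrix (g' x))" if "x \<in> S" for x
  proof -
    have "R (axis j 1) = axis (inv \<sigma> j) 1" for j
      using \<sigma> by (auto simp: R_def vec_eq_iff axis_def bij_is_inj bij_is_surj surj_f_inv_f)
    then have "matrix (T \<circ> g' x \<circ> R) = (\<chi> i j. matrix (g' x) $ inv \<sigma> i $ inv \<sigma> j)"
      by (subst vec_eq_iff, subst vec_eq_iff) (simp add: matrix_def T_def)
    then show ?thesis
      using det_reindex[OF bij_imp_bij_inv[OF \<sigma>]] by metis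
  qed
  have "(\<lambda>x. \<bar>det (matrix (g' x))\<bar> *\<^sub>R f (g x)) absolutely_integrable_on S \<and>
           integral S (\<lambda>x. \<bar>det (matrix (g' x))\<bar> *\<^sub>R f (g x)) = b
     \<longleftrightarrow> (\<lambda>y. \<bar>det (matrix (g' (R y)))\<bar> *\<^sub>R f (g (R y))) absolutely_integrable_on (T ` S) \<and>
           integral (T ` S) (\<lambda>y. \<bar>det (matrix (g' (R y)))\<bar> *\<^sub>R f (g (R y))) = b"
    using absolutely_integrable_reindex_vec[OF bij_imp_bij_inv[OF \<sigma>],
        where f = "\<lambda>y. \<bar>det (matrix (g' (R y)))\<bar> *\<^sub>R f (g (R y))" and S = S and c = b] RT
    by (simp flip: T_def)
  also have "\<dots> \<longleftrightarrow> (\<lambda>y. \<bar>det (matrix (T \<circ> g' (R y) \<circ> R))\<bar> *\<^sub>R (f \<circ> R) ((T \<circ> g \<circ> R) y)) absolutely_integrable_on (T ` S) \<and>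
           integral (T ` S) (\<lambda>y. \<bar>det (matrix (T \<circ> g' (R y) \<circ> R))\<bar> *\<^sub>R (f \<circ> R) ((T \<circ> g \<circ> R) y)) = b"
    by (intro conj_cong set_integrable_cong arg_cong2[where f = "(=)"] Henstock_Kurzweil_Integration.integral_cong)
       (auto simp: det)
  also have "\<dots> \<longleftrightarrow> (f \<circ> R) absolutely_integrable_on ((T \<circ> g \<circ> R) ` T ` S) \<and> integral ((T \<circ> g \<circ> R) ` T ` S) (f \<circ> R) = b"
    by (rule has_absolute_integral_change_of_variables[OF TS der inj'])
  also have "(T \<circ> g \<circ> R) ` T ` S = T ` g ` S"
    by (simp add: image_image)
  also have "(f \<circ> R) absolutely_integrable_on (T ` g ` S) \<and> integral (T ` g ` S) (f \<circ> R) = b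
      \<longleftrightarrow> f absolutely_integrable_on (g ` S) \<and> integral (g ` S) f = b"
    using absolutely_integrable_reindex_vec[OF \<sigma>, where f = f and S = "T ` g ` S" and c = b]
    by (simp add: o_def RS flip: R_def)
  finally show ?thesis .
qed

text \<open>The dimension assumption enters here: the numeral types \<open>2\<close> and
  \<open>3\<close> are well-ordered index types of the right size.\<close>

lemma change_of_variables_2_3:
  fixes f :: "real ^ 'd::finite \<Rightarrow> real ^ 'n::finite" and g :: "real ^ 'd \<Rightarrow> real ^ 'd"
  assumes dim: "CARD('d) = 2 \<or> CARD('d) = 3" and S: "S \<in> sets lebesgue"
    and g': "\<And>x. x \<in> S \<Longrightarrow> (g has_derivative g' x) (at x within S)"
    and inj: "inj_on g S"
  shows "(\<lambda>x. \<bar>det (matrix (g' x))\<bar> *\<^sub>R f (g x)) absolutely_integrable_on S \<and>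
           integral S (\<lambda>x. \<bar>det (matrix (g' x))\<bar> *\<^sub>R f (g x)) = b
     \<longleftrightarrow> f absolutely_integrable_on (g ` S) \<and> integral (g ` S) f = b"
  using dim
proof
  assume "CARD('d) = 2"
  then obtain \<sigma> :: "'d \<Rightarrow> 2" where "bij \<sigma>"
    using finite_same_card_bij[of "UNIV :: 'd set" "UNIV :: 2 set"] by auto
  then show ?thesis
    by (rule change_of_variables_reindex[OF _ S g' inj])
next
  assume "CARD('d) = 3"
  then obtain \<sigma> :: "'d \<Rightarrow> 3" where "bij \<sigma>"
    using finite_same_card_bij[of "UNIV :: 'd set" "UNIV :: 3 set"] by auto
  then show ?thesis
    by (rule change_of_variables_reindex[OF _ S g' inj])
qed

section \<open>Transfer of the kinetic histories\<close>

text \<open>Overlap is allowed because neighbouring closed elements share faces.\<close>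

lemma L2_Un:
  assumes A: "A \<in> sets lebesgue" "f \<in> L2 A" and B: "B \<in> sets lebesgue" "f \<in> L2 B"
  shows "f \<in> L2 (A \<union> B)"
proof -
  have m: "(\<lambda>x. if x \<in> A then f x else 0) \<in> borel_measurable lebesgue"
    "(\<lambda>x. if x \<in> B then f x else 0) \<in> borel_measurable lebesgue"
    using L2_measurable[OF A(2)] L2_measurable[OF B(2)] borel_measurable_if[OF A(1)] borel_measurable_if[OF B(1)]
    by blast+
  have "(\<lambda>x. if x \<in> A then (if x \<in> A then f x else 0) else (if x \<in> B then f x else 0)) \<in> borel_measurable lebesgue"
    by (rule measurable_If_set[OF m]) (use A(1) in simp)
  then have "(\<lambda>x. if x \<in> A \<union> B then f x else 0) \<in> borel_measurable lebesgue"
    by (rule measurable_cong[THEN iffD1, rotated]) simp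
  then have "f \<in> borel_measurable (lebesgue_on (A \<union> B))"
    using borel_measurable_if[of "A \<union> B"] A B by blast
  moreover have "set_integrable lebesgue (A \<union> B) (\<lambda>x. (norm (f x))\<^sup>2)"
    using L2_norm_sq[OF A(2)] L2_norm_sq[OF B(2)] A(1) B(1)
    by (intro set_integrable_Un) (simp_all add: set_integrable_def integrable_restrict_space)
  ultimately show ?thesis
    using A(1) B(1) by (simp add: L2_def set_integrable_def integrable_restrict_space)
qed

lemma L2_subset:
  assumes B: "B \<in> sets lebesgue" "f \<in> L2 B" and A: "A \<in> sets lebesgue" "A \<subseteq> B"
  shows "f \<in> L2 A"
proof -
  have "set_integrable lebesgue B (\<lambda>x. (norm (f x))\<^sup>2)"
    using L2_norm_sq[OF B(2)] B(1) by (simp add: set_integrable_def integrable_restrict_space)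
  then have "set_integrable lebesgue A (\<lambda>x. (norm (f x))\<^sup>2)"
    by (rule set_integrable_subset[OF _ A])
  then show ?thesis
    using measurable_restrict_mono[OF L2_measurable[OF B(2)] A(2)] A(1)
    by (simp add: L2_def set_integrable_def integrable_restrict_space)
qed

lemma L2_Union:
  assumes "finite \<K>" "\<And>K. K \<in> \<K> \<Longrightarrow> K \<in> sets lebesgue \<and> f \<in> L2 K"
  shows "f \<in> L2 (\<Union>\<K>)"
  using assms
proof (induction \<K> rule: finite_induct)
  case empty
  have "f \<in> borel_measurable (lebesgue_on {})" by (rule measurableI) auto
  then show ?case by (simp add: L2_def)
next
  case (insert K \<K>)
  then have "\<Union>\<K> \<in> sets lebesgue" by (intro sets.finite_Union) auto
  with insert show ?case by (auto intro!: L2_Un)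
qed

text \<open>Elements are compact and finite in number, and a polynomial is bounded on each. This
  places the history spaces inside \<open>L2\<close>, as the existence of projections
  requires.\<close>

lemma piecewise_polynomial_L2:
  assumes \<Omega>: "open \<Omega>" and T: "conforming_mesh \<Omega> T" and w: "piecewise_polynomial T w"
  shows "w \<in> L2 \<Omega>"
proof (rule L2_subset)
  have "w \<in> L2 K \<and> K \<in> sets lebesgue" if KT: "K \<in> T" for K
  proof -
    have "compact K"
      using T KT by (auto simp: conforming_mesh_def intro: polytope_imp_compact simplex_imp_polytope)
    then have K: "K \<in> lmeasurable" "K \<in> sets lebesgue"
      by (auto intro: lmeasurable_compact fmeasurableD)
    interpret finite_measure "lebesgue_on K" by (rule finite_measure_lebesgue_on[OF K(1)])
    obtain p where p: "polynomial_function p" "AE x in lebesgue_on K. w x = p x"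
      using w KT unfolding piecewise_polynomial_def by blast
    have cont: "continuous_on K p" by (rule continuous_on_polymonial_function[OF p(1)])
    have pm: "p \<in> borel_measurable (lebesgue_on K)"
      by (rule continuous_imp_measurable_on_sets_lebesgue[OF cont K(2)])
    have wm: "w \<in> borel_measurable (lebesgue_on K)"
      by (rule borel_measurable_lebesgue_on_AE[OF K(2) pm p(2)])
    have "bounded ((\<lambda>x. (norm (p x))\<^sup>2) ` K)"
      by (intro compact_imp_bounded compact_continuous_image continuous_intros cont \<open>compact K\<close>)
    then obtain C where C: "\<And>x. x \<in> K \<Longrightarrow> \<bar>(norm (p x))\<^sup>2\<bar> \<le> C"
      unfolding bounded_iff by auto
    have "integrable (lebesgue_on K) (\<lambda>x. (norm (w x))\<^sup>2)"
    proof (rule integrable_const_bound)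
      show "AE x in lebesgue_on K. norm ((norm (w x))\<^sup>2) \<le> C"
        using p(2) AE_space by eventually_elim (use C in auto)
    qed (use wm in measurable)
    then show ?thesis using wm K by (simp add: L2_def)
  qed
  moreover have "finite T" using T by (simp add: conforming_mesh_def triangulation_def)
  ultimately show "w \<in> L2 (\<Union>T)" "\<Union>T \<in> sets lebesgue"
    by (intro L2_Union sets.finite_Union; auto)+
  show "\<Omega> \<subseteq> \<Union>T" using T closure_subset by (auto simp: conforming_mesh_def)
  show "\<Omega> \<in> sets lebesgue" using \<Omega> by simp
qed

text \<open>The rescaling factor is the quotient of the two norms, so the norm is preserved by
  construction; \<open>nz\<close> keeps the denominator from vanishing. The work lies in
  square-integrability of the projection.\<close>

lemma transfer_remesh:
  assumes \<Omega>: "open (Omega D)" and re: "remesh D n"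
    and T: "conforming_mesh (Omega D) (Th D (n + 1))"
    and H: "fin_dim_space (Omega D) (Hh D (n + 1))" "\<forall>w\<in>Hh D (n + 1). piecewise_polynomial (Th D (n + 1)) w"
    and nz: "L2norm (Omega D) g \<noteq> 0 \<Longrightarrow> L2norm (Omega D) (L2proj (Omega D) (Hh D (n + 1)) g) \<noteq> 0"
    and g: "g \<in> L2 (Omega D)"
  shows "transfer D n g \<in> L2 (Omega D) \<and> L2norm (Omega D) (transfer D n g) = L2norm (Omega D) g"
proof (cases "L2norm (Omega D) g = 0")
  case True
  then show ?thesis using re by (simp add: transfer_def L2_def L2norm_def ip_def)
next
  case False
  let ?p = "L2proj (Omega D) (Hh D (n + 1)) g"
  have HL: "Hh D (n + 1) \<subseteq> L2 (Omega D)"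
    using piecewise_polynomial_L2[OF \<Omega> T] H(2) by auto
  then have "?p \<in> L2 (Omega D)"
    using L2proj_in_space[OF H(1) HL g] by auto
  moreover have "L2norm (Omega D) g \<ge> 0" "L2norm (Omega D) ?p \<ge> 0"
    by (simp_all add: L2norm_def ip_self_nonneg)
  ultimately show ?thesis
    using False nz re by (simp add: transfer_def L2_scaleR L2norm_scaleR)
qed

text \<open>The set on which an admissible map is known to be differentiable with positive Jacobian;
  nothing is assumed about derivatives on faces.\<close>

definition mesh_interior :: "(real ^ 'd) set set \<Rightarrow> (real ^ 'd) set" where
  "mesh_interior T = (\<Union>K\<in>T. interior K)"

lemma open_mesh_interior: "open (mesh_interior T)"
  by (auto simp: mesh_interior_def)

text \<open>The elements only tile \<open>closure \<Omega>\<close>; the regularity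
  \<open>\<Omega> = interior (closure \<Omega>)\<close> brings their interiors back into
  \<open>\<Omega>\<close>.\<close>

lemma mesh_interior_subset:
  assumes "polyhedral_domain \<Omega>" "conforming_mesh \<Omega> T"
  shows "mesh_interior T \<subseteq> \<Omega>"
proof -
  have "interior K \<subseteq> interior (closure \<Omega>)" if "K \<in> T" for K
    using assms that by (intro interior_mono) (auto simp: conforming_mesh_def)
  then show ?thesis
    using assms by (auto simp: mesh_interior_def polyhedral_domain_def)
qed

text \<open>The missing points lie on the frontiers of finitely many convex sets, and such frontiers
  are null.\<close>

lemma negligible_diff_mesh_interior:
  assumes "conforming_mesh \<Omega> T"
  shows "negligible (\<Omega> - mesh_interior T)"
proof (rule negligible_subset)
  have K: "convex K \<and> closed K" if "K \<in> T" for K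
    using assms that
    by (auto simp: conforming_mesh_def dest!: simplex_imp_polytope intro: polytope_imp_convex compact_imp_closed polytope_imp_compact)
  then show "negligible (\<Union>K\<in>T. frontier K)"
    using assms by (auto simp: conforming_mesh_def triangulation_def intro!: negligible_convex_frontier)
  show "\<Omega> - mesh_interior T \<subseteq> (\<Union>K\<in>T. frontier K)"
  proof
    fix x assume x: "x \<in> \<Omega> - mesh_interior T"
    then have "x \<in> \<Union>T"
      using assms closure_subset by (auto simp: conforming_mesh_def)
    then obtain k where "k \<in> T" "x \<in> k" by blast
    then show "x \<in> (\<Union>K\<in>T. frontier K)"
      using x K by (auto simp: mesh_interior_def frontier_def)
  qed
qed

lemma absolutely_integrable_iff_lebesgue_on:
  fixes f :: "'a::euclidean_space \<Rightarrow> 'b::euclidean_space"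
  shows "S \<in> sets lebesgue \<Longrightarrow> f absolutely_integrable_on S \<longleftrightarrow> integrable (lebesgue_on S) f"
  by (simp add: set_integrable_def integrable_restrict_space)

text \<open>On the element interiors this is the differentiable change of variables. The rest of the
  domain is contained in the image of a null set under a Lipschitz map, hence null, so the physical
  side extends to all of \<open>Omega D\<close>. The reference side stays on the interiors, where
  \<open>Jh\<close> is meaningful.\<close>

lemma admissible_map_change_of_variables:
  fixes D :: "'d::finite discretization" and f :: "real ^ 'd \<Rightarrow> real ^ 'n::finite"
  assumes dim: "CARD('d) = 2 \<or> CARD('d) = 3" and X: "admissible_map D L l"
  defines "S \<equiv> mesh_interior (ThHat D l)"
  shows "(\<lambda>y. Jh D l y *\<^sub>R f (Xh D l y)) absolutely_integrable_on S \<and>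
           integral S (\<lambda>y. Jh D l y *\<^sub>R f (Xh D l y)) = b
     \<longleftrightarrow> f absolutely_integrable_on (Omega D) \<and> integral (Omega D) f = b"
proof -
  note X' = X[unfolded admissible_map_def]
  have SO: "S \<subseteq> OmegaHat D l" and neg: "negligible (OmegaHat D l - S)" and op: "open S"
    unfolding S_def using X'
    by (auto intro!: mesh_interior_subset negligible_diff_mesh_interior open_mesh_interior del: subsetI)
  have bij: "bij_betw (Xh D l) (OmegaHat D l) (Omega D)" using X' by blast
  have lip: "L-lipschitz_on (closure (OmegaHat D l)) (Xh D l)" using X' by blast
  have diff: "Xh D l differentiable (at y)" "Jh D l y > 0" if "y \<in> S" for y
    using X' that by (auto simp: S_def mesh_interior_def)
  have "(\<lambda>y. \<bar>det (matrix (frechet_derivative (Xh D l) (at y)))\<bar> *\<^sub>R f (Xh D l y)) absolutely_integrable_on S \<and>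
           integral S (\<lambda>y. \<bar>det (matrix (frechet_derivative (Xh D l) (at y)))\<bar> *\<^sub>R f (Xh D l y)) = b
     \<longleftrightarrow> f absolutely_integrable_on (Xh D l ` S) \<and> integral (Xh D l ` S) f = b"
  proof (rule change_of_variables_2_3[OF dim])
    show "S \<in> sets lebesgue" using op by simp
    show "(Xh D l has_derivative frechet_derivative (Xh D l) (at y)) (at y within S)" if "y \<in> S" for y
      using diff(1)[OF that] by (simp add: frechet_derivative_works has_derivative_at_withinI)
    show "inj_on (Xh D l) S"
      using bij SO by (auto simp: bij_betw_def intro: inj_on_subset)
  qed
  moreover have "\<bar>det (matrix (frechet_derivative (Xh D l) (at y)))\<bar> = Jh D l y" if "y \<in> S" for y
    using diff(2)[OF that] by (simp add: Jh_def Fh_def)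
  ultimately have "(\<lambda>y. Jh D l y *\<^sub>R f (Xh D l y)) absolutely_integrable_on S \<and>
           integral S (\<lambda>y. Jh D l y *\<^sub>R f (Xh D l y)) = b
     \<longleftrightarrow> f absolutely_integrable_on (Xh D l ` S) \<and> integral (Xh D l ` S) f = b"
    by (simp cong: set_integrable_cong Henstock_Kurzweil_Integration.integral_cong)
  moreover have sub: "Xh D l ` S \<subseteq> Omega D" using bij SO by (auto simp: bij_betw_def)
  moreover have negO: "negligible (Omega D - Xh D l ` S)"
  proof (rule negligible_subset)
    show "Omega D - Xh D l ` S \<subseteq> Xh D l ` (OmegaHat D l - S)"
      using bij unfolding bij_betw_def by blast
    show "negligible (Xh D l ` (OmegaHat D l - S))"
    proof (rule negligible_locally_Lipschitz_image[OF _ neg])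
      fix x assume "x \<in> OmegaHat D l - S"
      then have "\<forall>y \<in> (OmegaHat D l - S) \<inter> UNIV. norm (Xh D l y - Xh D l x) \<le> L * norm (y - x)"
        using lipschitz_onD[OF lip] closure_subset[of "OmegaHat D l"] by (auto simp: dist_norm subset_iff)
      then show "\<exists>T B. open T \<and> x \<in> T \<and> (\<forall>y \<in> (OmegaHat D l - S) \<inter> T. norm (Xh D l y - Xh D l x) \<le> B * norm (y - x))"
        by (intro exI[of _ UNIV] exI[of _ L]) auto
    qed simp
  qed
  moreover have "f absolutely_integrable_on (Xh D l ` S) \<longleftrightarrow> f absolutely_integrable_on (Omega D)"
  proof (rule absolutely_integrable_spike_set_eq)
    show "negligible {x \<in> Xh D l ` S - Omega D. f x \<noteq> 0}" using sub by (auto intro: negligible_subset[OF negligible_empty])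
    show "negligible {x \<in> Omega D - Xh D l ` S. f x \<noteq> 0}" by (rule negligible_subset[OF negO]) auto
  qed
  moreover have "integral (Xh D l ` S) f = integral (Omega D) f"
  proof (rule integral_spike_set)
    show "negligible {x \<in> Xh D l ` S - Omega D. f x \<noteq> 0}" using sub by (auto intro: negligible_subset[OF negligible_empty])
    show "negligible {x \<in> Omega D - Xh D l ` S. f x \<noteq> 0}" by (rule negligible_subset[OF negO]) auto
  qed
  ultimately show ?thesis by simp
qed

text \<open>Scalar integrands are carried along a fixed axis vector, because the change of variables
  above is for values in \<open>real ^ 'n\<close>.\<close>

lemma absolutely_integrable_scaleR_axis:
  fixes h :: "real ^ 'd::finite \<Rightarrow> real"
  shows "(\<lambda>x. h x *\<^sub>R (axis i 1 :: real ^ 'd)) absolutely_integrable_on S \<and>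
           integral S (\<lambda>x. h x *\<^sub>R (axis i 1 :: real ^ 'd)) = b *\<^sub>R axis i 1
     \<longleftrightarrow> h absolutely_integrable_on S \<and> integral S h = b"
proof -
  let ?a = "axis i 1 :: real ^ 'd"
  have "((\<lambda>v. v \<bullet> ?a) \<circ> (\<lambda>x. h x *\<^sub>R ?a)) = h" "((\<lambda>c. c *\<^sub>R ?a) \<circ> h) = (\<lambda>x. h x *\<^sub>R ?a)"
    by (auto simp: o_def inner_axis)
  then have iff: "(\<lambda>x. h x *\<^sub>R ?a) absolutely_integrable_on S \<longleftrightarrow> h absolutely_integrable_on S"
    using absolutely_integrable_linear[where f = "\<lambda>x. h x *\<^sub>R ?a" and s = S, OF _ bounded_linear_inner_left[of ?a]]
      absolutely_integrable_linear[where f = h and s = S, OF _ bounded_linear_scaleR_left[of ?a]] by auto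
  have "integral S (\<lambda>x. h x *\<^sub>R ?a) = integral S h *\<^sub>R ?a" if "h absolutely_integrable_on S"
    using integral_linear[where f = h and S = S, OF _ bounded_linear_scaleR_left[of ?a]] that
    by (simp add: o_def set_lebesgue_integral_eq_integral(1))
  then show ?thesis
    using iff by (auto simp: axis_eq_0_iff)
qed

lemma admissible_map_change_of_variables_real:
  fixes D :: "'d::finite discretization" and f :: "real ^ 'd \<Rightarrow> real"
  assumes dim: "CARD('d) = 2 \<or> CARD('d) = 3" and X: "admissible_map D L l"
  defines "S \<equiv> mesh_interior (ThHat D l)"
  shows "(\<lambda>y. Jh D l y * f (Xh D l y)) absolutely_integrable_on S \<and>
           integral S (\<lambda>y. Jh D l y * f (Xh D l y)) = b
     \<longleftrightarrow> f absolutely_integrable_on (Omega D) \<and> integral (Omega D) f = b"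
proof -
  fix i :: 'd
  show ?thesis
    using admissible_map_change_of_variables[OF dim X, where f = "\<lambda>x. f x *\<^sub>R (axis i 1 :: real ^ 'd)" and b = "b *\<^sub>R axis i 1"]
      absolutely_integrable_scaleR_axis[where h = "\<lambda>y. Jh D l y * f (Xh D l y)" and i = i and S = S and b = b]
      absolutely_integrable_scaleR_axis[where h = f and i = i and S = "Omega D" and b = b]
    by (simp add: S_def)
qed

text \<open>The weight \<open>sqrt (J / J')\<close> is chosen so that \<open>J' |w|\<^sup>2\<close>
  on the reference domain equals \<open>J |g|\<^sup>2\<close>: both squared norms are the same
  reference integral. Measurability of the transferred field has to be proved separately.\<close>

lemma transfer_fixed_topology:
  fixes D :: "'d::finite discretization"
  assumes dim: "CARD('d) = 2 \<or> CARD('d) = 3" and \<Omega>: "polyhedral_domain (Omega D)"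
    and fixed: "\<not> remesh D n"
    and X: "admissible_map D L n" "admissible_map D L (n + 1)"
    and eq: "OmegaHat D n = OmegaHat D (n + 1)" "ThHat D n = ThHat D (n + 1)"
    and g: "g \<in> L2 (Omega D)"
  shows "transfer D n g \<in> L2 (Omega D) \<and> L2norm (Omega D) (transfer D n g) = L2norm (Omega D) g"
proof -
  define S where "S = mesh_interior (ThHat D (n + 1))"
  define J where "J = Jh D n"
  define J' where "J' = Jh D (n + 1)"
  define gX where "gX = (\<lambda>y. g (Xh D n y))"
  define w where "w = transfer D n g"
  have \<Omega>': "open (Omega D)" "bounded (Omega D)" "Omega D \<in> lmeasurable" "Omega D \<in> sets lebesgue"
    using \<Omega> by (auto simp: polyhedral_domain_def intro: lmeasurable_open)
  have S: "open S" "S \<in> sets lebesgue" by (simp_all add: S_def open_mesh_interior)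
  have SO: "S \<subseteq> OmegaHat D (n + 1)"
    unfolding S_def using X(2) by (intro mesh_interior_subset) (simp_all add: admissible_map_def)
  have pos: "J y > 0" "J' y > 0" if "y \<in> S" for y
    using X that eq(2) unfolding admissible_map_def S_def mesh_interior_def J_def J'_def by auto
  have cont: "continuous_on S (Fh D n)" "continuous_on S (Fh D (n + 1))"
    using X eq(2) unfolding admissible_map_def S_def mesh_interior_def
    by (auto intro!: continuous_on_open_UN)
  have Jm: "J \<in> borel_measurable (lebesgue_on S)" "J' \<in> borel_measurable (lebesgue_on S)"
    unfolding J_def J'_def Jh_def[abs_def] det_def
    using cont by (auto intro!: continuous_imp_measurable_on_sets_lebesgue[OF _ S(2)] continuous_intros)
  have inj: "inj_on (Xh D (n + 1)) (OmegaHat D (n + 1))"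
    using X(2) by (auto simp: admissible_map_def bij_betw_def)
  have wX: "w (Xh D (n + 1) y) = (1 / sqrt (J' y) * sqrt (J y)) *\<^sub>R gX y" if "y \<in> S" for y
    using fixed that SO inv_into_f_f[OF inj, of y]
    by (auto simp: w_def transfer_def Xinv_def J_def J'_def gX_def Let_def)
  note cov = admissible_map_change_of_variables[OF dim X(1), unfolded eq(2), folded S_def J_def]
    admissible_map_change_of_variables[OF dim X(2), folded S_def J'_def]
  note covr = admissible_map_change_of_variables_real[OF dim X(1), unfolded eq(2), folded S_def J_def]
    admissible_map_change_of_variables_real[OF dim X(2), folded S_def J'_def]
  note AI = absolutely_integrable_iff_lebesgue_on[OF S(2)] absolutely_integrable_iff_lebesgue_on[OF \<Omega>'(4)]
  \<comment> \<open>The change of variables makes \<open>J\<close> times \<open>gX\<close>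
    integrable, hence measurable, and division by the positive \<open>J\<close> leaves
    \<open>gX\<close>.\<close>
  have "g absolutely_integrable_on Omega D"
    using L2_integrable[OF \<Omega>'(3) g] by (simp add: AI)
  then have "(\<lambda>y. J y *\<^sub>R gX y) absolutely_integrable_on S"
    using cov(1)[of g "integral (Omega D) g"] by (simp add: gX_def)
  then have "(\<lambda>y. J y *\<^sub>R gX y) \<in> borel_measurable (lebesgue_on S)"
    by (simp add: AI)
  then have "(\<lambda>y. (1 / J y) *\<^sub>R (J y *\<^sub>R gX y)) \<in> borel_measurable (lebesgue_on S)"
    using Jm by measurable
  then have gXm: "gX \<in> borel_measurable (lebesgue_on S)"
    by (rule measurable_cong[THEN iffD1, rotated]) (use pos in \<open>auto simp: less_imp_neq[THEN not_sym]\<close>)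
  let ?N = "integral (Omega D) (\<lambda>x. (norm (g x))\<^sup>2)"
  have gsq: "(\<lambda>y. J y * (norm (gX y))\<^sup>2) absolutely_integrable_on S"
      "integral S (\<lambda>y. J y * (norm (gX y))\<^sup>2) = ?N"
    using covr(1)[of "\<lambda>x. (norm (g x))\<^sup>2" ?N] L2_norm_sq[OF g] by (simp_all add: gX_def AI)
  interpret finite_measure "lebesgue_on (Omega D)" by (rule finite_measure_lebesgue_on[OF \<Omega>'(3)])
  \<comment> \<open>Constant integrand 1 on a domain of finite measure.\<close>
  have J'i: "integrable (lebesgue_on S) J'"
    using covr(2)[of "\<lambda>_. 1" "integral (Omega D) (\<lambda>_. 1)"] by (simp add: AI)
  \<comment> \<open>The same detour in the other direction: integrability on the reference side
    gives that of \<open>w\<close>, and with it measurability. The weighted integrand is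
    \<open>sqrt (J' J) gX\<close>, bounded through \<open>a b \<le> a\<^sup>2 + b\<^sup>2\<close> by
    the integrable \<open>J' + J |gX|\<^sup>2\<close>.\<close>
  have "(\<lambda>y. J' y *\<^sub>R w (Xh D (n + 1) y)) absolutely_integrable_on S"
  proof -
    have int: "integrable (lebesgue_on S) (\<lambda>y. (sqrt (J' y) * sqrt (J y)) *\<^sub>R gX y)"
    proof (rule Bochner_Integration.integrable_bound)
      show "integrable (lebesgue_on S) (\<lambda>y. J' y + J y * (norm (gX y))\<^sup>2)"
        using J'i gsq(1) by (simp add: AI)
      show "(\<lambda>y. (sqrt (J' y) * sqrt (J y)) *\<^sub>R gX y) \<in> borel_measurable (lebesgue_on S)"
        using Jm gXm by measurable
      show "AE y in lebesgue_on S. norm ((sqrt (J' y) * sqrt (J y)) *\<^sub>R gX y) \<le> norm (J' y + J y * (norm (gX y))\<^sup>2)"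
      proof (rule AE_I2)
        fix y assume "y \<in> space (lebesgue_on S)"
        then have p: "J y > 0" "J' y > 0" using pos by auto
        have "2 * sqrt (J' y) * (sqrt (J y) * norm (gX y)) \<le> (sqrt (J' y))\<^sup>2 + (sqrt (J y) * norm (gX y))\<^sup>2"
          by (rule sum_squares_bound)
        moreover have "0 \<le> sqrt (J' y) * (sqrt (J y) * norm (gX y))"
          using p by simp
        ultimately have "sqrt (J' y) * (sqrt (J y) * norm (gX y)) \<le> (sqrt (J' y))\<^sup>2 + (sqrt (J y) * norm (gX y))\<^sup>2"
          unfolding mult.assoc by linarith
        then show "norm ((sqrt (J' y) * sqrt (J y)) *\<^sub>R gX y) \<le> norm (J' y + J y * (norm (gX y))\<^sup>2)"
          using p by (simp add: power_mult_distrib abs_mult mult.assoc)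
      qed
    qed
    have eq: "J' y *\<^sub>R w (Xh D (n + 1) y) = (sqrt (J' y) * sqrt (J y)) *\<^sub>R gX y" if "y \<in> S" for y
    proof -
      have "J' y * (1 / sqrt (J' y) * sqrt (J y)) = J' y / sqrt (J' y) * sqrt (J y)" by simp
      also have "J' y / sqrt (J' y) = sqrt (J' y)"
        using pos[OF that] by (simp add: real_div_sqrt)
      finally show ?thesis unfolding wX[OF that] scaleR_scaleR by simp
    qed
    show ?thesis
      unfolding AI by (rule Bochner_Integration.integrable_cong[THEN iffD1, OF refl _ int]) (simp add: eq[simplified])
  qed
  then have "w absolutely_integrable_on Omega D"
    using cov(2)[of w "integral S (\<lambda>y. J' y *\<^sub>R w (Xh D (n + 1) y))"] by simp
  then have wm: "w \<in> borel_measurable (lebesgue_on (Omega D))"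
    by (simp add: AI)
  have "J' y * (norm (w (Xh D (n + 1) y)))\<^sup>2 = J y * (norm (gX y))\<^sup>2" if "y \<in> S" for y
    using wX[OF that] pos[OF that] by (simp add: power_mult_distrib power_divide)
  then have "(\<lambda>y. J' y * (norm (w (Xh D (n + 1) y)))\<^sup>2) absolutely_integrable_on S \<and>
      integral S (\<lambda>y. J' y * (norm (w (Xh D (n + 1) y)))\<^sup>2) = ?N"
    using gsq by (simp cong: set_integrable_cong Henstock_Kurzweil_Integration.integral_cong)
  then have wsq: "(\<lambda>x. (norm (w x))\<^sup>2) absolutely_integrable_on Omega D"
      "integral (Omega D) (\<lambda>x. (norm (w x))\<^sup>2) = ?N"
    using covr(2)[of "\<lambda>x. (norm (w x))\<^sup>2" ?N] by simp_all
  have wL: "w \<in> L2 (Omega D)" using wm wsq(1) by (simp add: L2_def AI)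
  have "ip (Omega D) v v = integral (Omega D) (\<lambda>x. (norm (v x))\<^sup>2)" if "v \<in> L2 (Omega D)" for v :: "real ^ 'd \<Rightarrow> real ^ 'd"
    using lebesgue_integral_eq_integral[OF L2_norm_sq[OF that] \<Omega>'(4)]
    by (simp add: ip_def power2_norm_eq_inner)
  then have "L2norm (Omega D) w = L2norm (Omega D) g"
    using wL g wsq(2) by (simp add: L2norm_def)
  then show ?thesis using wL by (simp add: w_def)
qed

lemma transfer_isometry:
  fixes D :: "'d::finite discretization"
  assumes dim: "CARD('d) = 2 \<or> CARD('d) = 3" and \<Omega>: "polyhedral_domain (Omega D)"
    and mesh: "admissible_mesh D \<kappa> (n + 1)"
    and fixed: "\<not> remesh D n \<Longrightarrow> fixed_topology_update D L k n"
    and remesh: "remesh D n \<Longrightarrow> remeshing_update P D Y k n"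
    and nz: "remesh D n \<Longrightarrow> L2norm (Omega D) g \<noteq> 0 \<Longrightarrow>
               L2norm (Omega D) (L2proj (Omega D) (Hh D (n + 1)) g) \<noteq> 0"
    and g: "g \<in> L2 (Omega D)"
  shows "transfer D n g \<in> L2 (Omega D)" "L2norm (Omega D) (transfer D n g) = L2norm (Omega D) g"
proof -
  have "transfer D n g \<in> L2 (Omega D) \<and> L2norm (Omega D) (transfer D n g) = L2norm (Omega D) g"
  proof (cases "remesh D n")
    case True
    show ?thesis
      using \<Omega> mesh remesh[OF True] nz[OF True]
      by (intro transfer_remesh[OF _ True _ _ _ _ g])
         (simp_all add: polyhedral_domain_def admissible_mesh_def remeshing_update_def)
  next
    case False
    have "n \<in> update_levels k n" "n + 1 \<in> update_levels k n"
      by (auto simp: update_levels_def)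
    then have "admissible_map D L n" "admissible_map D L (n + 1)"
      "OmegaHat D n = OmegaHat D (n + 1)" "ThHat D n = ThHat D (n + 1)"
      using fixed[OF False] unfolding fixed_topology_update_def by blast+
    then show ?thesis
      by (rule transfer_fixed_topology[OF dim \<Omega> False _ _ _ _ g])
  qed
  then show "transfer D n g \<in> L2 (Omega D)" "L2norm (Omega D) (transfer D n g) = L2norm (Omega D) g"
    by auto
qed

section \<open>Energy balance\<close>

lemma L2_vecI:
  fixes v :: "real ^ 'd::finite \<Rightarrow> 'b::euclidean_space ^ 'n::finite"
  assumes v: "\<And>i. (\<lambda>x. v x $ i) \<in> L2 \<Omega>"
  shows "v \<in> L2 \<Omega>"
proof -
  have "v \<in> borel_measurable (lebesgue_on \<Omega>)"
  proof (subst borel_measurable_euclidean_space, rule ballI)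
    fix b :: "'b ^ 'n" assume "b \<in> Basis"
    then obtain i u where "b = axis i u" by (auto simp: Basis_vec_def)
    then show "(\<lambda>x. v x \<bullet> b) \<in> borel_measurable (lebesgue_on \<Omega>)"
      using L2_measurable[OF v[of i]] by (simp add: inner_axis)
  qed
  then show ?thesis
    using L2_inner_integrable[OF v v]
    by (simp add: L2_def power2_norm_eq_inner inner_vec_def)
qed

lemma H1vec_L2: "v \<in> H1vec \<Omega> \<Longrightarrow> v \<in> L2 \<Omega>"
  by (rule L2_vecI) (simp add: H1vec_def H1_L2)

lemma jac_L2: "v \<in> H1vec \<Omega> \<Longrightarrow> jac \<Omega> v \<in> L2 \<Omega>"
  by (rule L2_vecI) (simp add: H1vec_def jac_def H1_grad)

lemma symgrad_measurable:
  assumes "v \<in> H1vec \<Omega>"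
  shows "symgrad \<Omega> v \<in> borel_measurable (lebesgue_on \<Omega>)"
proof -
  have "linear (transpose :: real ^ 'd ^ 'd \<Rightarrow> _)"
    by (rule linearI) (simp_all add: transpose_def vec_eq_iff)
  then have "(transpose :: real ^ 'd ^ 'd \<Rightarrow> _) \<in> borel_measurable borel"
    by (intro borel_measurable_continuous_onI linear_continuous_on) (simp add: linear_conv_bounded_linear)
  from measurable_compose[OF L2_measurable[OF jac_L2[OF assms]] this]
  have "(\<lambda>x. transpose (jac \<Omega> v x)) \<in> borel_measurable (lebesgue_on \<Omega>)" .
  then show ?thesis
    unfolding symgrad_def[abs_def] using L2_measurable[OF jac_L2[OF assms]]
    by (intro borel_measurable_scaleR borel_measurable_add measurable_const) auto
qed

text \<open>Nonnegativity matters: \<open>sqrt\<close> is odd, so for negative \<open>c\<close> the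
  product of the two roots would be \<open>-c\<close>.\<close>

lemma ip_sqrt_weight:
  assumes c: "c \<in> borel_measurable (lebesgue_on \<Omega>)" "AE x in lebesgue_on \<Omega>. 0 \<le> c x"
    and A: "A \<in> borel_measurable (lebesgue_on \<Omega>)"
  shows "(L2norm \<Omega> (\<lambda>x. sqrt (c x) *\<^sub>R A x))\<^sup>2 = ip \<Omega> (\<lambda>x. c x *\<^sub>R A x) A"
  unfolding L2norm_sq ip_def
proof (rule integral_cong_AE)
  show "AE x in lebesgue_on \<Omega>. (sqrt (c x) *\<^sub>R A x) \<bullet> (sqrt (c x) *\<^sub>R A x) = (c x *\<^sub>R A x) \<bullet> A x"
    using c(2) by eventually_elim (simp flip: mult.assoc)
qed (use c A in measurable)

lemma zeta_L2:
  assumes \<phi>: "phi Y l \<in> borel_measurable (lebesgue_on \<Omega>)" and u: "vel Y l \<in> L2 \<Omega>"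
    and \<rho>: "AE x in lebesgue_on \<Omega>. rho P (phi Y l x) \<le> R" "AE x in lebesgue_on \<Omega>. 0 \<le> rho P (phi Y l x)"
  shows "zeta P Y l \<in> L2 \<Omega>"
  unfolding zeta_def[abs_def]
proof (rule L2_bounded_scaleR[OF _ _ u])
  show "(\<lambda>x. sqrt (rho P (phi Y l x))) \<in> borel_measurable (lebesgue_on \<Omega>)"
    unfolding rho_def using \<phi> by measurable
  show "AE x in lebesgue_on \<Omega>. \<bar>sqrt (rho P (phi Y l x))\<bar> \<le> sqrt R"
    using \<rho> by eventually_elim simp
qed

text \<open>The symmetric bilinear form behind \<open>cns_norm2\<close>. It is also the form in
  which the phase history is projected and the linear part of the chemical potential.\<close>

definition energy_form :: "params \<Rightarrow> (real ^ 'd) set \<Rightarrow> (real ^ 'd \<Rightarrow> real) \<Rightarrow> (real ^ 'd \<Rightarrow> real) \<Rightarrow> real" where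
  "energy_form P \<Omega> v w = (Cn P)\<^sup>2 * ip \<Omega> (grad \<Omega> v) (grad \<Omega> w) + stab P * ip \<Omega> v w"

lemma energy_form_commute: "energy_form P \<Omega> v w = energy_form P \<Omega> w v"
  by (simp add: energy_form_def ip_commute)

lemma cns_norm2_eq_energy_form: "cns_norm2 P \<Omega> v = energy_form P \<Omega> v v"
  by (simp add: energy_form_def cns_norm2_def L2norm_sq)

lemma energy_form_lincomb:
  assumes \<Omega>: "open \<Omega>" "bounded \<Omega>" and uvw: "u \<in> H1 \<Omega>" "v \<in> H1 \<Omega>" "w \<in> H1 \<Omega>"
  shows "energy_form P \<Omega> (\<lambda>x. a * u x + b * v x) w = a * energy_form P \<Omega> u w + b * energy_form P \<Omega> v w"
proof -
  note L2 = H1_grad(1)[OF uvw(1)] H1_grad(1)[OF uvw(2)] H1_grad(1)[OF uvw(3)]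
  have "ip \<Omega> (grad \<Omega> (\<lambda>x. a * u x + b * v x)) (grad \<Omega> w)
      = ip \<Omega> (\<lambda>x. a *\<^sub>R grad \<Omega> u x + b *\<^sub>R grad \<Omega> v x) (grad \<Omega> w)"
  proof (rule ip_cong_AE)
    show "AE x in lebesgue_on \<Omega>. grad \<Omega> (\<lambda>x. a * u x + b * v x) x = a *\<^sub>R grad \<Omega> u x + b *\<^sub>R grad \<Omega> v x"
      by (rule grad_lincomb(2)[OF \<Omega> uvw(1,2)])
    show "grad \<Omega> (\<lambda>x. a * u x + b * v x) \<in> borel_measurable (lebesgue_on \<Omega>)"
      by (intro L2_measurable H1_grad grad_lincomb \<Omega> uvw)
    show "(\<lambda>x. a *\<^sub>R grad \<Omega> u x + b *\<^sub>R grad \<Omega> v x) \<in> borel_measurable (lebesgue_on \<Omega>)"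
      by (intro L2_measurable L2_lincomb L2)
  qed (use L2_measurable[OF L2(3)] in auto)
  also have "\<dots> = a * ip \<Omega> (grad \<Omega> u) (grad \<Omega> w) + b * ip \<Omega> (grad \<Omega> v) (grad \<Omega> w)"
    by (rule ip_lincomb_left[OF L2])
  finally show ?thesis
    using ip_lincomb_left[OF H1_L2[OF uvw(1)] H1_L2[OF uvw(2)] H1_L2[OF uvw(3)], of a b]
    by (simp add: energy_form_def algebra_simps)
qed

lemma cns_norm2_lincomb:
  assumes \<Omega>: "open \<Omega>" "bounded \<Omega>" and uv: "u \<in> H1 \<Omega>" "v \<in> H1 \<Omega>"
  shows "cns_norm2 P \<Omega> (\<lambda>x. a * u x + b * v x)
       = a\<^sup>2 * cns_norm2 P \<Omega> u + 2 * a * b * energy_form P \<Omega> u v + b\<^sup>2 * cns_norm2 P \<Omega> v"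
proof -
  have "energy_form P \<Omega> (\<lambda>x. a * u x + b * v x) (\<lambda>x. a * u x + b * v x)
      = a * energy_form P \<Omega> (\<lambda>x. a * u x + b * v x) u + b * energy_form P \<Omega> (\<lambda>x. a * u x + b * v x) v"
    using energy_form_lincomb[OF \<Omega> uv grad_lincomb(1)[OF \<Omega> uv]] by (simp add: energy_form_commute)
  then show ?thesis
    using energy_form_commute[of P \<Omega> v u]
    by (simp add: cns_norm2_eq_energy_form energy_form_lincomb[OF \<Omega> uv uv(1)] energy_form_lincomb[OF \<Omega> uv uv(2)]
        power2_eq_square algebra_simps)
qed

text \<open>The scalar identity \<open>2 (a - b) a = a\<^sup>2 - b\<^sup>2 + (a - b)\<^sup>2\<close>
  in the energy form.\<close>

lemma cns_norm2_polarization_BE: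
  assumes \<Omega>: "open \<Omega>" "bounded \<Omega>" and uv: "u \<in> H1 \<Omega>" "v \<in> H1 \<Omega>"
  shows "cns_norm2 P \<Omega> u - cns_norm2 P \<Omega> v + cns_norm2 P \<Omega> (\<lambda>x. u x - v x)
       = 2 * (energy_form P \<Omega> u u - energy_form P \<Omega> v u)"
  using cns_norm2_lincomb[OF \<Omega> uv, of P 1 "-1"] energy_form_commute[of P \<Omega> u v]
  by (simp add: cns_norm2_eq_energy_form)

text \<open>The G-stability identity of BDF2, \<open>2 (3a - 4b + c) a = a\<^sup>2 + (2a -
  b)\<^sup>2 - b\<^sup>2 - (2b - c)\<^sup>2 + (a - 2b + c)\<^sup>2\<close>, in the energy
  form.\<close>

lemma cns_norm2_polarization_BDF2:
  assumes \<Omega>: "open \<Omega>" "bounded \<Omega>" and uvw: "u \<in> H1 \<Omega>" "v \<in> H1 \<Omega>" "w \<in> H1 \<Omega>"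
  shows "cns_norm2 P \<Omega> u + cns_norm2 P \<Omega> (\<lambda>x. 2 * u x - v x)
         - cns_norm2 P \<Omega> v - cns_norm2 P \<Omega> (\<lambda>x. 2 * v x - w x)
         + cns_norm2 P \<Omega> (\<lambda>x. u x - 2 * v x + w x)
       = 2 * (3 * energy_form P \<Omega> u u - 4 * energy_form P \<Omega> v u + energy_form P \<Omega> w u)"
proof -
  \<comment> \<open>The second difference is nested into two-term combinations, with explicit unit
    coefficients, to fit the lemmas above.\<close>
  have "(\<lambda>x. u x - 2 * v x + w x) = (\<lambda>x. 1 * (1 * u x + (- 2) * v x) + 1 * w x)" by auto
  then have "cns_norm2 P \<Omega> (\<lambda>x. u x - 2 * v x + w x)
      = cns_norm2 P \<Omega> (\<lambda>x. 1 * u x + (- 2) * v x)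
        + 2 * energy_form P \<Omega> (\<lambda>x. 1 * u x + (- 2) * v x) w + cns_norm2 P \<Omega> w"
    using cns_norm2_lincomb[OF \<Omega> grad_lincomb(1)[OF \<Omega> uvw(1,2), of 1 "-2"] uvw(3), of P 1 1] by simp
  then show ?thesis
    using cns_norm2_lincomb[OF \<Omega> uvw(1,2), of P 1 "-2"] energy_form_lincomb[OF \<Omega> uvw, of P 1 "-2"]
      cns_norm2_lincomb[OF \<Omega> uvw(1,2), of P 2 "-1"] cns_norm2_lincomb[OF \<Omega> uvw(2,3), of P 2 "-1"]
      energy_form_commute[of P \<Omega> u v] energy_form_commute[of P \<Omega> u w]
    by (simp add: cns_norm2_eq_energy_form)
qed

section \<open>Discrete polarization of the kinetic energy\<close>

lemma L2norm_sq_lincomb: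
  assumes "f \<in> L2 \<Omega>" "g \<in> L2 \<Omega>"
  shows "(L2norm \<Omega> (\<lambda>x. a *\<^sub>R f x + b *\<^sub>R g x))\<^sup>2
       = a\<^sup>2 * (L2norm \<Omega> f)\<^sup>2 + 2 * a * b * ip \<Omega> f g + b\<^sup>2 * (L2norm \<Omega> g)\<^sup>2"
  using assms ip_commute[of \<Omega> g f] unfolding L2norm_sq
  by (simp add: ip_lincomb_left ip_lincomb_right L2_lincomb power2_eq_square algebra_simps)

lemma L2norm_polarization_BE:
  assumes "z \<in> L2 \<Omega>" "a \<in> L2 \<Omega>"
  shows "(L2norm \<Omega> z)\<^sup>2 - (L2norm \<Omega> a)\<^sup>2 + (L2norm \<Omega> (\<lambda>x. z x - a x))\<^sup>2 = 2 * ip \<Omega> (\<lambda>x. z x - a x) z"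
  using L2norm_sq_lincomb[OF assms, of 1 "-1"] ip_lincomb_left[OF assms assms(1), of 1 "-1"] ip_commute[of \<Omega> z a]
  by (simp add: L2norm_sq)

text \<open>With \<open>a = z\<^sup>n\<close> and
  \<open>b = 2 z\<^sup>n - z\<^sup>n\<^sup>-\<^sup>1\<close> this is the BDF2 identity, but it holds
  for arbitrary \<open>a\<close> and \<open>b\<close>: products of \<open>a\<close> with
  \<open>b\<close> cancel out of it. Transferring the two histories separately, each with its norm
  preserved, is therefore enough.\<close>

lemma L2norm_polarization_BDF2:
  assumes z: "z \<in> L2 \<Omega>" and a: "a \<in> L2 \<Omega>" and b: "b \<in> L2 \<Omega>"
  shows "(L2norm \<Omega> z)\<^sup>2 + (L2norm \<Omega> (\<lambda>x. 2 *\<^sub>R z x - a x))\<^sup>2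
         - (L2norm \<Omega> a)\<^sup>2 - (L2norm \<Omega> b)\<^sup>2 + (L2norm \<Omega> (\<lambda>x. z x - b x))\<^sup>2
       = 6 * ip \<Omega> (\<lambda>x. z x - (1/3) *\<^sub>R (2 *\<^sub>R a x + b x)) z"
proof -
  have "(\<lambda>x. z x - (1/3) *\<^sub>R (2 *\<^sub>R a x + b x)) = (\<lambda>x. 1 *\<^sub>R (1 *\<^sub>R z x + (-2/3) *\<^sub>R a x) + (-1/3) *\<^sub>R b x)"
    by (auto simp: scaleR_add_right)
  then have "ip \<Omega> (\<lambda>x. z x - (1/3) *\<^sub>R (2 *\<^sub>R a x + b x)) z = ip \<Omega> z z - 2/3 * ip \<Omega> a z - 1/3 * ip \<Omega> b z"
    using ip_lincomb_left[OF L2_lincomb[OF z a] b z, of 1 1 "-2/3" "-1/3"] ip_lincomb_left[OF z a z, of 1 "-2/3"]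
    by simp
  then show ?thesis
    using L2norm_sq_lincomb[OF z a, of 2 "-1"] L2norm_sq_lincomb[OF z b, of 1 "-1"]
      ip_commute[of \<Omega> z a] ip_commute[of \<Omega> z b]
    by (simp add: L2norm_sq)
qed

text \<open>Polarization of each quadratic part plus the product rule for \<open>q\<close> times the
  phase energy. The constant \<open>C_A\<close> drops out of the increment of \<open>Ephi1\<close>
  and survives only in the last factor \<open>Ephi1 P D Y n\<close>.\<close>

lemma energy_increment_BE:
  assumes \<Omega>: "open (Omega D)" "bounded (Omega D)"
    and H1: "phi Y (n + 1) \<in> H1 (Omega D)" "phi Y n \<in> H1 (Omega D)"
    and L2: "zeta P Y (n + 1) \<in> L2 (Omega D)" "g0H P D Y (n + 1) \<in> L2 (Omega D)"
    and iso: "L2norm (Omega D) (g0H P D Y (n + 1)) = L2norm (Omega D) (g0 P Y n)"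
  shows "Eh1 P D Y (n + 1) - Eh1 P D Y n + Nh1 P D Y (n + 1)
       = ip (Omega D) (\<lambda>x. zeta P Y (n + 1) x - zetaH P D Y 1 (n + 1) x) (zeta P Y (n + 1))
         + qs Y (n + 1) * (1 / (We P * Cn P) *
             (energy_form P (Omega D) (phi Y (n + 1)) (phi Y (n + 1))
              - energy_form P (Omega D) (phiH Y 1 n) (phi Y (n + 1))
              + 2 * sav Y (n + 1) * (sav Y (n + 1) - hist 1 (sav Y) n)))
         + (qs Y (n + 1) - qs Y n) * Ephi1 P D Y n
         + 1 / alpha_q P * qs Y (n + 1) * (qs Y (n + 1) - hist 1 (qs Y) n)"
proof -
  \<comment> \<open>Opaque names for the two reciprocals make the final identity polynomial for the
    simplifier.\<close>
  define K where "K = 1 / (We P * Cn P)"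
  define A where "A = 1 / alpha_q P"
  have KA: "1 / (2 * We P * Cn P) = K / 2" "1 / (2 * alpha_q P) = A / 2"
    by (simp_all add: K_def A_def)
  have \<phi>H: "phiH Y 1 n = phi Y n" by (auto simp: phiH_def hist_def)
  have \<phi>: "energy_form P (Omega D) (phi Y (n + 1)) (phi Y (n + 1)) - energy_form P (Omega D) (phi Y n) (phi Y (n + 1))
      = (cns_norm2 P (Omega D) (phi Y (n + 1)) - cns_norm2 P (Omega D) (phi Y n)
         + cns_norm2 P (Omega D) (\<lambda>x. phi Y (n + 1) x - phi Y n x)) / 2"
    using cns_norm2_polarization_BE[OF \<Omega> H1, of P] by simp
  have \<zeta>: "ip (Omega D) (\<lambda>x. zeta P Y (n + 1) x - zetaH P D Y 1 (n + 1) x) (zeta P Y (n + 1))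
      = ((L2norm (Omega D) (g0 P Y (n + 1)))\<^sup>2 - (L2norm (Omega D) (g0 P Y n))\<^sup>2
         + (L2norm (Omega D) (\<lambda>x. zeta P Y (n + 1) x - g0H P D Y (n + 1) x))\<^sup>2) / 2"
    using L2norm_polarization_BE[OF L2] iso by (simp add: zetaH_def g0_def)
  show ?thesis
    unfolding \<phi>H \<phi> \<zeta> Eh1_def Nh1_def Ephi1_def KA K_def[symmetric] A_def[symmetric]
    by (simp add: hist_def power2_diff algebra_simps add_divide_distrib diff_divide_distrib) (simp add: power2_eq_square algebra_simps add_divide_distrib)
qed

text \<open>As for backward Euler. The factor 3/2 arises each time as the weight of the energy times
  the 6 of the polarization identity: 1/4 times 6 for the kinetic, phase and \<open>q\<close> parts,
  and 1/2 times 6 for the SAV part, which is listed with a factor 2.\<close>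

lemma energy_increment_BDF2:
  assumes \<Omega>: "open (Omega D)" "bounded (Omega D)"
    and H1: "phi Y (n + 1) \<in> H1 (Omega D)" "phi Y n \<in> H1 (Omega D)" "phi Y (n - 1) \<in> H1 (Omega D)"
    and L2: "zeta P Y (n + 1) \<in> L2 (Omega D)" "g0H P D Y (n + 1) \<in> L2 (Omega D)" "g1H P D Y (n + 1) \<in> L2 (Omega D)"
    and iso: "L2norm (Omega D) (g0H P D Y (n + 1)) = L2norm (Omega D) (g0 P Y n)"
      "L2norm (Omega D) (g1H P D Y (n + 1)) = L2norm (Omega D) (g1 P D Y n)"
  shows "Eh2 P D Y (n + 1) - Eh2 P D Y n + Nh2 P D Y (n + 1)
       = 3/2 * ip (Omega D) (\<lambda>x. zeta P Y (n + 1) x - zetaH P D Y 2 (n + 1) x) (zeta P Y (n + 1))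
         + qs Y (n + 1) * (3/2 / (We P * Cn P) *
             (energy_form P (Omega D) (phi Y (n + 1)) (phi Y (n + 1))
              - energy_form P (Omega D) (phiH Y 2 n) (phi Y (n + 1))
              + 2 * sav Y (n + 1) * (sav Y (n + 1) - hist 2 (sav Y) n)))
         + (qs Y (n + 1) - qs Y n) * Ephi2 P D Y n
         + 3/2 / alpha_q P * qs Y (n + 1) * (qs Y (n + 1) - hist 2 (qs Y) n)"
proof -
  define K where "K = 1 / (We P * Cn P)"
  define A where "A = 1 / alpha_q P"
  have KA: "1 / (2 * We P * Cn P) = K / 2" "1 / (4 * We P * Cn P) = K / 4" "1 / (4 * alpha_q P) = A / 4"
     "3/2 / (We P * Cn P) = 3/2 * K" "3/2 / alpha_q P = 3/2 * A"
    by (simp_all add: K_def A_def)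
  have "phiH Y 2 n = (\<lambda>x. 4/3 * phi Y n x + (-1/3) * phi Y (n - 1) x)"
    by (auto simp: phiH_def hist_def algebra_simps)
  then have \<phi>: "energy_form P (Omega D) (phi Y (n + 1)) (phi Y (n + 1)) - energy_form P (Omega D) (phiH Y 2 n) (phi Y (n + 1))
      = (cns_norm2 P (Omega D) (phi Y (n + 1)) + cns_norm2 P (Omega D) (\<lambda>x. 2 * phi Y (n + 1) x - phi Y n x)
         - cns_norm2 P (Omega D) (phi Y n) - cns_norm2 P (Omega D) (\<lambda>x. 2 * phi Y n x - phi Y (n - 1) x)
         + cns_norm2 P (Omega D) (\<lambda>x. phi Y (n + 1) x - 2 * phi Y n x + phi Y (n - 1) x)) / 6"
    using cns_norm2_polarization_BDF2[OF \<Omega> H1, of P] energy_form_lincomb[OF \<Omega> H1(2,3,1), of P "4/3" "-1/3"]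
    by simp
  have \<zeta>: "ip (Omega D) (\<lambda>x. zeta P Y (n + 1) x - zetaH P D Y 2 (n + 1) x) (zeta P Y (n + 1))
      = ((L2norm (Omega D) (g0 P Y (n + 1)))\<^sup>2 + (L2norm (Omega D) (g1 P D Y (n + 1)))\<^sup>2
         - (L2norm (Omega D) (g0 P Y n))\<^sup>2 - (L2norm (Omega D) (g1 P D Y n))\<^sup>2
         + (L2norm (Omega D) (\<lambda>x. zeta P Y (n + 1) x - g1H P D Y (n + 1) x))\<^sup>2) / 6"
    using L2norm_polarization_BDF2[OF L2] iso by (simp add: zetaH_def g0_def g1_def[abs_def])
  \<comment> \<open>Truncated subtraction makes the second equation hold at \<open>n = 0\<close> as
    well.\<close>
  have idx: "n + 1 - 1 = n" "n + 1 - 2 = n - 1" by simp_all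
  show ?thesis
    unfolding \<phi> \<zeta> Eh2_def Nh2_def Ephi2_def KA K_def[symmetric] A_def[symmetric] idx
    by (simp add: hist_def power2_diff algebra_simps add_divide_distrib diff_divide_distrib) (simp add: power2_eq_square algebra_simps add_divide_distrib)
qed

theorem theorem4p4:
  fixes P :: params
    and D :: "'d::finite discretization"
    and Y :: "'d states"
    and k n :: nat
    and \<kappa> \<beta> L rho_lo rho_hi eta_lo eta_hi :: real
    and \<phi>Hh lam :: "real ^ 'd \<Rightarrow> real"
    and f :: "real ^ 'd \<Rightarrow> real ^ 'd"
  assumes dim: "CARD('d) = 2 \<or> CARD('d) = 3"
    and order: "k = 1 \<or> k = 2" and start: "k = 2 \<Longrightarrow> n \<ge> 1"
    and params: "admissible_params P"
    and domain: "polyhedral_domain (Omega D)"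
    and boundary: "boundary_partition (Omega D) (GammaD D) (GammaS D)"
    and meshes: "\<kappa> > 0" "\<And>l. l \<le> n + 1 \<Longrightarrow> admissible_mesh D \<kappa> l"
    and spaces: "\<And>l. l \<le> n + 1 \<Longrightarrow> admissible_spaces D l"
    and inf_sup: "\<beta> > 0" "\<And>l. l \<le> n + 1 \<Longrightarrow> inf_sup_condition D \<beta> l"
    and fixed_topology: "\<And>l. l \<le> n \<Longrightarrow> \<not> remesh D l \<Longrightarrow> fixed_topology_update D L k l"
    and topology_change: "\<And>l. l \<le> n \<Longrightarrow> remesh D l \<Longrightarrow> remeshing_update P D Y k l"
    and previous: "\<And>l. l \<le> n \<Longrightarrow> phi Y l \<in> Sh D l \<and> vel Y l \<in> Vh D l"
    and initial: "initial_values P D Y"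
    and density: "0 < rho_lo"
      "\<And>l. l \<le> n + 1 \<Longrightarrow>
         AE x in lebesgue_on (Omega D). rho_lo \<le> rho P (phi Y l x) \<and> rho P (phi Y l x) \<le> rho_hi"
    and viscosity: "0 < eta_lo"
      "\<And>l. l \<le> n + 1 \<Longrightarrow>
         AE x in lebesgue_on (Omega D). eta_lo \<le> eta P (phi Y l x) \<and> eta P (phi Y l x) \<le> eta_hi"
    and regularity: "finite_integrals P D Y k n lam f"
    and step1: "projected_history P D Y k n \<phi>Hh"
    and step2: "carrier_potential D Y k n lam"
    and step3: "phase_sav_update P D Y k n \<phi>Hh lam"
    and scheme: "saddle_point_update P D Y k n lam f"
    and q_pos: "qs Y (n + 1) > 0"
  shows "Eh P D Y k (n + 1) - Eh P D Y k n + Nh P D Y k (n + 1)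
         + 2 * tau P / Rey P *
             (L2norm (Omega D) (\<lambda>x. sqrt (eta P (phi Y (n + 1) x))
                                      *\<^sub>R symgrad (Omega D) (vel Y (n + 1)) x))\<^sup>2
         + tau P * qs Y (n + 1) / (Pe P * We P * Cn P) *
             ip (Omega D) (\<lambda>x. mobE P Y k n x *\<^sub>R grad (Omega D) (mu Y (n + 1)) x)
                          (grad (Omega D) (mu Y (n + 1)))
         = tau P * ip (Omega D) f (vel Y (n + 1))"
proof -
  let ?\<Omega> = "Omega D" and ?\<phi> = "phi Y (n + 1)" and ?\<mu> = "mu Y (n + 1)" and ?u = "vel Y (n + 1)"
    and ?q = "qs Y (n + 1)" and ?r = "sav Y (n + 1)" and ?\<zeta> = "zeta P Y (n + 1)"
  have \<Omega>: "open ?\<Omega>" "bounded ?\<Omega>" using domain by (auto simp: polyhedral_domain_def)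
  have pos: "Cn P > 0" "We P > 0" "Pe P > 0" "tau P > 0" "Rey P > 0" "alpha_q P > 0"
    using params by (auto simp: admissible_params_def)
  have SH: "Sh D l \<subseteq> H1 ?\<Omega>" "Vh D l \<subseteq> H1vec ?\<Omega>" "fin_dim_space ?\<Omega> (Sh D l)" if "l \<le> n + 1" for l
    using spaces[OF that] by (auto simp: admissible_spaces_def)
  have new: "?\<phi> \<in> Sh D (n + 1)" "?\<mu> \<in> Sh D (n + 1)" "?u \<in> Vh D (n + 1)"
    using step3 scheme by (auto simp: phase_sav_update_def saddle_point_update_def Let_def)
  have state: "phi Y l \<in> H1 ?\<Omega>" "vel Y l \<in> H1vec ?\<Omega>" if "l \<le> n + 1" for l
  proof -
    have "phi Y l \<in> Sh D l \<and> vel Y l \<in> Vh D l"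
      using previous[of l] new that by (cases "l = n + 1") auto
    then show "phi Y l \<in> H1 ?\<Omega>" "vel Y l \<in> H1vec ?\<Omega>" using SH[OF that] by auto
  qed
  have \<phi>m: "phi Y l \<in> borel_measurable (lebesgue_on ?\<Omega>)" if "l \<le> n + 1" for l
    by (rule L2_measurable[OF H1_L2[OF state(1)[OF that]]])
  have \<zeta>L: "zeta P Y l \<in> L2 ?\<Omega>" if "l \<le> n + 1" for l
  proof (rule zeta_L2[OF \<phi>m[OF that] H1vec_L2[OF state(2)[OF that]]])
    show "AE x in lebesgue_on ?\<Omega>. rho P (phi Y l x) \<le> rho_hi"
      using density(2)[OF that] by eventually_elim simp
    show "AE x in lebesgue_on ?\<Omega>. 0 \<le> rho P (phi Y l x)"
      using density(2)[OF that] by eventually_elim (use density(1) in linarith)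
  qed
  \<comment> \<open>Stated for every level up to \<open>n\<close>, since \<open>g1 P D Y n\<close>
    contains the history transferred by the preceding update.\<close>
  have g0H: "g0H P D Y (l + 1) \<in> L2 ?\<Omega>" "L2norm ?\<Omega> (g0H P D Y (l + 1)) = L2norm ?\<Omega> (g0 P Y l)" if l: "l \<le> n" for l
  proof -
    have "l + 1 \<le> n + 1" "l \<le> n + 1" using l by auto
    note iso = transfer_isometry[OF dim domain meshes(2)[OF this(1)] fixed_topology[OF l] topology_change[OF l],
        of "g0 P Y l"]
    show "g0H P D Y (l + 1) \<in> L2 ?\<Omega>" "L2norm ?\<Omega> (g0H P D Y (l + 1)) = L2norm ?\<Omega> (g0 P Y l)"
      using iso topology_change[OF l] \<zeta>L[OF \<open>l \<le> n + 1\<close>]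
      by (simp_all add: g0H_def g0_def remeshing_update_def)
  qed
  have g1H: "g1H P D Y (n + 1) \<in> L2 ?\<Omega>" "L2norm ?\<Omega> (g1H P D Y (n + 1)) = L2norm ?\<Omega> (g1 P D Y n)" if k: "k = 2"
  proof -
    have n: "n \<ge> 1" using start[OF k] .
    have "g0H P D Y n \<in> L2 ?\<Omega>" using g0H(1)[of "n - 1"] n by simp
    then have gL: "g1 P D Y n \<in> L2 ?\<Omega>"
      unfolding g1_def[abs_def] using \<zeta>L[of n] by (intro L2_diff L2_scaleR) auto
    note iso = transfer_isometry[OF dim domain meshes(2)[OF order_refl] fixed_topology[OF order_refl]
        topology_change[OF order_refl] _ gL]
    show "g1H P D Y (n + 1) \<in> L2 ?\<Omega>" "L2norm ?\<Omega> (g1H P D Y (n + 1)) = L2norm ?\<Omega> (g1 P D Y n)"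
      using iso topology_change[OF order_refl] n k by (simp_all add: g1H_def remeshing_update_def)
  qed

  define Z where "Z = ip ?\<Omega> (\<lambda>x. ?\<zeta> x - zetaH P D Y k (n + 1) x) ?\<zeta>"
  define I where "I = energy_form P ?\<Omega> ?\<phi> ?\<phi> - energy_form P ?\<Omega> (phiH Y k n) ?\<phi>
      + 2 * ?r * (?r - hist k (sav Y) n)"
  have increment: "Eh P D Y k (n + 1) - Eh P D Y k n + Nh P D Y k (n + 1)
      = gam k * Z + ?q * (gam k / (We P * Cn P) * I) + (?q - qs Y n) * Ephi P D Y k n
        + gam k / alpha_q P * ?q * (?q - hist k (qs Y) n)"
    using order
  proof
    assume k: "k = 1"
    show ?thesis
      using energy_increment_BE[where n = n, OF \<Omega> state(1) state(1) \<zeta>L g0H]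
      by (simp add: k Eh_def Nh_def Ephi_def Z_def I_def gam_def)
  next
    assume k: "k = 2"
    show ?thesis
      using energy_increment_BDF2[where n = n, OF \<Omega> state(1) state(1) state(1) \<zeta>L g0H(1) g1H(1) g0H(2) g1H(2)] k
      by (simp add: k Eh_def Nh_def Ephi_def Z_def I_def gam_def)
  qed

  define d\<phi> where "d\<phi> = (\<lambda>x. gam k / tau P * (?\<phi> x - \<phi>Hh x))"
  define T where "T = ip ?\<Omega> (\<lambda>x. phiE Y k n x *\<^sub>R vel_c D Y k n lam x) (grad ?\<Omega> ?\<mu>)"
  define M where "M = ip ?\<Omega> (\<lambda>x. mobE P Y k n x *\<^sub>R grad ?\<Omega> ?\<mu> x) (grad ?\<Omega> ?\<mu>)"
  define C where "C = ip ?\<Omega> (\<lambda>x. ?\<phi> x *\<^sub>R grad ?\<Omega> ?\<mu> x) ?u"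
  define V where "V = ip ?\<Omega> (\<lambda>x. eta P (?\<phi> x) *\<^sub>R symgrad ?\<Omega> ?u x) (symgrad ?\<Omega> ?u)"
  define F where "F = ip ?\<Omega> f ?u"
  \<comment> \<open>The projection equation is tested with the new phase field, which lives on the
    new mesh; in this pairing the projected history may be exchanged for the original one.\<close>
  have \<phi>Hh: "\<phi>Hh \<in> Sh D (n + 1)"
    and ritz: "energy_form P ?\<Omega> \<phi>Hh ?\<phi> = energy_form P ?\<Omega> (phiH Y k n) ?\<phi>"
    using step1 new(1) by (auto simp: projected_history_def energy_form_def)
  have d\<phi>': "d\<phi> = (\<lambda>x. gam k / tau P * ?\<phi> x + (- gam k / tau P) * \<phi>Hh x)"
    by (simp add: d\<phi>_def algebra_simps)
  \<comment> \<open>Makes the increment an admissible test function for the chemical potential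
    equation, so that \<open>ip ?\<Omega> ?\<mu> d\<phi>\<close> can be evaluated in two
    ways.\<close>
  have d\<phi>_Sh: "d\<phi> \<in> Sh D (n + 1)"
    using fin_dim_space_lincomb[OF SH(3)[OF order_refl] new(1) \<phi>Hh, of "gam k / tau P" "- gam k / tau P"]
    by (simp add: d\<phi>')
  have phase: "ip ?\<Omega> d\<phi> ?\<mu> = T - M / Pe P"
    using step3 new(2) by (auto simp: phase_sav_update_def Let_def d\<phi>_def T_def M_def)
  have "ip ?\<Omega> ?\<mu> d\<phi> = energy_form P ?\<Omega> ?\<phi> d\<phi> + ?r / UE P D Y k n * ip ?\<Omega> (dG_E P Y k n) d\<phi>"
    using step3 d\<phi>_Sh by (simp add: phase_sav_update_def Let_def energy_form_def)
  moreover have "Dtau P k (sav Y) n = 1 / (2 * UE P D Y k n) * ip ?\<Omega> (dG_E P Y k n) d\<phi>" "UE P D Y k n > 0"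
    using step3 by (simp_all add: phase_sav_update_def Let_def d\<phi>_def)
  \<comment> \<open>The auxiliary variable equation, multiplied by \<open>2 r\<close>, absorbs the
    nonlinear potential.\<close>
  then have "?r / UE P D Y k n * ip ?\<Omega> (dG_E P Y k n) d\<phi> = 2 * ?r * Dtau P k (sav Y) n"
    by (simp add: field_simps)
  moreover have "energy_form P ?\<Omega> ?\<phi> d\<phi>
      = gam k / tau P * (energy_form P ?\<Omega> ?\<phi> ?\<phi> - energy_form P ?\<Omega> (phiH Y k n) ?\<phi>)"
    using energy_form_lincomb[OF \<Omega> state(1)[OF order_refl] _ state(1)[OF order_refl], of \<phi>Hh P "gam k / tau P" "- gam k / tau P"]
      \<phi>Hh SH(1)[OF order_refl] ritz energy_form_commute[of P ?\<Omega> ?\<phi> d\<phi>]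
    by (auto simp: d\<phi>' algebra_simps)
  ultimately have "ip ?\<Omega> ?\<mu> d\<phi> = gam k / tau P * I"
    by (simp add: I_def Dtau_def algebra_simps)
  then have "gam k * I = tau P * ip ?\<Omega> d\<phi> ?\<mu>"
    using pos ip_commute[of ?\<Omega> ?\<mu> d\<phi>] by (simp add: field_simps)
  then have I_eq: "gam k * I = tau P * (T - M / Pe P)"
    by (simp only: phase)

  \<comment> \<open>The pressure itself serves as test function in the incompressibility
    constraint.\<close>
  have divp: "ip ?\<Omega> (prs Y (n + 1)) (divg ?\<Omega> ?u) = 0"
    using scheme ip_commute[of ?\<Omega> "prs Y (n + 1)" "divg ?\<Omega> ?u"]
    by (simp add: saddle_point_update_def Let_def)
  \<comment> \<open>With equal arguments the two halves of the form are the same integral.\<close>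
  have conv: "conv_form P D Y k n lam ?u ?u = 0"
    by (simp add: conv_form_def)
  \<comment> \<open>Tested with the velocity, whose density-weighted version is
    \<open>?\<zeta>\<close>; this is why the time term becomes \<open>Z\<close>.\<close>
  have "gam k / tau P * Z + conv_form P D Y k n lam ?u ?u + 2 / Rey P * V - ip ?\<Omega> (prs Y (n + 1)) (divg ?\<Omega> ?u)
      = F - ?q / (We P * Cn P) * C"
    using scheme new(3) unfolding saddle_point_update_def Let_def Z_def V_def F_def C_def zeta_def[abs_def] by blast
  then have "gam k / tau P * Z = F - ?q / (We P * Cn P) * C - 2 / Rey P * V"
    unfolding conv divp by linarith
  then have Z_eq: "gam k * Z = tau P * (F - ?q / (We P * Cn P) * C - 2 / Rey P * V)"
    using pos by (simp add: field_simps)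
  have q_scheme: "gam k * ?q / (alpha_q P * tau P) * (?q - hist k (qs Y) n) + (?q - qs Y n) / tau P * Ephi P D Y k n
      + ?q / (We P * Cn P) * T - ?q / (We P * Cn P) * C = 0"
    using scheme unfolding saddle_point_update_def Let_def T_def C_def by blast
  have q_eq: "(?q - qs Y n) * Ephi P D Y k n + gam k / alpha_q P * ?q * (?q - hist k (qs Y) n)
      = tau P * (?q / (We P * Cn P) * C - ?q / (We P * Cn P) * T)"
  proof -
    have "(?q - qs Y n) * Ephi P D Y k n + gam k / alpha_q P * ?q * (?q - hist k (qs Y) n)
      = tau P * (gam k * ?q / (alpha_q P * tau P) * (?q - hist k (qs Y) n) + (?q - qs Y n) / tau P * Ephi P D Y k n)"
      using pos by (simp add: distrib_left)
    also have "\<dots> = tau P * (?q / (We P * Cn P) * C - ?q / (We P * Cn P) * T)"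
      using q_scheme by (intro arg_cong[of _ _ "\<lambda>x. tau P * x"]) linarith
    finally show ?thesis .
  qed
  have V_eq: "(L2norm ?\<Omega> (\<lambda>x. sqrt (eta P (?\<phi> x)) *\<^sub>R symgrad ?\<Omega> ?u x))\<^sup>2 = V"
    unfolding V_def
  proof (rule ip_sqrt_weight)
    show "(\<lambda>x. eta P (?\<phi> x)) \<in> borel_measurable (lebesgue_on ?\<Omega>)"
      unfolding eta_def using \<phi>m[OF order_refl] by measurable
    show "AE x in lebesgue_on ?\<Omega>. 0 \<le> eta P (?\<phi> x)"
      using viscosity(2)[OF order_refl] by eventually_elim (use viscosity(1) in linarith)
    show "symgrad ?\<Omega> ?u \<in> borel_measurable (lebesgue_on ?\<Omega>)"
      by (rule symgrad_measurable[OF state(2)[OF order_refl]])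
  qed
  have scaled: "gam k / (We P * Cn P) * I = tau P * (T - M / Pe P) / (We P * Cn P)"
    by (simp flip: I_eq)
  \<comment> \<open>The capillary work \<open>C\<close> cancels between momentum and scalar
    equation, the transport work \<open>T\<close> between phase and scalar equation; only force,
    viscous and mobility terms are left.\<close>
  have "Eh P D Y k (n + 1) - Eh P D Y k n + Nh P D Y k (n + 1)
      = tau P * (F - ?q / (We P * Cn P) * C - 2 / Rey P * V)
        + ?q * (tau P * (T - M / Pe P) / (We P * Cn P))
        + tau P * (?q / (We P * Cn P) * C - ?q / (We P * Cn P) * T)"
    unfolding increment scaled Z_eq using q_eq by linarith
  then show ?thesis
    unfolding V_eq M_def[symmetric] F_def[symmetric]
    by (simp add: algebra_simps diff_divide_distrib)
qed

end
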